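(* Let $(N,g,J)$ be a $6$-dimensional strict nearly Kähler manifold and let $M$ be a Lagrangian submanifold of $N$ with second fundamental form $h$. Then $M$ is isotropic, i.e. there is a non-negative function $\mu$ on $M$ such that $$g(h(v,v),h(v,v))=\mu^2(p)\,(g(v,v))^2\qquad\text{for all } p\in M,\ v\in T_pM,$$ if and only if $M$ is totally geodesic (i.e. $h\equiv 0$).
   Context: A nearly Kähler (NK) manifold is an almost Hermitian manifold $(N,g,J)$ such that $\tilde\nabla J$ is skew-symmetric, i.e. $(\tilde\nabla_XJ)X=0$ for all tangent vectors $X$, where $\tilde\nabla$ is the Levi-Civita connection of $g$. It is strict if $\tilde\nabla_XJ\neq 0$ for every nonzero tangent vector $X$. A submanifold $M$ of an almost Hermitian manifold $N$ is Lagrangian if $J$ interchanges the tangent and normal spaces of $M$, i.e. $J(TM)=T^\perp M$; thus $\dim M=\tfrac12\dim N$. The second fundamental form $h$ is defined by $\tilde\nabla_XY=\nabla_XY+h(X,Y)$ for $X,Y$ tangent to $M$, where $\nabla_XY$ is the tangential and $h(X,Y)$ the normal component. *)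

theory Defs
  imports "HOL-Analysis.Analysis"
begin

section \<open>Smooth maps between Euclidean spaces\<close>

text \<open>Only used for open \<open>S\<close>; there it is the usual notion of a \<open>C\<^sup>k\<close> map, since the domain is
  finite-dimensional.\<close>

primrec Ck_on :: "nat \<Rightarrow> 'n::euclidean_space set \<Rightarrow> ('n \<Rightarrow> 'b::real_normed_vector) \<Rightarrow> bool" where
  "Ck_on 0 S f \<longleftrightarrow> continuous_on S f"
| "Ck_on (Suc k) S f \<longleftrightarrow>
     (\<forall>x\<in>S. f differentiable (at x)) \<and> (\<forall>v. Ck_on k S (\<lambda>x. frechet_derivative f (at x) v))"

definition smooth_on :: "'n::euclidean_space set \<Rightarrow> ('n \<Rightarrow> 'b::real_normed_vector) \<Rightarrow> bool" where
  "smooth_on S f \<longleftrightarrow> (\<forall>k. Ck_on k S f)"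


section \<open>Smooth manifolds\<close>

text \<open>A chart is a pair of a domain and a coordinate map (only its values on the domain matter).
  The dimension of a manifold is \<open>DIM('n)\<close>. The atlas need not be maximal.\<close>

type_synonym ('a, 'n) chart = "'a set \<times> ('a \<Rightarrow> 'n)"

record ('a, 'n) manifold =
  mtop :: "'a topology"
  atlas :: "('a, 'n) chart set"

abbreviation points :: "('a, 'n) manifold \<Rightarrow> 'a set" where
  "points N \<equiv> topspace (mtop N)"

abbreviation chart_inv :: "('a, 'n) chart \<Rightarrow> 'n \<Rightarrow> 'a" where
  "chart_inv c \<equiv> inv_into (fst c) (snd c)"

definition is_chart :: "'a topology \<Rightarrow> ('a, 'n::euclidean_space) chart \<Rightarrow> bool" where
  "is_chart X c \<longleftrightarrow> openin X (fst c) \<and> open (snd c ` fst c) \<and>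
     homeomorphic_map (subtopology X (fst c)) (top_of_set (snd c ` fst c)) (snd c)"

definition smooth_manifold :: "('a, 'n::euclidean_space) manifold \<Rightarrow> bool" where
  "smooth_manifold N \<longleftrightarrow>
     Hausdorff_space (mtop N) \<and> second_countable (mtop N) \<and>
     (\<forall>c\<in>atlas N. is_chart (mtop N) c) \<and>
     points N = (\<Union>c\<in>atlas N. fst c) \<and>
     (\<forall>c\<in>atlas N. \<forall>d\<in>atlas N. smooth_on (snd c ` (fst c \<inter> fst d)) (snd d \<circ> chart_inv c))"

definition smooth_fun_on ::
  "('a, 'n::euclidean_space) manifold \<Rightarrow> 'a set \<Rightarrow> ('a \<Rightarrow> 'b::real_normed_vector) \<Rightarrow> bool" where
  "smooth_fun_on N U f \<longleftrightarrow> (\<forall>c\<in>atlas N. smooth_on (snd c ` (U \<inter> fst c)) (f \<circ> chart_inv c))"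

definition smooth_map ::
  "('a, 'm::euclidean_space) manifold \<Rightarrow> ('b, 'n::euclidean_space) manifold \<Rightarrow> ('a \<Rightarrow> 'b) \<Rightarrow> bool" where
  "smooth_map M N F \<longleftrightarrow> continuous_map (mtop M) (mtop N) F \<and>
     (\<forall>c\<in>atlas M. \<forall>d\<in>atlas N.
        smooth_on (snd c ` (fst c \<inter> F -` fst d)) (snd d \<circ> F \<circ> chart_inv c))"


section \<open>Tangent vectors and vector fields\<close>

text \<open>The tangent space \<open>T\<^sub>pN\<close> is modelled by the whole type \<open>'n\<close>: the vector \<open>v :: 'n\<close> stands for the
  tangent vector at \<open>p\<close> whose components in one fixed chart around \<open>p\<close>, \<open>chart_at N p\<close>, are \<open>v\<close>.
  As \<open>chart_at N p\<close> may jump with \<open>p\<close>, a vector field \<open>Y :: 'a \<Rightarrow> 'n\<close> is smooth when its components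
  \<open>coords N c q (Y q)\<close> in the charts \<open>c\<close> of the atlas are smooth functions of \<open>q\<close>, not when \<open>Y\<close> is.
  The inner product that the type \<open>'n\<close> carries plays no geometric role.\<close>

definition chart_at :: "('a, 'n) manifold \<Rightarrow> 'a \<Rightarrow> ('a, 'n) chart" where
  "chart_at N p = (SOME c. c \<in> atlas N \<and> p \<in> fst c)"

text \<open>The derivative \<open>v f\<close> of a function \<open>f\<close> defined near \<open>p\<close> in the direction of \<open>v \<in> T\<^sub>pN\<close>.\<close>

definition dir_deriv ::
  "('a, 'n::euclidean_space) manifold \<Rightarrow> 'a \<Rightarrow> 'n \<Rightarrow> ('a \<Rightarrow> 'b::real_normed_vector) \<Rightarrow> 'b" where
  "dir_deriv N p v f =
     frechet_derivative (f \<circ> chart_inv (chart_at N p)) (at (snd (chart_at N p) p)) v"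

definition coords ::
  "('a, 'n::euclidean_space) manifold \<Rightarrow> ('a, 'n) chart \<Rightarrow> 'a \<Rightarrow> 'n \<Rightarrow> 'n" where
  "coords N c p v = dir_deriv N p v (snd c)"

text \<open>The vector field on the domain of \<open>c\<close> with constant components \<open>b\<close> in the chart \<open>c\<close>; for \<open>b\<close> in
  the standard basis these are the coordinate fields of \<open>c\<close>.\<close>

definition coord_field ::
  "('a, 'n::euclidean_space) manifold \<Rightarrow> ('a, 'n) chart \<Rightarrow> 'n \<Rightarrow> 'a \<Rightarrow> 'n" where
  "coord_field N c b p =
     frechet_derivative (snd (chart_at N p) \<circ> chart_inv c) (at (snd c p)) b"

definition smooth_field_on ::
  "('a, 'n::euclidean_space) manifold \<Rightarrow> 'a set \<Rightarrow> ('a \<Rightarrow> 'n) \<Rightarrow> bool" where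
  "smooth_field_on N U Y \<longleftrightarrow> (\<forall>c\<in>atlas N.
     smooth_on (snd c ` (U \<inter> fst c)) ((\<lambda>q. coords N c q (Y q)) \<circ> chart_inv c))"

definition smooth_fun_near ::
  "('a, 'n::euclidean_space) manifold \<Rightarrow> 'a \<Rightarrow> ('a \<Rightarrow> real) \<Rightarrow> bool" where
  "smooth_fun_near N p f \<longleftrightarrow> (\<exists>U. openin (mtop N) U \<and> p \<in> U \<and> smooth_fun_on N U f)"

definition smooth_field_near ::
  "('a, 'n::euclidean_space) manifold \<Rightarrow> 'a \<Rightarrow> ('a \<Rightarrow> 'n) \<Rightarrow> bool" where
  "smooth_field_near N p Y \<longleftrightarrow> (\<exists>U. openin (mtop N) U \<and> p \<in> U \<and> smooth_field_on N U Y)"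

definition tangent_map ::
  "('a, 'm::euclidean_space) manifold \<Rightarrow> ('b, 'n::euclidean_space) manifold \<Rightarrow> ('a \<Rightarrow> 'b) \<Rightarrow> 'a \<Rightarrow> 'm \<Rightarrow> 'n"
  where "tangent_map M N F p v = dir_deriv M p v (snd (chart_at N (F p)) \<circ> F)"

definition immersion ::
  "('a, 'm::euclidean_space) manifold \<Rightarrow> ('b, 'n::euclidean_space) manifold \<Rightarrow> ('a \<Rightarrow> 'b) \<Rightarrow> bool" where
  "immersion M N F \<longleftrightarrow> smooth_map M N F \<and> (\<forall>p\<in>points M. inj (tangent_map M N F p))"


section \<open>Almost Hermitian manifolds\<close>

definition riemannian_metric ::
  "('a, 'n::euclidean_space) manifold \<Rightarrow> ('a \<Rightarrow> 'n \<Rightarrow> 'n \<Rightarrow> real) \<Rightarrow> bool" where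
  "riemannian_metric N g \<longleftrightarrow>
     (\<forall>p\<in>points N. bilinear (g p) \<and> (\<forall>u v. g p u v = g p v u) \<and> (\<forall>v. v \<noteq> 0 \<longrightarrow> g p v v > 0)) \<and>
     (\<forall>U X Y. openin (mtop N) U \<and> smooth_field_on N U X \<and> smooth_field_on N U Y \<longrightarrow>
        smooth_fun_on N U (\<lambda>q. g q (X q) (Y q)))"

definition almost_complex_structure ::
  "('a, 'n::euclidean_space) manifold \<Rightarrow> ('a \<Rightarrow> 'n \<Rightarrow> 'n) \<Rightarrow> bool" where
  "almost_complex_structure N J \<longleftrightarrow>
     (\<forall>p\<in>points N. linear (J p) \<and> (\<forall>v. J p (J p v) = - v)) \<and>
     (\<forall>U X. openin (mtop N) U \<and> smooth_field_on N U X \<longrightarrow> smooth_field_on N U (\<lambda>q. J q (X q)))"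

definition almost_hermitian ::
  "('a, 'n::euclidean_space) manifold \<Rightarrow> ('a \<Rightarrow> 'n \<Rightarrow> 'n \<Rightarrow> real) \<Rightarrow> ('a \<Rightarrow> 'n \<Rightarrow> 'n) \<Rightarrow> bool" where
  "almost_hermitian N g J \<longleftrightarrow>
     smooth_manifold N \<and> riemannian_metric N g \<and> almost_complex_structure N J \<and>
     (\<forall>p\<in>points N. \<forall>u v. g p (J p u) (J p v) = g p u v)"


section \<open>The Levi-Civita connection\<close>

text \<open>\<open>D p v Y\<close> is the covariant derivative at \<open>p\<close>, in the direction \<open>v \<in> T\<^sub>pN\<close>, of a field \<open>Y\<close> that is
  smooth near \<open>p\<close>. Since the function \<open>f\<close> in the Leibniz rule need only be smooth near \<open>p\<close> (it may be
  \<open>0\<close> away from \<open>p\<close>), the rule forces \<open>D p v Y\<close> to depend only on the germ of \<open>Y\<close> at \<open>p\<close>.\<close>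

type_synonym ('a, 'n) connection = "'a \<Rightarrow> 'n \<Rightarrow> ('a \<Rightarrow> 'n) \<Rightarrow> 'n"

definition affine_connection ::
  "('a, 'n::euclidean_space) manifold \<Rightarrow> ('a, 'n) connection \<Rightarrow> bool" where
  "affine_connection N D \<longleftrightarrow>
     (\<forall>p\<in>points N. \<forall>Y. smooth_field_near N p Y \<longrightarrow>
        linear (\<lambda>v. D p v Y) \<and>
        (\<forall>v Z. smooth_field_near N p Z \<longrightarrow> D p v (\<lambda>q. Y q + Z q) = D p v Y + D p v Z) \<and>
        (\<forall>v f. smooth_fun_near N p f \<longrightarrow>
           D p v (\<lambda>q. f q *\<^sub>R Y q) = dir_deriv N p v f *\<^sub>R Y p + f p *\<^sub>R D p v Y)) \<and>
     (\<forall>U X Y. openin (mtop N) U \<and> smooth_field_on N U X \<and> smooth_field_on N U Y \<longrightarrow>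
        smooth_field_on N U (\<lambda>q. D q (X q) Y))"

text \<open>\<open>D\<^sub>X Y - D\<^sub>Y X = [X, Y]\<close>, where the bracket is determined by \<open>[X, Y] f = X (Y f) - Y (X f)\<close>.\<close>

definition torsion_free ::
  "('a, 'n::euclidean_space) manifold \<Rightarrow> ('a, 'n) connection \<Rightarrow> bool" where
  "torsion_free N D \<longleftrightarrow>
     (\<forall>p\<in>points N. \<forall>X Y f.
        smooth_field_near N p X \<and> smooth_field_near N p Y \<and> smooth_fun_near N p f \<longrightarrow>
        dir_deriv N p (D p (X p) Y - D p (Y p) X) f =
          dir_deriv N p (X p) (\<lambda>q. dir_deriv N q (Y q) f) -
          dir_deriv N p (Y p) (\<lambda>q. dir_deriv N q (X q) f))"

definition metric_connection ::
  "('a, 'n::euclidean_space) manifold \<Rightarrow> ('a \<Rightarrow> 'n \<Rightarrow> 'n \<Rightarrow> real) \<Rightarrow> ('a, 'n) connection \<Rightarrow> bool" where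
  "metric_connection N g D \<longleftrightarrow>
     (\<forall>p\<in>points N. \<forall>v Y Z. smooth_field_near N p Y \<and> smooth_field_near N p Z \<longrightarrow>
        dir_deriv N p v (\<lambda>q. g q (Y q) (Z q)) = g p (D p v Y) (Z p) + g p (Y p) (D p v Z))"

definition levi_civita ::
  "('a, 'n::euclidean_space) manifold \<Rightarrow> ('a \<Rightarrow> 'n \<Rightarrow> 'n \<Rightarrow> real) \<Rightarrow> ('a, 'n) connection \<Rightarrow> bool" where
  "levi_civita N g D \<longleftrightarrow> affine_connection N D \<and> torsion_free N D \<and> metric_connection N g D"


section \<open>Nearly Kaehler manifolds\<close>

text \<open>\<open>(D\<^sub>v J) Y = D\<^sub>v (J Y) - J (D\<^sub>v Y)\<close>, which depends only on \<open>Y p\<close>.\<close>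

definition cov_deriv_J ::
  "('a, 'n::euclidean_space) connection \<Rightarrow> ('a \<Rightarrow> 'n \<Rightarrow> 'n) \<Rightarrow> 'a \<Rightarrow> 'n \<Rightarrow> ('a \<Rightarrow> 'n) \<Rightarrow> 'n" where
  "cov_deriv_J D J p v Y = D p v (\<lambda>q. J q (Y q)) - J p (D p v Y)"

definition nearly_kaehler ::
  "('a, 'n::euclidean_space) manifold \<Rightarrow> ('a \<Rightarrow> 'n \<Rightarrow> 'n \<Rightarrow> real) \<Rightarrow> ('a \<Rightarrow> 'n \<Rightarrow> 'n) \<Rightarrow>
   ('a, 'n) connection \<Rightarrow> bool" where
  "nearly_kaehler N g J D \<longleftrightarrow> almost_hermitian N g J \<and> levi_civita N g D \<and>
     (\<forall>p\<in>points N. \<forall>X. smooth_field_near N p X \<longrightarrow> cov_deriv_J D J p (X p) X = 0)"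

definition strict_nearly_kaehler ::
  "('a, 'n::euclidean_space) manifold \<Rightarrow> ('a \<Rightarrow> 'n \<Rightarrow> 'n \<Rightarrow> real) \<Rightarrow> ('a \<Rightarrow> 'n \<Rightarrow> 'n) \<Rightarrow>
   ('a, 'n) connection \<Rightarrow> bool" where
  "strict_nearly_kaehler N g J D \<longleftrightarrow> nearly_kaehler N g J D \<and>
     (\<forall>p\<in>points N. \<forall>v. v \<noteq> 0 \<longrightarrow> (\<exists>Y. smooth_field_near N p Y \<and> cov_deriv_J D J p v Y \<noteq> 0))"


section \<open>Lagrangian submanifolds and the second fundamental form\<close>

text \<open>Submanifolds are immersed: \<open>M\<close> is a manifold in its own right and \<open>F\<close> an immersion of \<open>M\<close> into
  \<open>N\<close>. Tangent and normal spaces at \<open>p \<in> M\<close> are subspaces of \<open>T\<^sub>F\<^sub>pN\<close>.\<close>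

definition tangent_space ::
  "('a, 'm::euclidean_space) manifold \<Rightarrow> ('b, 'n::euclidean_space) manifold \<Rightarrow> ('a \<Rightarrow> 'b) \<Rightarrow> 'a \<Rightarrow> 'n set"
  where "tangent_space M N F p = range (tangent_map M N F p)"

definition normal_space ::
  "('a, 'm::euclidean_space) manifold \<Rightarrow> ('b, 'n::euclidean_space) manifold \<Rightarrow>
   ('b \<Rightarrow> 'n \<Rightarrow> 'n \<Rightarrow> real) \<Rightarrow> ('a \<Rightarrow> 'b) \<Rightarrow> 'a \<Rightarrow> 'n set" where
  "normal_space M N g F p = {u. \<forall>w\<in>tangent_space M N F p. g (F p) u w = 0}"

definition lagrangian ::
  "('a, 'm::euclidean_space) manifold \<Rightarrow> ('b, 'n::euclidean_space) manifold \<Rightarrow>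
   ('b \<Rightarrow> 'n \<Rightarrow> 'n \<Rightarrow> real) \<Rightarrow> ('b \<Rightarrow> 'n \<Rightarrow> 'n) \<Rightarrow> ('a \<Rightarrow> 'b) \<Rightarrow> bool" where
  "lagrangian M N g J F \<longleftrightarrow> smooth_manifold M \<and> immersion M N F \<and>
     (\<forall>p\<in>points M. J (F p) ` tangent_space M N F p = normal_space M N g F p)"

text \<open>The covariant derivative along \<open>F\<close>, at \<open>p\<close> and in the direction \<open>v \<in> T\<^sub>pM\<close>, of a field \<open>V\<close> along
  \<open>F\<close> (so \<open>V q \<in> T\<^sub>F\<^sub>qN\<close>). Writing \<open>V = \<Sum>\<^sub>b V\<^sup>b (E\<^sub>b \<circ> F)\<close> near \<open>p\<close> with the coordinate fields \<open>E\<^sub>b\<close> of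
  a chart around \<open>F p\<close>, it is \<open>\<Sum>\<^sub>b (v V\<^sup>b) E\<^sub>b + V\<^sup>b D\<^sub>d\<^sub>F\<^sub>v E\<^sub>b\<close>. If \<open>V = Z \<circ> F\<close> for a field \<open>Z\<close> on \<open>N\<close>,
  this is \<open>D\<^sub>d\<^sub>F\<^sub>v Z\<close>.\<close>

definition cov_deriv_along ::
  "('a, 'm::euclidean_space) manifold \<Rightarrow> ('b, 'n::euclidean_space) manifold \<Rightarrow> ('b, 'n) connection \<Rightarrow>
   ('a \<Rightarrow> 'b) \<Rightarrow> 'a \<Rightarrow> 'm \<Rightarrow> ('a \<Rightarrow> 'n) \<Rightarrow> 'n" where
  "cov_deriv_along M N D F p v V = (let c = chart_at N (F p) in
     \<Sum>b\<in>Basis.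
       dir_deriv M p v (\<lambda>q. coords N c (F q) (V q) \<bullet> b) *\<^sub>R coord_field N c b (F p) +
       (coords N c (F p) (V p) \<bullet> b) *\<^sub>R D (F p) (tangent_map M N F p v) (coord_field N c b))"

text \<open>Gauss formula: \<open>h(v, Y p)\<close> is the normal component of the ambient derivative \<open>D\<^sub>v Y\<close>, for every
  vector field \<open>Y\<close> on \<open>M\<close>.\<close>

definition second_fundamental_form ::
  "('a, 'm::euclidean_space) manifold \<Rightarrow> ('b, 'n::euclidean_space) manifold \<Rightarrow>
   ('b \<Rightarrow> 'n \<Rightarrow> 'n \<Rightarrow> real) \<Rightarrow> ('b, 'n) connection \<Rightarrow> ('a \<Rightarrow> 'b) \<Rightarrow> ('a \<Rightarrow> 'm \<Rightarrow> 'm \<Rightarrow> 'n) \<Rightarrow> bool" where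
  "second_fundamental_form M N g D F h \<longleftrightarrow>
     (\<forall>p\<in>points M. \<forall>v Y. smooth_field_near M p Y \<longrightarrow>
        h p v (Y p) \<in> normal_space M N g F p \<and>
        cov_deriv_along M N D F p v (\<lambda>q. tangent_map M N F q (Y q)) - h p v (Y p)
          \<in> tangent_space M N F p)"

text \<open>In the next definition \<open>g(v, v)\<close> for \<open>v \<in> T\<^sub>pM\<close> is the induced metric.\<close>

definition isotropic ::
  "('a, 'm::euclidean_space) manifold \<Rightarrow> ('b, 'n::euclidean_space) manifold \<Rightarrow>
   ('b \<Rightarrow> 'n \<Rightarrow> 'n \<Rightarrow> real) \<Rightarrow> ('a \<Rightarrow> 'b) \<Rightarrow> ('a \<Rightarrow> 'm \<Rightarrow> 'm \<Rightarrow> 'n) \<Rightarrow> bool" where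
  "isotropic M N g F h \<longleftrightarrow> (\<exists>\<mu>::'a \<Rightarrow> real. \<forall>p\<in>points M. \<mu> p \<ge> 0 \<and>
     (\<forall>v. g (F p) (h p v v) (h p v v) =
        (\<mu> p)\<^sup>2 * (g (F p) (tangent_map M N F p v) (tangent_map M N F p v))\<^sup>2))"

definition totally_geodesic ::
  "('a, 'm) manifold \<Rightarrow> ('a \<Rightarrow> 'm \<Rightarrow> 'm \<Rightarrow> 'n::real_vector) \<Rightarrow> bool" where
  "totally_geodesic M h \<longleftrightarrow> (\<forall>p\<in>points M. \<forall>v w. h p v w = 0)"

end

theory Submission
  imports Defs
begin

text \<open>Put \<open>T(X,Y,Z) = g((D\<^sub>X J)Y, Z)\<close>, an alternating form of type (3,0)+(0,3), and \<open>C(X,Y,Z) = g(h(X,Y), JZ)\<close>.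
  Differentiating the Lagrangian condition gives \<open>T(X,Y,Z) = C(X,Y,Z) - C(X,Z,Y)\<close> on \<open>M\<close>; the cyclic sum shows
  that \<open>T\<close> vanishes on \<open>TM\<close> and \<open>C\<close> is totally symmetric. Differentiating \<open>T = 0\<close> on \<open>TM\<close> gives
  \<open>(D\<^sub>W T)(X,Y,Z) + T(h(W,X),Y,Z) + T(X,h(W,Y),Z) + T(X,Y,h(W,Z)) = 0\<close>. The Ricci identity for \<open>J\<close> and the
  symmetries of the curvature tensor force the (3,0)+(0,3) part of \<open>D\<^sub>W T\<close> to vanish, and then \<open>D\<^sub>W T\<close> is zero
  on \<open>TM\<close>; the remaining terms add up to a nonzero multiple of the mean curvature, so \<open>M\<close> is minimal. At a
  point, an isotropic \<open>h\<close> with zero trace and values in a 3-dimensional space is zero by polarization.\<close>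

section \<open>Directional derivatives\<close>

text \<open>\<open>D_W T\<close> itself need not vanish: only its (3,0)+(0,3) part does, and that
  part must be separated without a connection preserving \<open>J\<close>. This is done with the
  Levi-Civita connection and curvature algebra alone. What is left of \<open>D_W T\<close> on
  \<open>TM\<close> reduces to terms quadratic in \<open>DJ\<close>, and these vanish because
  \<open>DJ\<close> sends pairs of tangent vectors to normal vectors. Dimension 6 enters twice. In
  complex dimension 3 an alternating (3,0) form is a single complex number, so on an orthonormal
  frame each of the three terms with \<open>h\<close> is a diagonal entry of \<open>C\<close> times
  one real number, which strictness keeps away from 0; their sum is therefore a trace. Secondly,
  isotropy and zero trace would produce four independent normal vectors, one too many.
  \<open>h\<close> is given only pointwise by the Gauss formula. The differentiations are carried
  out with the full covariant second derivative \<open>B\<close> of the immersion, which differs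
  from \<open>h\<close> by a tangent vector that \<open>T\<close> does not see on
  \<open>TM\<close>.\<close>

abbreviation dd :: "'n::euclidean_space \<Rightarrow> ('n \<Rightarrow> 'b::real_normed_vector) \<Rightarrow> 'n \<Rightarrow> 'b"
  where "dd w f x \<equiv> frechet_derivative f (at x) w"

lemma dd_eqI: "(f has_derivative f') (at x) \<Longrightarrow> dd w f x = f' w"
  by (simp add: frechet_derivative_at[symmetric])

lemma dd_works: "f differentiable (at x) \<Longrightarrow> (f has_derivative (\<lambda>w. dd w f x)) (at x)"
  using frechet_derivative_works by fastforce

text \<open>Both sides are the same choice from the same set of derivatives, so the equation holds
  also at points where \<open>f\<close> has no derivative.\<close>

lemma dd_cong_open:
  assumes "open S" "x \<in> S" "\<And>y. y \<in> S \<Longrightarrow> f y = g y"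
  shows "frechet_derivative f (at x) = frechet_derivative g (at x)"
proof -
  have "(f has_derivative D) (at x) \<longleftrightarrow> (g has_derivative D) (at x)" for D
    using has_derivative_transform_within_open[OF _ assms(1,2), of f D UNIV g]
      has_derivative_transform_within_open[OF _ assms(1,2), of g D UNIV f] assms(3) by metis
  then show ?thesis
    by (simp add: frechet_derivative_def)
qed

lemma differentiable_cong_open:
  assumes "open S" "x \<in> S" "\<And>y. y \<in> S \<Longrightarrow> f y = g y" "f differentiable (at x)"
  shows "g differentiable (at x)"
  using assms unfolding differentiable_def
  by (metis has_derivative_transform_within_open)

lemma dd_chain:
  assumes "g differentiable (at x)" "f differentiable (at (g x))"
  shows "dd w (\<lambda>y. f (g y)) x = dd (dd w g x) f (g x)"
  using has_derivative_compose[OF dd_works[OF assms(1)] dd_works[OF assms(2)]]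
  by (rule dd_eqI)

lemma dd_linear:
  assumes "f differentiable (at x)"
  shows "linear (\<lambda>w. dd w f x)"
  using linear_frechet_derivative[OF assms] by (simp add: eta_contract_eq)

lemma dd_bounded_linear:
  assumes "bounded_linear L" "f differentiable (at x)"
  shows "dd w (\<lambda>y. L (f y)) x = L (dd w f x)"
  using bounded_linear.has_derivative[OF assms(1) dd_works[OF assms(2)]] by (rule dd_eqI)

lemma linear_expand_Basis:
  fixes L :: "'n::euclidean_space \<Rightarrow> 'b::real_vector"
  assumes "linear L"
  shows "L v = (\<Sum>b\<in>Basis. (v \<bullet> b) *\<^sub>R L b)"
proof -
  have "L (\<Sum>b\<in>Basis. (v \<bullet> b) *\<^sub>R b) = (\<Sum>b\<in>Basis. (v \<bullet> b) *\<^sub>R L b)"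
    by (simp add: linear_sum[OF assms] linear_scale[OF assms])
  then show ?thesis by (simp add: euclidean_representation)
qed

lemma dd_euclidean_sum:
  fixes f :: "'n::euclidean_space \<Rightarrow> 'b::real_normed_vector"
  assumes "f differentiable (at x)"
  shows "dd w f x = (\<Sum>b\<in>Basis. (w \<bullet> b) *\<^sub>R dd b f x)"
  by (rule linear_expand_Basis[OF dd_linear[OF assms]])


section \<open>Maps of class \<open>C\<^sup>k\<close>\<close>

lemma Ck_on_cong:
  assumes "open S" "\<And>x. x \<in> S \<Longrightarrow> f x = g x"
  shows "Ck_on k S f \<longleftrightarrow> Ck_on k S g"
  using assms(2)
proof (induction k arbitrary: f g)
  case 0
  then show ?case by (simp cong: continuous_on_cong)
next
  case (Suc k)
  have "Ck_on k S (\<lambda>x. dd v f x) \<longleftrightarrow> Ck_on k S (\<lambda>x. dd v g x)" for v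
    by (rule Suc.IH) (metis dd_cong_open[OF assms(1)] Suc.prems)
  moreover have "f differentiable (at x) \<longleftrightarrow> g differentiable (at x)" if "x \<in> S" for x
    using differentiable_cong_open[OF assms(1) that] Suc.prems by metis
  ultimately show ?case by simp
qed

lemma Ck_on_Suc_imp: "Ck_on (Suc k) S f \<Longrightarrow> Ck_on k S f"
proof (induction k arbitrary: f)
  case 0
  then show ?case
    by (simp add: continuous_at_imp_continuous_on differentiable_imp_continuous_within)
next
  case (Suc k)
  show ?case
    unfolding Ck_on.simps(2)[of k]
  proof (intro conjI allI)
    show "\<forall>x\<in>S. f differentiable at x" using Suc.prems by simp
    show "Ck_on k S (\<lambda>x. dd v f x)" for v
      by (rule Suc.IH) (use Suc.prems in \<open>simp del: Ck_on.simps add: Ck_on.simps(2)[of "Suc k"]\<close>)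
  qed
qed

lemma Ck_on_subset: "Ck_on k S f \<Longrightarrow> T \<subseteq> S \<Longrightarrow> Ck_on k T f"
  by (induction k arbitrary: f) (auto intro: continuous_on_subset)

lemma Ck_on_const: "Ck_on k S (\<lambda>x. c)"
  by (induction k arbitrary: c) auto

lemma Ck_on_add:
  assumes "open S" "Ck_on k S f" "Ck_on k S g"
  shows "Ck_on k S (\<lambda>x. f x + g x)"
  using assms(2,3)
proof (induction k arbitrary: f g)
  case 0
  then show ?case by (simp add: continuous_on_add)
next
  case (Suc k)
  have "dd v (\<lambda>x. f x + g x) x = dd v f x + dd v g x" if "x \<in> S" for x v
    by (rule dd_eqI) (use Suc.prems that in \<open>auto intro!: has_derivative_add dd_works\<close>)
  then have "Ck_on k S (\<lambda>x. dd v (\<lambda>x. f x + g x) x)" for v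
    using Suc by (subst Ck_on_cong[OF assms(1), where g = "\<lambda>x. dd v f x + dd v g x"]) auto
  then show ?case using Suc.prems by simp
qed

lemma Ck_on_sum:
  assumes "open S" "\<And>i. i \<in> I \<Longrightarrow> Ck_on k S (f i)"
  shows "Ck_on k S (\<lambda>x. \<Sum>i\<in>I. f i x)"
  using assms(2)
  by (induction I rule: infinite_finite_induct) (auto intro: Ck_on_const Ck_on_add[OF assms(1)])

lemma Ck_on_bounded_linear:
  assumes "open S" "bounded_linear L" "Ck_on k S f"
  shows "Ck_on k S (\<lambda>x. L (f x))"
  using assms(3)
proof (induction k arbitrary: f)
  case 0
  then show ?case by (simp add: bounded_linear.continuous_on[OF assms(2)])
next
  case (Suc k)
  have "dd v (\<lambda>x. L (f x)) x = L (dd v f x)" if "x \<in> S" for x v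
    by (rule dd_bounded_linear[OF assms(2)]) (use Suc.prems that in auto)
  then have "Ck_on k S (\<lambda>x. dd v (\<lambda>x. L (f x)) x)" for v
    using Suc by (subst Ck_on_cong[OF assms(1), where g = "\<lambda>x. L (dd v f x)"]) auto
  moreover have "(\<lambda>x. L (f x)) differentiable (at x)" if "x \<in> S" for x
    using bounded_linear.has_derivative[OF assms(2) dd_works, of f x] Suc.prems that
    by (auto intro: differentiableI)
  ultimately show ?case by simp
qed

lemma Ck_on_scaleR:
  fixes f :: "'n::euclidean_space \<Rightarrow> real"
  assumes "open S" "Ck_on k S f" "Ck_on k S g"
  shows "Ck_on k S (\<lambda>x. f x *\<^sub>R g x)"
  using assms(2,3)
proof (induction k arbitrary: f g)
  case 0
  then show ?case by (simp add: continuous_on_scaleR)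
next
  case (Suc k)
  have d: "f differentiable (at x)" "g differentiable (at x)" if "x \<in> S" for x
    using Suc.prems that by auto
  have *: "dd v (\<lambda>x. f x *\<^sub>R g x) x = f x *\<^sub>R dd v g x + dd v f x *\<^sub>R g x" if "x \<in> S" for x v
    by (rule dd_eqI) (intro has_derivative_scaleR dd_works d that)
  have fg: "Ck_on k S f" "Ck_on k S g" using Suc.prems Ck_on_Suc_imp by blast+
  have "Ck_on k S (\<lambda>x. dd v (\<lambda>x. f x *\<^sub>R g x) x)" for v
  proof (subst Ck_on_cong[OF assms(1) *])
    show "Ck_on k S (\<lambda>x. f x *\<^sub>R dd v g x + dd v f x *\<^sub>R g x)"
      by (rule Ck_on_add[OF assms(1)]; rule Suc.IH) (use Suc.prems fg in auto)
  qed
  moreover have "(\<lambda>x. f x *\<^sub>R g x) differentiable (at x)" if "x \<in> S" for x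
    using d[OF that] by (rule differentiable_scaleR)
  ultimately show ?case by simp
qed

text \<open>Expanded over \<open>Basis\<close>, the chain rule writes a derivative of the
  composition as a sum of products whose second factors are derivatives of \<open>f\<close> after
  \<open>g\<close>. The induction hypothesis is applied to these derivatives, hence \<open>f\<close>
  varies in the induction while \<open>g\<close> stays fixed.\<close>

lemma Ck_on_compose:
  fixes f :: "'m::euclidean_space \<Rightarrow> 'b::real_normed_vector" and g :: "'n::euclidean_space \<Rightarrow> 'm"
  assumes "open S" "Ck_on k S g" "Ck_on k T f" "g ` S \<subseteq> T"
  shows "Ck_on k S (\<lambda>x. f (g x))"
  using assms(2,3)
proof (induction k arbitrary: f)
  case 0
  then show ?case using assms(4) by (auto intro: continuous_on_compose2)
next
  case (Suc k)
  have d: "g differentiable (at x)" "f differentiable (at (g x))" if "x \<in> S" for x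
    using Suc.prems that assms(4) by auto
  have *: "dd v (\<lambda>x. f (g x)) x = (\<Sum>b\<in>Basis. (dd v g x \<bullet> b) *\<^sub>R dd b f (g x))" if "x \<in> S" for x v
    by (simp add: dd_chain d that) (rule dd_euclidean_sum[OF d(2)[OF that]])
  have g: "Ck_on k S g" using Suc.prems Ck_on_Suc_imp by blast
  have "Ck_on k S (\<lambda>x. dd v (\<lambda>x. f (g x)) x)" for v
  proof (subst Ck_on_cong[OF assms(1) *])
    show "Ck_on k S (\<lambda>x. \<Sum>b\<in>Basis. (dd v g x \<bullet> b) *\<^sub>R dd b f (g x))"
    proof (rule Ck_on_sum[OF assms(1)], rule Ck_on_scaleR[OF assms(1)])
      show "Ck_on k S (\<lambda>x. dd v g x \<bullet> b)" for b
        by (rule Ck_on_bounded_linear[OF assms(1) bounded_linear_inner_left]) (use Suc.prems(1) in simp)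
      show "Ck_on k S (\<lambda>x. dd b f (g x))" for b
        by (rule Suc.IH[OF g]) (use Suc.prems in simp)
    qed
  qed
  moreover have "(\<lambda>x. f (g x)) differentiable (at x)" if "x \<in> S" for x
    using differentiable_compose[OF d(2) d(1)] that by simp
  ultimately show ?case by simp
qed

lemma smooth_on_cong:
  "open S \<Longrightarrow> (\<And>x. x \<in> S \<Longrightarrow> f x = g x) \<Longrightarrow> smooth_on S f \<longleftrightarrow> smooth_on S g"
  unfolding smooth_on_def using Ck_on_cong[of S f g] by simp

lemma smooth_on_eq:
  "open S \<Longrightarrow> smooth_on S f \<Longrightarrow> (\<And>x. x \<in> S \<Longrightarrow> f x = g x) \<Longrightarrow> smooth_on S g"
  using smooth_on_cong[of S f g] by simp

lemma smooth_on_ident: "smooth_on S (\<lambda>x. x)"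
  unfolding smooth_on_def
proof
  show "Ck_on k S (\<lambda>x. x)" for k by (cases k) (simp_all add: Ck_on_const)
qed

lemma smooth_on_subset: "smooth_on S f \<Longrightarrow> T \<subseteq> S \<Longrightarrow> smooth_on T f"
  unfolding smooth_on_def by (intro allI, rule Ck_on_subset) auto

lemma smooth_on_const: "smooth_on S (\<lambda>x. c)"
  unfolding smooth_on_def by (simp add: Ck_on_const)

lemma smooth_on_sum:
  "open S \<Longrightarrow> (\<And>i. i \<in> I \<Longrightarrow> smooth_on S (f i)) \<Longrightarrow> smooth_on S (\<lambda>x. \<Sum>i\<in>I. f i x)"
  unfolding smooth_on_def by (intro allI, rule Ck_on_sum) auto

lemma smooth_on_bounded_linear:
  "open S \<Longrightarrow> bounded_linear L \<Longrightarrow> smooth_on S f \<Longrightarrow> smooth_on S (\<lambda>x. L (f x))"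
  unfolding smooth_on_def by (intro allI, rule Ck_on_bounded_linear) auto

lemma smooth_on_scaleR:
  fixes f :: "'n::euclidean_space \<Rightarrow> real"
  shows "open S \<Longrightarrow> smooth_on S f \<Longrightarrow> smooth_on S g \<Longrightarrow> smooth_on S (\<lambda>x. f x *\<^sub>R g x)"
  unfolding smooth_on_def by (intro allI, rule Ck_on_scaleR) auto

lemma smooth_on_compose:
  fixes f :: "'m::euclidean_space \<Rightarrow> 'b::real_normed_vector" and g :: "'n::euclidean_space \<Rightarrow> 'm"
  shows "open S \<Longrightarrow> smooth_on S g \<Longrightarrow> smooth_on T f \<Longrightarrow> g ` S \<subseteq> T \<Longrightarrow> smooth_on S (\<lambda>x. f (g x))"
  unfolding smooth_on_def by (intro allI, rule Ck_on_compose[where T = T]) auto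

lemma smooth_on_differentiable: "smooth_on S f \<Longrightarrow> x \<in> S \<Longrightarrow> f differentiable (at x)"
  unfolding smooth_on_def by (drule spec[of _ "Suc 0"]) simp

lemma smooth_on_dd: "smooth_on S f \<Longrightarrow> smooth_on S (\<lambda>x. dd v f x)"
  unfolding smooth_on_def
proof
  fix k assume "\<forall>k. Ck_on k S f"
  then have "Ck_on (Suc k) S f" by blast
  then show "Ck_on k S (\<lambda>x. dd v f x)" by simp
qed


section \<open>Symmetry of second derivatives\<close>

text \<open>The mean value theorem in the direction \<open>u\<close> turns the second difference
  into \<open>t\<close> times a difference of two values of \<open>dd u f\<close>; differentiability
  of \<open>dd u f\<close> at the single point \<open>x\<close> then evaluates it.\<close>

lemma second_difference_limit:
  fixes f :: "'n::euclidean_space \<Rightarrow> real"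
  assumes "open S" "x \<in> S" and f: "\<And>y. y \<in> S \<Longrightarrow> f differentiable (at y)"
    and fu: "(\<lambda>y. dd u f y) differentiable (at x)"
  shows "((\<lambda>t. (f (x + t *\<^sub>R u + t *\<^sub>R v) - f (x + t *\<^sub>R u) - f (x + t *\<^sub>R v) + f x) / t\<^sup>2)
    \<longlongrightarrow> dd v (\<lambda>y. dd u f y) x) (at_right 0)"
proof (rule tendstoI)
  fix e :: real assume e: "e > 0"
  \<comment> \<open>\<open>M\<close> only has to exceed \<open>norm u + norm v\<close>; the summand
    1 makes this strict, and \<open>M\<close> positive, even when both vectors are 0.\<close>
  define M where "M = 2 * (norm u + norm v) + 1"
  have M: "M > 0" unfolding M_def
    by (rule add_nonneg_pos) (simp_all add: mult_nonneg_nonneg)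
  obtain r where r: "r > 0" "ball x r \<subseteq> S" using assms(1,2) openE by blast
  define A where "A = (\<lambda>w. dd w (\<lambda>y. dd u f y) x)"
  have linA: "linear A" unfolding A_def by (rule dd_linear[OF fu])
  have "((\<lambda>y. dd u f y) has_derivative A) (at x)"
    unfolding A_def by (rule dd_works[OF fu])
  then have "\<forall>e>0. \<exists>d>0. \<forall>y. norm (y - x) < d \<longrightarrow>
      norm (dd u f y - dd u f x - A (y - x)) \<le> e * norm (y - x)"
    unfolding has_derivative_at_alt by (rule conjunct2)
  from this[rule_format, of "e / (2*M)"] e M obtain s where s: "s > 0"
    "\<And>y. norm (y - x) < s \<Longrightarrow> norm (dd u f y - dd u f x - A (y - x)) \<le> (e / (2*M)) * norm (y - x)"
    by auto
  define d where "d = min r s / M"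
  have d: "d > 0" using r s M by (simp add: d_def)
  have main: "dist ((f (x + t *\<^sub>R u + t *\<^sub>R v) - f (x + t *\<^sub>R u) - f (x + t *\<^sub>R v) + f x) / t\<^sup>2) (A v) < e"
    if t: "0 < t" "t < d" for t
  proof -
    have near: "norm (a *\<^sub>R u + b *\<^sub>R v) \<le> t * (norm u + norm v)" if "0 \<le> a" "a \<le> t" "0 \<le> b" "b \<le> t" for a b
    proof -
      have "norm (a *\<^sub>R u + b *\<^sub>R v) \<le> a * norm u + b * norm v"
        using norm_triangle_ineq[of "a *\<^sub>R u" "b *\<^sub>R v"] that by simp
      also have "\<dots> \<le> t * norm u + t * norm v"
        using that by (intro add_mono mult_right_mono) simp_all
      finally show ?thesis by (simp add: distrib_left)
    qed
    have tM: "t * (norm u + norm v) < min r s"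
    proof -
      have "t * M < min r s" using t M by (simp add: d_def pos_less_divide_eq)
      moreover have "t * (norm u + norm v) \<le> t * M" using t by (intro mult_left_mono) (auto simp: M_def)
      ultimately show ?thesis by linarith
    qed
    have inS: "x + a *\<^sub>R u + b *\<^sub>R v \<in> S" if "0 \<le> a" "a \<le> t" "0 \<le> b" "b \<le> t" for a b
    proof -
      have "dist x (x + a *\<^sub>R u + b *\<^sub>R v) = norm (a *\<^sub>R u + b *\<^sub>R v)"
        by (simp add: dist_norm norm_minus_commute add.assoc add.commute)
      then show ?thesis using near[OF that] tM r by (auto simp: subset_iff)
    qed
    \<comment> \<open>The second difference is \<open>p t - p 0\<close>, so one application of the
      mean value theorem suffices.\<close>
    define p where "p = (\<lambda>a. f (x + a *\<^sub>R u + t *\<^sub>R v) - f (x + a *\<^sub>R u))"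
    define p' where "p' = (\<lambda>a. dd u f (x + a *\<^sub>R u + t *\<^sub>R v) - dd u f (x + a *\<^sub>R u))"
    have line: "((\<lambda>a. f (x + a *\<^sub>R u + b *\<^sub>R v)) has_derivative (\<lambda>h. h * dd u f (x + a *\<^sub>R u + b *\<^sub>R v))) (at a)"
      if "0 \<le> a" "a \<le> t" "0 \<le> b" "b \<le> t" for a b
    proof -
      have df: "f differentiable (at (x + a *\<^sub>R u + b *\<^sub>R v))" using f inS that by blast
      have "((\<lambda>a. x + a *\<^sub>R u + b *\<^sub>R v) has_derivative (\<lambda>h. h *\<^sub>R u)) (at a)"
        by (auto intro!: derivative_eq_intros)
      from has_derivative_compose[OF this dd_works[OF df]] show ?thesis
        by (simp add: linear_scale[OF dd_linear[OF df]])
    qed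
    have "(p has_derivative (\<lambda>h. h * p' a)) (at a)" if "0 \<le> a" "a \<le> t" for a
      using has_derivative_diff[OF line[of a t] line[of a 0]] that t
      by (simp add: p_def p'_def algebra_simps)
    then have pd: "\<And>a. 0 \<le> a \<Longrightarrow> a \<le> t \<Longrightarrow> (p has_derivative (\<lambda>h. h * p' a)) (at a within {0..t})"
      using has_derivative_at_withinI by blast
    obtain a where a: "0 < a" "a < t" "p t - p 0 = (t - 0) * p' a"
      using mvt_simple[of 0 t p "\<lambda>a h. h * p' a"] t pd by fastforce
    define y1 where "y1 = a *\<^sub>R u + t *\<^sub>R v"
    define y2 where "y2 = a *\<^sub>R u"
    have n1: "norm y1 \<le> t * (norm u + norm v)" using near[of a t] a t by (simp add: y1_def)
    have n2: "norm y2 \<le> t * (norm u + norm v)" using near[of a 0] a t by (simp add: y2_def)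
    have c: "e / (2*M) > 0" using e M by simp
    have b1: "\<bar>dd u f (x + y1) - dd u f x - A y1\<bar> \<le> (e/(2*M)) * (t * (norm u + norm v))"
      using s(2)[of "x + y1"] n1 tM mult_left_mono[OF n1, of "e/(2*M)"] c by fastforce
    have b2: "\<bar>dd u f (x + y2) - dd u f x - A y2\<bar> \<le> (e/(2*M)) * (t * (norm u + norm v))"
      using s(2)[of "x + y2"] n2 tM mult_left_mono[OF n2, of "e/(2*M)"] c by fastforce
    \<comment> \<open>The unknown intermediate point \<open>a\<close> cancels here: both points
      carry the same \<open>a *\<^sub>R u\<close>.\<close>
    have "A y1 - A y2 = t * A v"
      by (simp add: y1_def y2_def linear_add[OF linA] linear_scale[OF linA])
    then have "p' a - t * A v = (dd u f (x + y1) - dd u f x - A y1) - (dd u f (x + y2) - dd u f x - A y2)"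
      by (simp add: p'_def y1_def y2_def add.assoc)
    then have "\<bar>p' a - t * A v\<bar> \<le> 2 * ((e/(2*M)) * (t * (norm u + norm v)))"
      using order_trans[OF abs_triangle_ineq4 add_mono[OF b1 b2]] by (simp only: mult_2)
    also have "\<dots> = t * (e * ((norm u + norm v) / M))" using M by (simp add: field_simps)
    also have "\<dots> < t * e"
    proof -
      have "norm u + norm v < M"
        unfolding M_def distrib_left using norm_ge_zero[of u] norm_ge_zero[of v] by linarith
      then have "(norm u + norm v) / M < 1" using M by simp
      from mult_strict_left_mono[OF mult_strict_left_mono[OF this e] t(1)] show ?thesis
        by (simp only: mult_1_right)
    qed
    finally have fin: "\<bar>p' a - t * A v\<bar> < t * e" .
    have num: "f (x + t *\<^sub>R u + t *\<^sub>R v) - f (x + t *\<^sub>R u) - f (x + t *\<^sub>R v) + f x = t * p' a"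
      using a(3) by (simp add: p_def)
    have "t * p' a / t\<^sup>2 - A v = (p' a - t * A v) / t"
      using t by (simp add: power2_eq_square diff_divide_distrib)
    then have "dist (t * p' a / t\<^sup>2) (A v) = \<bar>p' a - t * A v\<bar> / t"
      using t by (simp add: dist_real_def)
    also have "\<dots> < e"
      using fin t by (simp add: pos_divide_less_eq mult.commute)
    finally show ?thesis unfolding num .
  qed
  show "\<forall>\<^sub>F t in at_right 0. dist ((f (x + t *\<^sub>R u + t *\<^sub>R v) - f (x + t *\<^sub>R u) - f (x + t *\<^sub>R v) + f x) / t\<^sup>2)
      (dd v (\<lambda>y. dd u f y) x) < e"
    unfolding eventually_at_right[OF zero_less_one] using main d unfolding A_def by blast
qed

text \<open>The second difference is symmetric in \<open>u\<close> and \<open>v\<close>, and its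
  limit is unique.\<close>

lemma dd_commute_real:
  fixes f :: "'n::euclidean_space \<Rightarrow> real"
  assumes "smooth_on S f" "open S" "x \<in> S"
  shows "dd v (\<lambda>y. dd u f y) x = dd u (\<lambda>y. dd v f y) x"
proof -
  have f: "\<And>y. y \<in> S \<Longrightarrow> f differentiable (at y)"
    using assms smooth_on_differentiable by blast
  have d: "(\<lambda>y. dd w f y) differentiable (at x)" for w
    using smooth_on_differentiable[OF smooth_on_dd] assms by blast
  have "((\<lambda>t. (f (x + t *\<^sub>R u + t *\<^sub>R v) - f (x + t *\<^sub>R u) - f (x + t *\<^sub>R v) + f x) / t\<^sup>2)
    \<longlongrightarrow> dd u (\<lambda>y. dd v f y) x) (at_right 0)"
    using second_difference_limit[OF assms(2,3) f d, of v u]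
    by (simp add: algebra_simps)
  from tendsto_unique[OF _ second_difference_limit[OF assms(2,3) f d, of u v] this]
  show ?thesis by simp
qed

lemma dd_commute:
  fixes f :: "'n::euclidean_space \<Rightarrow> 'b::euclidean_space"
  assumes "smooth_on S f" "open S" "x \<in> S"
  shows "dd v (\<lambda>y. dd u f y) x = dd u (\<lambda>y. dd v f y) x"
proof (rule euclidean_eqI)
  fix b :: 'b
  have *: "dd v (\<lambda>y. dd u f y) x \<bullet> b = dd v (\<lambda>y. dd u (\<lambda>z. f z \<bullet> b) y) x" for u v
  proof -
    have "dd v (\<lambda>y. dd u f y \<bullet> b) x = dd v (\<lambda>y. dd u f y) x \<bullet> b"
      using smooth_on_differentiable[OF smooth_on_dd] assms
      by (intro dd_bounded_linear bounded_linear_inner_left) blast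
    moreover have "dd u (\<lambda>z. f z \<bullet> b) y = dd u f y \<bullet> b" if "y \<in> S" for y
      using smooth_on_differentiable assms that
      by (intro dd_bounded_linear bounded_linear_inner_left) blast
    ultimately show ?thesis
      using dd_cong_open[OF assms(2,3), of "\<lambda>y. dd u (\<lambda>z. f z \<bullet> b) y" "\<lambda>y. dd u f y \<bullet> b"] by simp
  qed
  have "smooth_on S (\<lambda>z. f z \<bullet> b)"
    by (rule smooth_on_bounded_linear[OF assms(2) bounded_linear_inner_left assms(1)])
  from dd_commute_real[OF this assms(2,3)]
  show "dd v (\<lambda>y. dd u f y) x \<bullet> b = dd u (\<lambda>y. dd v f y) x \<bullet> b"
    by (simp add: *)
qed


section \<open>A product rule for families of linear maps\<close>

text \<open>Metric, \<open>J\<close> and Christoffel symbols are known to be differentiable only on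
  fixed vectors. Expanding \<open>f y\<close> over \<open>Basis\<close> reduces the moving argument
  to finitely many fixed ones.\<close>

lemma has_derivative_linear_family:
  fixes A :: "'a::real_normed_vector \<Rightarrow> 'n::euclidean_space \<Rightarrow> 'b::real_normed_vector"
  assumes S: "open S" "x \<in> S" and lin: "\<And>y. y \<in> S \<Longrightarrow> linear (A y)"
    and A: "\<And>v. ((\<lambda>y. A y v) has_derivative (\<lambda>w. A' w v)) (at x)"
    and f: "(f has_derivative f') (at x)"
  shows "((\<lambda>y. A y (f y)) has_derivative (\<lambda>w. A' w (f x) + A x (f' w))) (at x)"
proof -
  \<comment> \<open>Linearity of the derivative family is inherited from that of \<open>A y\<close>
    near \<open>x\<close> by uniqueness of derivatives.\<close>
  have lin': "linear (\<lambda>v. A' w v)" for w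
  proof (rule linearI)
    fix u v and r :: real
    have "((\<lambda>y. A y (u + v)) has_derivative (\<lambda>w. A' w u + A' w v)) (at x)"
      by (rule has_derivative_transform_within_open[OF has_derivative_add[OF A[of u] A[of v]] S])
        (simp add: linear_add lin)
    from has_derivative_unique[OF A[of "u + v"] this]
    show "A' w (u + v) = A' w u + A' w v" by (rule fun_cong)
    have "((\<lambda>y. A y (r *\<^sub>R v)) has_derivative (\<lambda>w. r *\<^sub>R A' w v)) (at x)"
      by (rule has_derivative_transform_within_open[OF has_derivative_scaleR_right[OF A[of v]] S])
        (simp add: linear_scale lin)
    from has_derivative_unique[OF A[of "r *\<^sub>R v"] this]
    show "A' w (r *\<^sub>R v) = r *\<^sub>R A' w v" by (rule fun_cong)
  qed
  have "((\<lambda>y. \<Sum>b\<in>Basis. (f y \<bullet> b) *\<^sub>R A y b) has_derivative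
      (\<lambda>w. \<Sum>b\<in>Basis. (f x \<bullet> b) *\<^sub>R A' w b + (f' w \<bullet> b) *\<^sub>R A x b)) (at x)"
    by (intro has_derivative_sum has_derivative_scaleR has_derivative_inner_left f A)
  moreover have "(\<Sum>b\<in>Basis. (f x \<bullet> b) *\<^sub>R A' w b + (f' w \<bullet> b) *\<^sub>R A x b) = A' w (f x) + A x (f' w)" for w
    using linear_expand_Basis[OF lin', of w "f x"] linear_expand_Basis[OF lin[OF S(2)], of "f' w"]
    by (simp only: sum.distrib)
  ultimately have "((\<lambda>y. \<Sum>b\<in>Basis. (f y \<bullet> b) *\<^sub>R A y b) has_derivative
      (\<lambda>w. A' w (f x) + A x (f' w))) (at x)"
    by simp
  then show ?thesis
  proof (rule has_derivative_transform_within_open[OF _ S])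
    show "(\<Sum>b\<in>Basis. (f y \<bullet> b) *\<^sub>R A y b) = A y (f y)" if "y \<in> S" for y
      by (rule linear_expand_Basis[OF lin[OF that], symmetric])
  qed
qed

lemma has_derivative_bilinear_family:
  fixes A :: "'a::real_normed_vector \<Rightarrow> 'n::euclidean_space \<Rightarrow> 'p::euclidean_space \<Rightarrow> 'b::real_normed_vector"
  assumes S: "open S" "x \<in> S" and bil: "\<And>y. y \<in> S \<Longrightarrow> bilinear (A y)"
    and A: "\<And>u v. ((\<lambda>y. A y u v) has_derivative (\<lambda>w. A' w u v)) (at x)"
    and f: "(f has_derivative f') (at x)" and g: "(g has_derivative g') (at x)"
  shows "((\<lambda>y. A y (f y) (g y)) has_derivative
    (\<lambda>w. A' w (f x) (g x) + A x (f' w) (g x) + A x (f x) (g' w))) (at x)"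
proof -
  have "((\<lambda>y. A y (f y) v) has_derivative (\<lambda>w. A' w (f x) v + A x (f' w) v)) (at x)" for v
    by (rule has_derivative_linear_family[where A = "\<lambda>y u. A y u v", OF S _ A f])
      (use bil in \<open>simp add: bilinear_def\<close>)
  from has_derivative_linear_family[where A = "\<lambda>y. A y (f y)", OF S _ this g] bil show ?thesis
    by (simp add: bilinear_def)
qed


section \<open>Hermitian inner products and Lagrangian subspaces\<close>

text \<open>The metric at a point is unrelated to the inner product of the type, so orthogonality,
  frames and expansions have to be developed for \<open>G\<close> itself.\<close>

locale inner_form =
  fixes G :: "'n::euclidean_space \<Rightarrow> 'n \<Rightarrow> real"
  assumes bil: "bilinear G" and sym: "G x y = G y x" and pos: "x \<noteq> 0 \<Longrightarrow> G x x > 0"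
begin

lemmas G_simps = bilinear_ladd[OF bil] bilinear_radd[OF bil] bilinear_lmul[OF bil] bilinear_rmul[OF bil]
  bilinear_lneg[OF bil] bilinear_rneg[OF bil] bilinear_lzero[OF bil] bilinear_rzero[OF bil]
  bilinear_lsub[OF bil] bilinear_rsub[OF bil]

lemma G_linear: "linear (G x)" "linear (\<lambda>x. G x y)"
  using bil by (auto simp: bilinear_def)

lemma G_eq_0: "G x x = 0 \<longleftrightarrow> x = 0"
  using pos[of x] by (cases "x = 0") (auto simp: G_simps)

lemma orthogonal_independent:
  assumes "finite B" "\<And>x. x \<in> B \<Longrightarrow> x \<noteq> 0" "\<And>x y. x \<in> B \<Longrightarrow> y \<in> B \<Longrightarrow> x \<noteq> y \<Longrightarrow> G x y = 0"
  shows "independent B"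
  unfolding independent_explicit_finite_subsets
proof (intro allI ballI impI)
  fix A u v assume A: "A \<subseteq> B" "finite A" and s: "(\<Sum>v\<in>A. u v *\<^sub>R v) = 0" and v: "v \<in> A"
  have "0 = G (\<Sum>w\<in>A. u w *\<^sub>R w) v" by (simp add: s G_simps)
  also have "\<dots> = (\<Sum>w\<in>A. u w * G w v)"
    by (simp add: linear_sum[OF G_linear(2)] G_simps)
  also have "\<dots> = (\<Sum>w\<in>A. if w = v then u v * G v v else 0)"
    using A(1) v assms(3) by (intro sum.cong) auto
  also have "\<dots> = u v * G v v" using A(2) v by simp
  finally show "u v = 0" using assms(2)[of v] A(1) v G_eq_0[of v] by auto
qed

definition orthonormal :: "'n set \<Rightarrow> bool" where
  "orthonormal B \<longleftrightarrow> finite B \<and> (\<forall>x\<in>B. \<forall>y\<in>B. G x y = (if x = y then 1 else 0))"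

lemma orthonormal_independent:
  assumes "orthonormal B" shows "independent B"
proof (rule orthogonal_independent)
  show "x \<noteq> 0" if "x \<in> B" for x
    using assms that G_eq_0[of x] unfolding orthonormal_def by fastforce
qed (use assms in \<open>auto simp: orthonormal_def\<close>)

lemma orthonormal_residual:
  assumes "orthonormal B" "b \<in> B"
  shows "G (v - (\<Sum>x\<in>B. G v x *\<^sub>R x)) b = 0"
proof -
  have "G (\<Sum>x\<in>B. G v x *\<^sub>R x) b = (\<Sum>x\<in>B. if x = b then G v b else 0)"
    using assms unfolding linear_sum[OF G_linear(2)]
    by (intro sum.cong) (auto simp: orthonormal_def G_simps)
  also have "\<dots> = G v b" using assms by (simp add: orthonormal_def)
  finally show ?thesis by (simp add: G_simps)
qed

text \<open>Gram-Schmidt: the residual of any vector outside the span so far is nonzero and,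
  normalized, extends the set.\<close>

lemma exists_orthonormal: "n \<le> DIM('n) \<Longrightarrow> \<exists>B. orthonormal B \<and> card B = n"
proof (induction n)
  case 0
  show ?case by (rule exI[of _ "{}"]) (simp add: orthonormal_def)
next
  case (Suc n)
  then obtain B where B: "orthonormal B" "card B = n" by auto
  have fin: "finite B" using B(1) by (simp add: orthonormal_def)
  have "dim (span B) \<le> n" using dim_le_card'[OF fin] B(2) by simp
  have "span B \<noteq> UNIV"
  proof
    assume "span B = UNIV"
    with \<open>dim (span B) \<le> n\<close> have "dim (UNIV :: 'n set) \<le> n" by metis
    then show False using Suc.prems by simp
  qed
  then obtain v where v: "v \<notin> span B" by blast
  define w where "w = v - (\<Sum>x\<in>B. G v x *\<^sub>R x)"
  have "w \<noteq> 0"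
  proof
    assume "w = 0"
    then have "v = (\<Sum>x\<in>B. G v x *\<^sub>R x)" by (simp add: w_def)
    also have "\<dots> \<in> span B" by (intro span_sum span_scale span_base)
    finally show False using v by simp
  qed
  then have wpos: "G w w > 0" by (rule pos)
  define e where "e = (1 / sqrt (G w w)) *\<^sub>R w"
  have ee: "G e e = 1" using wpos by (simp add: e_def G_simps)
  have eb: "G e b = 0" "G b e = 0" if "b \<in> B" for b
    using orthonormal_residual[OF B(1) that, of v] sym[of b e] by (simp_all add: e_def w_def[symmetric] G_simps)
  have "e \<notin> B" using ee eb(1)[of e] by auto
  moreover have "orthonormal (insert e B)"
    using B(1) ee eb \<open>e \<notin> B\<close> by (auto simp: orthonormal_def)
  ultimately show ?case using B(2) fin by (intro exI[of _ "insert e B"]) simp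
qed

lemma orthonormal_expansion:
  assumes "orthonormal B" "card B = DIM('n)"
  shows "(\<Sum>x\<in>B. G v x *\<^sub>R x) = v"
proof -
  define w where "w = v - (\<Sum>x\<in>B. G v x *\<^sub>R x)"
  have "UNIV \<subseteq> span B"
    by (rule card_ge_dim_independent) (use assms orthonormal_independent in auto)
  then have "w \<in> span B" by auto
  moreover have "B \<subseteq> {x. G w x = 0}"
    using orthonormal_residual[OF assms(1)] by (auto simp: w_def)
  moreover have "subspace {x. G w x = 0}" by (auto simp: subspace_def G_simps)
  ultimately have "G w w = 0" using span_minimal by blast
  then show ?thesis by (simp add: G_eq_0 w_def)
qed

end

locale hermitian_form = inner_form G for G :: "'n::euclidean_space \<Rightarrow> 'n \<Rightarrow> real" +
  fixes J :: "'n \<Rightarrow> 'n"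
  assumes lin_J: "linear J" and J_J: "J (J x) = - x" and G_J: "G (J x) (J y) = G x y"
begin

lemmas J_simps = linear_add[OF lin_J] linear_scale[OF lin_J] linear_neg[OF lin_J] linear_0[OF lin_J]
  linear_diff[OF lin_J]

lemma G_J_left: "G (J x) y = - G x (J y)"
  using G_J[of x "J y"] by (simp add: J_J G_simps)

end

locale lagrangian_frame = hermitian_form G J for G :: "'n::euclidean_space \<Rightarrow> 'n \<Rightarrow> real" and J +
  fixes f :: "'m::euclidean_space \<Rightarrow> 'n"
  assumes lin_f: "linear f" and inj_f: "inj f"
    and normal: "J ` range f = {u. \<forall>w. G u (f w) = 0}"
begin

lemmas f_simps = linear_add[OF lin_f] linear_scale[OF lin_f] linear_neg[OF lin_f] linear_0[OF lin_f]

lemma f_isotropic: "G (J (f u)) (f v) = 0"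
  using normal by blast

lemma induced_inner_form: "inner_form (\<lambda>u v. G (f u) (f v))"
proof
  show "bilinear (\<lambda>u v. G (f u) (f v))"
    unfolding bilinear_def
    by (auto intro!: linearI simp: f_simps G_simps)
  show "G (f x) (f y) = G (f y) (f x)" for x y by (rule sym)
  show "G (f x) (f x) > 0" if "x \<noteq> 0" for x
    using pos[of "f x"] inj_f that linear_0[OF lin_f] by (metis injD)
qed

interpretation ind: inner_form "\<lambda>u v. G (f u) (f v)"
  by (rule induced_inner_form)

text \<open>Subtracting from \<open>x\<close> its orthogonal projection to \<open>range f\<close>
  leaves a normal vector, which by \<open>normal\<close> is \<open>J\<close> of a tangent
  vector.\<close>

lemma tangent_normal_split: "\<exists>a b. x = f a + J (f b)"
proof -
  obtain B where B: "ind.orthonormal B" "card B = DIM('m)"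
    using ind.exists_orthonormal by blast
  define t where "t = f (\<Sum>e\<in>B. G x (f e) *\<^sub>R e)"
  have "G (x - t) (f b) = 0" if "b \<in> B" for b
  proof -
    have "G t (f b) = (\<Sum>e\<in>B. G x (f e) * G (f e) (f b))"
      by (simp add: t_def linear_sum[OF lin_f] linear_sum[OF G_linear(2)] f_simps G_simps)
    also have "\<dots> = (\<Sum>e\<in>B. if e = b then G x (f b) else 0)"
      using B that by (intro sum.cong) (auto simp: ind.orthonormal_def)
    finally show ?thesis using B that by (simp add: G_simps ind.orthonormal_def)
  qed
  note orth = this
  have "G (x - t) (f w) = 0" for w
  proof -
    have "f w = f (\<Sum>e\<in>B. G (f w) (f e) *\<^sub>R e)" using ind.orthonormal_expansion[OF B] by simp
    then have "G (x - t) (f w) = G (x - t) (f (\<Sum>e\<in>B. G (f w) (f e) *\<^sub>R e))"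
      by (rule arg_cong)
    also have "\<dots> = (\<Sum>e\<in>B. G (f w) (f e) * G (x - t) (f e))"
      by (simp only: linear_sum[OF lin_f] linear_sum[OF G_linear(1)] linear_scale[OF lin_f]
          bilinear_rmul[OF bil] real_scaleR_def)
    finally show ?thesis using orth by simp
  qed
  then have "x - t \<in> J ` range f" using normal by blast
  then obtain b where "x - t = J (f b)" by auto
  then have "x = t + J (f b)" by (simp add: algebra_simps)
  then show ?thesis unfolding t_def by blast
qed

text \<open>An orthonormal basis of the tangent space and its image under \<open>J\<close> together
  form an orthonormal basis of the ambient space. This is how the submanifold is known to have
  dimension 3.\<close>

lemma dimension: "DIM('n) = 2 * DIM('m)"
proof -
  obtain B where B: "ind.orthonormal B" "card B = DIM('m)"
    using ind.exists_orthonormal by blast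
  have fin: "finite B" and on: "\<And>x y. x \<in> B \<Longrightarrow> y \<in> B \<Longrightarrow> G (f x) (f y) = (if x = y then 1 else 0)"
    using B(1) unfolding ind.orthonormal_def by auto
  define A where "A = f ` B \<union> (J \<circ> f) ` B"
  have cross: "G (f u) (J (f v)) = 0" for u v
    using f_isotropic[of v u] sym[of "f u"] by simp
  have disj: "f ` B \<inter> (J \<circ> f) ` B = {}"
  proof (rule ccontr)
    assume "f ` B \<inter> (J \<circ> f) ` B \<noteq> {}"
    then obtain u v where "u \<in> B" "f u = J (f v)" by auto
    then have "G (f u) (f u) = 0" using cross[of u v] by simp
    then show False using on \<open>u \<in> B\<close> by simp
  qed
  have injJ: "inj J"
  proof (rule injI)
    fix x y assume "J x = J y"
    then have "J (J x) = J (J y)" by (rule arg_cong)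
    then show "x = y" by (simp add: J_J)
  qed
  have "inj_on f B" "inj_on (J \<circ> f) B"
    using inj_f inj_compose[OF injJ inj_f] by (auto intro: inj_on_subset)
  then have cA: "card A = 2 * DIM('m)"
    unfolding A_def card_Un_disjoint[OF finite_imageI[OF fin] finite_imageI[OF fin] disj]
    by (simp only: card_image B(2))
  have "orthonormal A"
    unfolding orthonormal_def A_def
    using fin on cross f_isotropic by (auto simp: G_J inj_eq[OF inj_f] inj_eq[OF injJ])
  then have ind: "independent A" by (rule orthonormal_independent)
  have "f u \<in> span (f ` B)" for u
  proof -
    have "f u = f (\<Sum>x\<in>B. G (f u) (f x) *\<^sub>R x)" using ind.orthonormal_expansion[OF B] by simp
    also have "\<dots> = (\<Sum>x\<in>B. G (f u) (f x) *\<^sub>R f x)" by (simp add: linear_sum[OF lin_f] f_simps)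
    also have "\<dots> \<in> span (f ` B)" by (intro span_sum span_scale span_base) simp
    finally show ?thesis .
  qed
  then have sf: "f u \<in> span A" for u using span_mono[of "f ` B" A] by (auto simp: A_def)
  have sJ: "J (f u) \<in> span A" for u
  proof -
    have "J (f u) = J (f (\<Sum>x\<in>B. G (f u) (f x) *\<^sub>R x))" using ind.orthonormal_expansion[OF B] by simp
    also have "\<dots> = (\<Sum>x\<in>B. G (f u) (f x) *\<^sub>R J (f x))"
      by (simp add: linear_sum[OF lin_f] linear_sum[OF lin_J] f_simps J_simps)
    also have "\<dots> \<in> span A" by (intro span_sum span_scale span_base) (simp add: A_def)
    finally show ?thesis .
  qed
  have "v \<in> span A" for v
  proof -
    obtain a b where "v = f a + J (f b)" using tangent_normal_split by blast
    then show ?thesis using span_add[OF sf sJ] by simp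
  qed
  then have "span A = UNIV" by auto
  then have "DIM('n) = card A" using dim_eq_card_independent[OF ind] dim_span[of A] dim_UNIV[where 'a = 'n] by simp
  then show ?thesis using cA by simp
qed

end


section \<open>Isotropic quadratic maps\<close>

locale isotropic_form = inner_form G + tan: inner_form g
  for G :: "'n::euclidean_space \<Rightarrow> 'n \<Rightarrow> real" and g :: "'m::euclidean_space \<Rightarrow> 'm \<Rightarrow> real" +
  fixes h :: "'m \<Rightarrow> 'm \<Rightarrow> 'n" and c :: real
  assumes bil_h: "bilinear h" and sym_h: "h x y = h y x"
    and iso: "G (h v v) (h v v) = c * (g v v)\<^sup>2"
begin

lemmas h_simps = bilinear_ladd[OF bil_h] bilinear_radd[OF bil_h] bilinear_lmul[OF bil_h] bilinear_rmul[OF bil_h]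

lemma h_comb: "h (r *\<^sub>R a + s *\<^sub>R w) (r *\<^sub>R a + s *\<^sub>R w) = r\<^sup>2 *\<^sub>R h a a + (2 * r * s) *\<^sub>R h a w + s\<^sup>2 *\<^sub>R h w w"
proof -
  have "(2 * r * s) *\<^sub>R h a w = (r * s) *\<^sub>R h a w + (r * s) *\<^sub>R h a w"
    by (simp only: scaleR_left_distrib[symmetric] mult_2 distrib_right)
  then show ?thesis
    by (simp add: h_simps sym_h[of w a] power2_eq_square scaleR_right_distrib mult.commute[of s r])
qed

text \<open>Isotropy as an identity of quartic polynomials in \<open>r\<close> and \<open>s\<close>.
  Orthogonality removes the mixed term from the right side, which is therefore even in both
  variables.\<close>

lemma iso_comb:
  assumes "g a w = 0"
  shows "r^4 * G (h a a) (h a a) + 4 * r^3 * s * G (h a a) (h a w) + r\<^sup>2 * s\<^sup>2 * (2 * G (h a a) (h w w) + 4 * G (h a w) (h a w))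
    + 4 * r * s^3 * G (h a w) (h w w) + s^4 * G (h w w) (h w w)
    = c * (r\<^sup>2 * g a a + s\<^sup>2 * g w w)\<^sup>2"
proof -
  have "g (r *\<^sub>R a + s *\<^sub>R w) (r *\<^sub>R a + s *\<^sub>R w) = r\<^sup>2 * g a a + s\<^sup>2 * g w w"
    using assms tan.sym[of w a] by (simp add: tan.G_simps power2_eq_square)
  moreover have "G (h (r *\<^sub>R a + s *\<^sub>R w) (r *\<^sub>R a + s *\<^sub>R w)) (h (r *\<^sub>R a + s *\<^sub>R w) (r *\<^sub>R a + s *\<^sub>R w))
    = r^4 * G (h a a) (h a a) + 4 * r^3 * s * G (h a a) (h a w) + r\<^sup>2 * s\<^sup>2 * (2 * G (h a a) (h w w) + 4 * G (h a w) (h a w))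
    + 4 * r * s^3 * G (h a w) (h w w) + s^4 * G (h w w) (h w w)"
    unfolding h_comb G_simps sym[of "h a w" "h a a"] sym[of "h w w" "h a a"] sym[of "h w w" "h a w"] real_scaleR_def
    by algebra
  ultimately show ?thesis using iso by metis
qed

lemma iso_mixed:
  assumes "g a w = 0"
  shows "G (h a a) (h a w) = 0" "G (h a a) (h w w) + 2 * G (h a w) (h a w) = c * g a a * g w w"
proof -
  note q = iso_comb[OF assms]
  \<comment> \<open>Replacing \<open>s\<close> by \<open>- s\<close> isolates the odd coefficients;
    the two ratios \<open>r = 1\<close> and \<open>r = 2\<close> separate the two of them. The even
    coefficient comes from the sum of the values at \<open>s = 1\<close> and
    \<open>s = -1\<close>.\<close>
  have 1: "G (h a a) (h a w) + G (h a w) (h w w) = 0"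
    using q[of 1 1] q[of 1 "-1"] by simp
  have 2: "4 * G (h a a) (h a w) + G (h a w) (h w w) = 0"
    using q[of 2 1] q[of 2 "-1"] by simp
  show "G (h a a) (h a w) = 0" using 1 2 by linarith
  show "G (h a a) (h w w) + 2 * G (h a w) (h a w) = c * g a a * g w w"
    using q[of 1 1] q[of 1 "-1"] iso[of a] iso[of w] by (simp add: power2_eq_square algebra_simps)
qed

text \<open>The second part of \<open>iso_mixed\<close> is quadratic in \<open>w\<close>; this is
  its polarization at \<open>w = b + d\<close>.\<close>

lemma iso_three:
  assumes "g a b = 0" "g a d = 0" "g b d = 0"
  shows "G (h a a) (h b d) + 2 * G (h a b) (h a d) = 0"
proof -
  have "g a (b + d) = 0" using assms by (simp add: tan.G_simps)
  from iso_mixed(2)[OF this] iso_mixed(2)[OF assms(1)] iso_mixed(2)[OF assms(2)]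
  show ?thesis
    using assms(3) tan.sym[of d b] sym_h[of d b] sym[of "h a d" "h a b"]
    by (simp add: h_simps G_simps tan.G_simps algebra_simps)
qed

text \<open>Tracelessness and polarization make \<open>h e1 e1\<close>, \<open>h e1 e2\<close>, \<open>h e1 e3\<close>, \<open>h e2 e3\<close> pairwise orthogonal with
  square lengths \<open>c\<close> and \<open>3c/4\<close>, which is impossible in dimension 3 unless \<open>c = 0\<close>.\<close>

lemma traceless_isotropic:
  assumes on: "g e1 e1 = 1" "g e2 e2 = 1" "g e3 e3 = 1" "g e1 e2 = 0" "g e1 e3 = 0" "g e2 e3 = 0"
    and trace: "h e1 e1 + h e2 e2 + h e3 e3 = 0"
    and W: "\<And>u v. h u v \<in> W" "dim W \<le> 3"
  shows "c = 0"
proof (rule ccontr)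
  assume c: "c \<noteq> 0"
  have tr: "G u (h e1 e1) + G u (h e2 e2) + G u (h e3 e3) = 0" for u
    using arg_cong[OF trace, of "G u"] by (simp add: G_simps)
  note gs = on(4-6) tan.sym[of e2 e1] tan.sym[of e3 e1] tan.sym[of e3 e2]
  note hs = sym_h[of e2 e1] sym_h[of e3 e1] sym_h[of e3 e2]
  \<comment> \<open>In the trace paired with an off-diagonal value such as \<open>h e2 e3\<close>,
    the diagonal terms sharing an index with it vanish by \<open>iso_mixed\<close>, so the third
    vanishes too.\<close>
  have z: "G (h e1 e1) (h e2 e3) = 0" "G (h e2 e2) (h e1 e3) = 0" "G (h e3 e3) (h e1 e2) = 0"
    using tr[of "h e2 e3"] tr[of "h e1 e3"] tr[of "h e1 e2"]
      iso_mixed(1)[of e2 e3] iso_mixed(1)[of e3 e2] iso_mixed(1)[of e1 e3] iso_mixed(1)[of e3 e1]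
      iso_mixed(1)[of e1 e2] iso_mixed(1)[of e2 e1] gs hs sym[of "h e2 e3"] sym[of "h e1 e3"] sym[of "h e1 e2"]
    by simp_all
  have o: "G (h e1 e2) (h e1 e3) = 0" "G (h e1 e2) (h e2 e3) = 0" "G (h e1 e3) (h e2 e3) = 0"
    using iso_three[of e1 e2 e3] iso_three[of e2 e1 e3] iso_three[of e3 e1 e2] z gs hs by simp_all
  have k: "G (h e1 e1) (h e1 e2) = 0" "G (h e1 e1) (h e1 e3) = 0"
    using iso_mixed(1)[of e1 e2] iso_mixed(1)[of e1 e3] gs by simp_all
  have n: "G (h e1 e1) (h e1 e1) = c" "G (h e2 e2) (h e2 e2) = c" "G (h e3 e3) (h e3 e3) = c"
    using iso[of e1] iso[of e2] iso[of e3] on by simp_all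
  \<comment> \<open>Pairing the trace with each diagonal value gives three linear equations for the
    products of distinct diagonal values. Each product is \<open>- c / 2\<close>, and
    \<open>iso_mixed\<close> then gives \<open>3 * c / 4\<close>.\<close>
  have x: "4 * G (h e1 e2) (h e1 e2) = 3 * c" "4 * G (h e1 e3) (h e1 e3) = 3 * c" "4 * G (h e2 e3) (h e2 e3) = 3 * c"
    using tr[of "h e1 e1"] tr[of "h e2 e2"] tr[of "h e3 e3"] n
      iso_mixed(2)[of e1 e2] iso_mixed(2)[of e1 e3] iso_mixed(2)[of e2 e3] on gs
      sym[of "h e2 e2" "h e1 e1"] sym[of "h e3 e3" "h e1 e1"] sym[of "h e3 e3" "h e2 e2"]
    by simp_all
  have nz: "h e1 e1 \<noteq> 0" "h e1 e2 \<noteq> 0" "h e1 e3 \<noteq> 0" "h e2 e3 \<noteq> 0"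
    using n(1) x c by (auto simp: G_simps)
  have ne: "u \<noteq> v" if "G u v = 0" "u \<noteq> 0" for u v
    using that G_eq_0[of u] by auto
  define B where "B = {h e1 e1, h e1 e2, h e1 e3, h e2 e3}"
  have "card B = 4"
    using ne[OF k(1)] ne[OF k(2)] ne[OF z(1)] ne[OF o(1)] ne[OF o(2)] ne[OF o(3)] nz by (simp add: B_def)
  moreover have "independent B"
  proof (rule orthogonal_independent)
    note orth = k z(1) o
    note orth' = orth[THEN trans[OF sym]]
    show "G x y = 0" if "x \<in> B" "y \<in> B" "x \<noteq> y" for x y
      using that orth orth' unfolding B_def by (elim insertE emptyE) simp_all
  qed (use nz in \<open>auto simp: B_def\<close>)
  moreover have "B \<subseteq> W" using W(1) by (auto simp: B_def)
  ultimately have "4 \<le> dim W" using independent_card_le_dim by metis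
  then show False using W(2) by simp
qed

end


section \<open>Alternating forms of type (3,0) on Lagrangian subspaces\<close>

lemma (in inner_form) exists_orthonormal_triple:
  assumes "DIM('n) = 3"
  obtains e1 e2 e3 where "G e1 e1 = 1" "G e2 e2 = 1" "G e3 e3 = 1"
    "G e1 e2 = 0" "G e1 e3 = 0" "G e2 e3 = 0"
    "\<And>v. v = G v e1 *\<^sub>R e1 + G v e2 *\<^sub>R e2 + G v e3 *\<^sub>R e3"
proof -
  obtain B where B: "orthonormal B" "card B = DIM('n)"
    using exists_orthonormal by blast
  then have "card B = 3" using assms by simp
  then obtain e1 e2 e3 where e: "B = {e1, e2, e3}" "e1 \<noteq> e2" "e2 \<noteq> e3" "e1 \<noteq> e3"
    unfolding card_3_iff by blast
  show ?thesis
  proof (rule that[of e1 e2 e3])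
    show "v = G v e1 *\<^sub>R e1 + G v e2 *\<^sub>R e2 + G v e3 *\<^sub>R e3" for v
      using orthonormal_expansion[OF B, of v] e by (simp add: add.assoc)
  qed (use B(1) e in \<open>auto simp: orthonormal_def\<close>)
qed

text \<open>Alternation together with \<open>T_J\<close> lets \<open>J\<close> move freely between
  the slots, so \<open>T\<close> is the real part of the complex trilinear form with values
  \<open>T x y z - i * T (J x) y z\<close>. By \<open>T_tangent\<close> this form is purely
  imaginary on the frame.\<close>

locale complex_volume_frame = lagrangian_frame G J f
  for G :: "'n::euclidean_space \<Rightarrow> 'n \<Rightarrow> real" and J and f :: "'m::euclidean_space \<Rightarrow> 'n" +
  fixes T :: "'n \<Rightarrow> 'n \<Rightarrow> 'n \<Rightarrow> real"
  assumes lin_T: "linear (\<lambda>x. T x y z)" and T_swap12: "T x y z = - T y x z"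
    and T_swap23: "T x y z = - T x z y" and T_J: "T x (J y) z = T x y (J z)"
    and T_tangent: "T (f u) (f v) (f w) = 0"
begin

interpretation ind: inner_form "\<lambda>u v. G (f u) (f v)"
  by (rule induced_inner_form)

lemma T_J12: "T (J x) y z = T x (J y) z"
  using T_swap12[of "J x" y z] T_J[of y x z] T_swap12[of y x "J z"] T_J[of x y z] by simp

lemma T_repeat: "T x x z = 0" "T x y y = 0" "T x y x = 0"
  using T_swap12[of x x z] T_swap23[of x y y] T_swap12[of x y x] T_swap23[of y x x] by simp_all

lemma T_J_repeat: "T (J x) x z = 0" "T (J x) y x = 0"
  using T_J12[of x x z] T_swap12[of "J x" x z] T_J12[of x x y] T_swap12[of "J x" x y]
    T_swap23[of "J x" y x] by simp_all

lemma lin_T2: "linear (\<lambda>y. T x y z)"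
proof -
  have "(\<lambda>y. T x y z) = (\<lambda>y. - T y x z)" by (rule ext) (rule T_swap12)
  then show ?thesis using linear_compose_neg[OF lin_T[of x z]] by simp
qed

lemma lin_T3: "linear (\<lambda>z. T x y z)"
proof -
  have "(\<lambda>z. T x y z) = (\<lambda>z. - T x z y)" by (rule ext) (rule T_swap23)
  then show ?thesis using linear_compose_neg[OF lin_T2[of x y]] by simp
qed

lemmas T_simps = linear_add[OF lin_T] linear_add[OF lin_T2] linear_add[OF lin_T3]
  linear_scale[OF lin_T] linear_scale[OF lin_T2] linear_scale[OF lin_T3]

text \<open>Used in contrapositive form, to turn strictness into a nonzero number. Expansion in the
  frame shows that \<open>T (J (f e1))\<close> vanishes on tangent pairs; for general
  \<open>y\<close> and \<open>z\<close>, split into tangent vectors and \<open>J\<close> of tangent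
  vectors, every \<open>J\<close> is moved onto the first slot.\<close>

lemma volume_zero_imp_zero:
  assumes e: "\<And>v. v = G (f v) (f e1) *\<^sub>R e1 + G (f v) (f e2) *\<^sub>R e2 + G (f v) (f e3) *\<^sub>R e3"
    and t: "T (J (f e1)) (f e2) (f e3) = 0"
  shows "T (f e1) y z = 0"
proof -
  have z: "T (J (f e1)) (f u) (f v) = 0" for u v
    by (subst e[of u], subst e[of v])
      (simp add: f_simps T_simps T_J_repeat T_repeat t T_swap23[of "J (f e1)" "f e3" "f e2"])
  obtain a b where y: "y = f a + J (f b)" using tangent_normal_split by blast
  obtain a' b' where "z = f a' + J (f b')" using tangent_normal_split by blast
  with y show ?thesis
    using z T_J12[of "f e1"] T_J[of "f e1", symmetric] T_tangent
    by (simp add: T_simps J_J linear_neg[OF lin_T2] linear_neg[OF lin_T3])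
qed

end

text \<open>The second-order data of the immersion at one point. \<open>B\<close> is the ambient
  covariant second derivative and \<open>h\<close> its normal part. \<open>T_deriv\<close> is the
  derivative of \<open>T = 0\<close> on tangent vectors after the term with \<open>D_W T\<close> has
  dropped out; tangential parts of \<open>B\<close> contribute nothing to it.\<close>

locale lagrangian_jet = complex_volume_frame G J f T
  for G :: "'n::euclidean_space \<Rightarrow> 'n \<Rightarrow> real" and J and f :: "'m::euclidean_space \<Rightarrow> 'n" and T +
  fixes B h :: "'m \<Rightarrow> 'm \<Rightarrow> 'n"
  assumes dim6: "DIM('n) = 6"
    and strict: "x \<noteq> 0 \<Longrightarrow> \<exists>y z. T x y z \<noteq> 0"
    and bil_B: "bilinear B" and sym_B: "B u v = B v u"
    and cubic: "G (B w u) (J (f v)) = G (B w v) (J (f u))"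
    and T_deriv: "T (B z w) (f u) (f v) + T (f w) (B z u) (f v) + T (f w) (f u) (B z v) = 0"
    and h_normal: "G (h w u) (f v) = 0" and h_B: "B w u - h w u \<in> range f"
begin

interpretation ind: inner_form "\<lambda>u v. G (f u) (f v)"
  by (rule induced_inner_form)

lemma tangent_normal_0:
  assumes "x \<in> range f" "\<And>v. G x (f v) = 0"
  shows "x = 0"
  using assms G_eq_0[of x] by auto

text \<open>Tangent and normal vectors meet only in 0, so the Gauss formula determines
  \<open>h\<close>. Symmetry and linearity of \<open>h\<close> are obtained from those of
  \<open>B\<close> in this way.\<close>

lemma h_unique:
  assumes "\<And>v. G y (f v) = 0" "B w u - y \<in> range f"
  shows "h w u = y"
proof -
  have "subspace (range f)" by (rule linear_subspace_image[OF lin_f subspace_UNIV])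
  from subspace_diff[OF this assms(2) h_B[of w u]] have "h w u - y \<in> range f" by simp
  moreover have "G (h w u - y) (f v) = 0" for v
    using assms(1) h_normal by (simp add: G_simps)
  ultimately have "h w u - y = 0" by (rule tangent_normal_0)
  then show ?thesis by simp
qed

lemma sym_h: "h u v = h v u"
proof (rule h_unique)
  show "B u v - h v u \<in> range f" using h_B[of v u] by (simp only: sym_B[of u v])
qed (rule h_normal)

lemma linear_h: "linear (h w)"
proof (rule linearI)
  have sub: "subspace (range f)" by (rule linear_subspace_image[OF lin_f subspace_UNIV])
  fix x y
  have eq: "B w (x + y) - (h w x + h w y) = (B w x - h w x) + (B w y - h w y)"
    by (simp add: bilinear_radd[OF bil_B])
  show "h w (x + y) = h w x + h w y"
  proof (rule h_unique)
    show "B w (x + y) - (h w x + h w y) \<in> range f"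
      unfolding eq by (rule subspace_add[OF sub h_B h_B])
  qed (simp add: G_simps h_normal)
next
  have sub: "subspace (range f)" by (rule linear_subspace_image[OF lin_f subspace_UNIV])
  fix r x
  have eq: "B w (r *\<^sub>R x) - r *\<^sub>R h w x = r *\<^sub>R (B w x - h w x)"
    by (simp add: bilinear_rmul[OF bil_B] scaleR_diff_right)
  show "h w (r *\<^sub>R x) = r *\<^sub>R h w x"
  proof (rule h_unique)
    show "B w (r *\<^sub>R x) - r *\<^sub>R h w x \<in> range f"
      unfolding eq by (rule subspace_scale[OF sub h_B])
  qed (simp add: G_simps h_normal)
qed

lemma bilinear_h: "bilinear h"
proof -
  have "(\<lambda>x. h x y) = h y" for y by (rule ext) (rule sym_h)
  then show ?thesis using linear_h by (simp add: bilinear_def)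
qed

lemma dim3: "DIM('m) = 3"
  using dimension dim6 by simp

lemma h_cubic: "G (h w u) (J (f v)) = G (B w u) (J (f v))"
proof -
  obtain a where a: "B w u - h w u = f a" using h_B[of w u] by auto
  have "G (B w u - h w u) (J (f v)) = 0"
    unfolding a using f_isotropic[of v a] sym[of "f a"] by simp
  then show ?thesis by (simp add: G_simps)
qed

text \<open>The three terms of \<open>T_deriv\<close> in an orthonormal frame are the summands of the trace of
  \<open>C z\<close>, each times the same nonzero number \<open>T (J (f e1)) (f e2) (f e3)\<close>.\<close>

lemma minimal:
  assumes on: "G (f e1) (f e1) = 1" "G (f e2) (f e2) = 1" "G (f e3) (f e3) = 1"
    "G (f e1) (f e2) = 0" "G (f e1) (f e3) = 0" "G (f e2) (f e3) = 0"
    and e: "\<And>v. v = G (f v) (f e1) *\<^sub>R e1 + G (f v) (f e2) *\<^sub>R e2 + G (f v) (f e3) *\<^sub>R e3"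
  shows "h e1 e1 + h e2 e2 + h e3 e3 = 0"
proof -
  define t where "t = T (J (f e1)) (f e2) (f e3)"
  have "f e1 \<noteq> 0" using on(1) by (auto simp: G_simps)
  then have t: "t \<noteq> 0" using strict volume_zero_imp_zero[OF e] by (auto simp: t_def)
  define C where "C = (\<lambda>w u v. G (B w u) (J (f v)))"
  \<comment> \<open>\<open>C\<close> sees only the normal part \<open>J (f y)\<close> of
    \<open>B z u\<close>, and its entries are the frame coordinates of \<open>y\<close>.\<close>
  have hx: "\<exists>a y. B z u = f a + J (f y) \<and> C z u e1 = G (f y) (f e1) \<and> C z u e2 = G (f y) (f e2)
      \<and> C z u e3 = G (f y) (f e3)" for z u
  proof -
    obtain a y where ay: "B z u = f a + J (f y)" using tangent_normal_split by blast
    have "C z u v = G (f y) (f v)" for v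
      using f_isotropic[of v a] sym[of "f a" "J (f v)"] by (simp add: C_def ay G_simps G_J)
    then show ?thesis using ay by blast
  qed
  have ey: "f y = G (f y) (f e1) *\<^sub>R f e1 + G (f y) (f e2) *\<^sub>R f e2 + G (f y) (f e3) *\<^sub>R f e3" for y
    using arg_cong[OF e[of y], of f] by (simp add: f_simps)
  have Jy: "J (f y) = G (f y) (f e1) *\<^sub>R J (f e1) + G (f y) (f e2) *\<^sub>R J (f e2) + G (f y) (f e3) *\<^sub>R J (f e3)" for y
    using arg_cong[OF ey[of y], of J] by (simp add: J_simps)
  \<comment> \<open>The tangent part \<open>f a\<close> drops out because \<open>T\<close> vanishes
    on tangent vectors, and the components of \<open>y\<close> along \<open>e2\<close> and
    \<open>e3\<close> repeat a frame vector. Only the component along \<open>e1\<close> survives;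
    \<open>T2\<close> and \<open>T3\<close> work alike.\<close>
  have T1: "T (B z e1) (f e2) (f e3) = C z e1 e1 * t" for z
  proof -
    obtain a y where ay: "B z e1 = f a + J (f y)" "C z e1 e1 = G (f y) (f e1)" using hx by blast
    show ?thesis unfolding ay t_def
      by (subst Jy) (simp add: T_simps T_tangent T_J_repeat)
  qed
  have T2: "T (f e1) (B z e2) (f e3) = C z e2 e2 * t" for z
  proof -
    obtain a y where ay: "B z e2 = f a + J (f y)" "C z e2 e2 = G (f y) (f e2)" using hx by blast
    show ?thesis unfolding ay t_def
      by (subst Jy) (simp add: T_simps T_tangent T_J_repeat T_J12[symmetric] T_repeat)
  qed
  have T3: "T (f e1) (f e2) (B z e3) = C z e3 e3 * t" for z
  proof -
    obtain a y where ay: "B z e3 = f a + J (f y)" "C z e3 e3 = G (f y) (f e3)" using hx by blast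
    show ?thesis unfolding ay t_def
      by (subst Jy) (simp add: T_simps T_tangent T_J[symmetric] T_J12[symmetric] T_J_repeat T_repeat)
  qed
  have "(C z e1 e1 + C z e2 e2 + C z e3 e3) * t = 0" for z
    using T_deriv[of z e1 e2 e3] by (simp add: T1 T2 T3 algebra_simps)
  then have trC: "C z e1 e1 + C z e2 e2 + C z e3 e3 = 0" for z using t by simp
  \<comment> \<open>Total symmetry of \<open>C\<close> turns the trace over its last two slots into
    the component of the mean curvature vector along \<open>J (f z)\<close>.\<close>
  have C_swap: "C e e z = C z e e" for e z
    unfolding C_def using cubic[of e e z] sym_B[of e z] by simp
  define H where "H = h e1 e1 + h e2 e2 + h e3 e3"
  have HJ: "G H (J (f z)) = 0" for z
    using trC[of z] C_swap[of e1 z] C_swap[of e2 z] C_swap[of e3 z] by (simp add: H_def G_simps h_cubic C_def)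
  have Hf: "G H (f z) = 0" for z by (simp add: H_def G_simps h_normal)
  obtain a b where "H = f a + J (f b)" using tangent_normal_split by blast
  then have "G H H = G H (f a + J (f b))" by simp
  then have "G H H = 0" using HJ Hf by (simp add: G_simps)
  then show ?thesis by (simp add: H_def G_eq_0)
qed

theorem isotropic_imp_zero:
  assumes iso: "\<And>v. G (h v v) (h v v) = c * (G (f v) (f v))\<^sup>2"
  shows "h v w = 0"
proof -
  interpret isotropic_form G "\<lambda>u v. G (f u) (f v)" h c
    by unfold_locales (auto simp: bilinear_h sym_h iso)
  obtain e1 e2 e3 where on: "G (f e1) (f e1) = 1" "G (f e2) (f e2) = 1" "G (f e3) (f e3) = 1"
    "G (f e1) (f e2) = 0" "G (f e1) (f e3) = 0" "G (f e2) (f e3) = 0"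
    and e: "\<And>v. v = G (f v) (f e1) *\<^sub>R e1 + G (f v) (f e2) *\<^sub>R e2 + G (f v) (f e3) *\<^sub>R e3"
    by (rule ind.exists_orthonormal_triple[OF dim3], rule that)
  \<comment> \<open>The values of \<open>h\<close> are normal, hence lie in a space of dimension at
    most 3, as the argument against four orthogonal vectors requires.\<close>
  have "dim (J ` range f) \<le> dim (range f)" by (rule dim_image_le[OF lin_J])
  also have "\<dots> \<le> dim (UNIV :: 'm set)" by (rule dim_image_le[OF lin_f])
  finally have "dim (J ` range f) \<le> 3" by (simp add: dim3)
  moreover have "h u v \<in> J ` range f" for u v using normal h_normal by blast
  ultimately have "c = 0" using traceless_isotropic[OF on minimal[OF on e]] by blast
  then have z: "h v v = 0" for v using iso[of v] by (simp add: G_eq_0)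
  have "h (v + w) (v + w) = h v v + h v w + (h v w + h w w)"
    by (simp only: h_simps sym_h[of w v] add_ac)
  then have "h v w + h v w = 0" by (simp add: z)
  then show ?thesis by (simp add: scaleR_2[symmetric])
qed

end


section \<open>The second derivative of a nearly Kaehler structure\<close>

text \<open>Adding the Ricci identity to the one with the two pairs of arguments exchanged equates an alternating
  form with one that satisfies the Bianchi identity. Both vanish, so \<open>J\<close> annihilates \<open>R\<close> as a derivation and
  \<open>s\<close> is closed; therefore \<open>s\<close> is determined by the curvature term, whose (3,0) part is zero.\<close>

lemma alternating_curvature_type:
  fixes s R :: "'n::real_vector \<Rightarrow> 'n \<Rightarrow> 'n \<Rightarrow> 'n \<Rightarrow> real"
  assumes R12: "\<And>w a b c. R w a b c = - R a w b c" and R34: "\<And>w a b c. R w a b c = - R w a c b"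
    and bianchi: "\<And>w a b c. R w a b c + R a b w c + R b w a c = 0"
    and R_neg: "\<And>w a b c. R w a (- b) c = - R w a b c" and JJ: "\<And>x. J (J x) = - x"
    and s12: "\<And>w a b c. s w a b c = - s w b a c" and s23: "\<And>w a b c. s w a b c = - s w a c b"
    and ricci: "\<And>w a b c. s w a b c - s a w b c = R w a (J b) c + R w a b (J c)"
  shows "s w a b c = s w (J a) (J b) c + s w a (J b) (J c) + s w (J a) b (J c)"
proof -
  \<comment> \<open>The classical pair symmetry of a curvature tensor: four instances of the Bianchi
    identity combined with both skew symmetries.\<close>
  have pair: "R w a b c = R b c w a" for w a b c
    using bianchi[of w a b c] bianchi[of a b c w] bianchi[of b c w a] bianchi[of c w a b]
      R12[of w a b c] R12[of a b w c] R12[of b w a c] R12[of a b c w] R12[of b c a w] R12[of c a b w]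
      R12[of b c w a] R12[of c w b a] R12[of w b c a] R12[of c w a b] R12[of w a c b] R12[of a c w b]
      R34[of w a b c] R34[of a b w c] R34[of b w a c] R34[of b c a w] R34[of c a b w]
      R34[of c w b a] R34[of w b c a] R34[of a c w b]
    by linarith
  have R_neg4: "R w a b (- c) = - R w a b c" for w a b c
    using R34[of w a b "- c"] R_neg[of w a c b] R34[of w a b c] by linarith
  define P where "P = (\<lambda>w a b c. R w a (J b) c + R w a b (J c))"
  have P12: "P w a b c = - P a w b c" for w a b c
    unfolding P_def using R12[of w a "J b" c] R12[of w a b "J c"] by linarith
  have P34: "P w a b c = - P w a c b" for w a b c
    unfolding P_def using R34[of w a "J b" c] R34[of w a b "J c"] by linarith
  define Q where "Q = (\<lambda>w a b c. P w a b c + P b c w a)"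
  \<comment> \<open>By pair symmetry the exchanged copy of \<open>P\<close> carries \<open>J\<close>
    in the first two slots. So \<open>Q\<close> is the sum of \<open>R\<close> with \<open>J\<close>
    inserted in each slot, and it inherits the Bianchi identity.\<close>
  have Q_eq: "Q w a b c = R w a (J b) c + R w a b (J c) + R (J w) a b c + R w (J a) b c" for w a b c
    unfolding Q_def P_def using pair[of b c "J w" a] pair[of b c w "J a"] by linarith
  \<comment> \<open>When \<open>s w\<close> is the covariant derivative of a 3-form in the direction
    \<open>w\<close>, the right side is the exterior derivative of that form.\<close>
  have Q_s: "Q w a b c = s w a b c - s a w b c + s b w a c - s c w a b" for w a b c
    unfolding Q_def P_def ricci[symmetric]
    using s12[of b c w a] s23[of b w c a] s12[of c b w a] s23[of c w b a] by linarith
  have Q_alt: "Q w a b c = - Q a w b c" "Q w a b c = - Q w b a c" for w a b c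
    unfolding Q_s using s12[of b w a c] s12[of c w a b] s12[of w a b c] s23[of c w a b] by linarith+
  have "Q w a b c + Q a b w c + Q b w a c = 0" for w a b c
    unfolding Q_eq
    using bianchi[of "J w" a b c] bianchi[of w "J a" b c] bianchi[of w a "J b" c] bianchi[of w a b "J c"]
    by linarith
  \<comment> \<open>A cyclic permutation of three arguments is even, so for an alternating
    \<open>Q\<close> the Bianchi sum is three times \<open>Q\<close>.\<close>
  then have Q0: "Q w a b c = 0" for w a b c
    using Q_alt(1)[of b w a c] Q_alt(2)[of w b a c] Q_alt(2)[of a b w c] Q_alt(1)[of a w b c]
    by (smt (verit))
  \<comment> \<open>\<open>P\<close> is skew under exchange of the pairs although \<open>R\<close>
    is symmetric. Properties of \<open>P\<close> in the last pair, immediate from its definition,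
    thereby pass to the first pair.\<close>
  have P_anti: "P b c w a = - P w a b c" for w a b c
    using Q0[of w a b c] unfolding Q_def by linarith
  have P_JJ: "P w a (J b) (J c) = - P w a b c" for w a b c
    unfolding P_def JJ R_neg R_neg4 by linarith
  have P_JJ1: "P (J w) (J a) b c = - P w a b c" for w a b c
    using P_anti[of b c "J w" "J a"] P_JJ[of b c w a] P_anti[of b c w a] by linarith
  have P_neg: "P w (- a) b c = - P w a b c" for w a b c
    using P_anti[of w "- a" b c] P_anti[of w a b c] R_neg4 unfolding P_def
    using P_JJ1[of w "J a" b c] by (smt (verit) JJ R_neg P_def P_anti P_JJ)
  have P_J12: "P (J w) a b c = P w (J a) b c" for w a b c
    using P_JJ1[of w "J a" b c] P_neg[of "J w" a b c] unfolding JJ by linarith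
  have P_J34: "P w a (J b) c = P w a b (J c)" for w a b c
    unfolding P_def JJ R_neg R_neg4 by linarith
  \<comment> \<open>Inserting \<open>J\<close> in all four slots annihilates \<open>P\<close> as it
    annihilates \<open>R\<close>. The two insertions within a pair are equal, so the sum relates an
    insertion in one pair to an insertion in the other.\<close>
  have "P (J w) a b c + P w (J a) b c + P w a (J b) c + P w a b (J c) = 0" for w a b c
    using Q0[of w a "J b" c] Q0[of w a b "J c"]
    unfolding Q_eq P_def JJ R_neg R_neg4 by linarith
  then have P_J: "P w (J a) b c = - P w a (J b) c" for w a b c
    using P_J12[of w a b c] P_J34[of w a b c] by (smt (verit))
  have P2: "P w (J a) (J b) c = P w a b c" "P w (J a) b (J c) = P w a b c" for w a b c
    using P_J[of w a "J b" c] P_J34[of w a "J b" c] P_JJ[of w a b c]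
      P_J[of w a b "J c"] by linarith+
  have ds: "s w a b c - s a w b c + s b w a c - s c w a b = 0" for w a b c
    using Q0[of w a b c] unfolding Q_s .
  \<comment> \<open>The sum of the three Ricci identities is \<open>3 * s w a b c\<close> minus
    terms that closedness \<open>ds\<close> collects into one \<open>s w a b c\<close>.\<close>
  have s_P: "2 * s w a b c = P w a b c + P w b c a + P w c a b" for w a b c
    using ricci[of w a b c] ricci[of w b c a] ricci[of w c a b] ds[of w a b c]
      s12[of w b c a] s23[of w b a c] s12[of w a b c] s12[of w c a b] s23[of w a c b]
      s23[of w a b c] s23[of b w a c] s12[of b w c a] s12[of c w a b]
    unfolding P_def by (smt (verit))
  \<comment> \<open>Over the three double insertions of \<open>J\<close>, each cyclic summand of
    \<open>P\<close> occurs twice with sign plus and once with sign minus.\<close>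
  show ?thesis
    using s_P[of w a b c] s_P[of w "J a" "J b" c] s_P[of w a "J b" "J c"] s_P[of w "J a" b "J c"]
      P2 P_JJ
    by (smt (verit))
qed


section \<open>Nearly Kaehler structures in coordinates\<close>

locale local_nearly_kaehler =
  fixes V :: "'n::euclidean_space set" and G :: "'n \<Rightarrow> 'n \<Rightarrow> 'n \<Rightarrow> real"
    and J :: "'n \<Rightarrow> 'n \<Rightarrow> 'n" and \<Gamma> :: "'n \<Rightarrow> 'n \<Rightarrow> 'n \<Rightarrow> 'n"
  assumes open_V: "open V"
    and hermitian: "x \<in> V \<Longrightarrow> hermitian_form (G x) (J x)"
    and bil_\<Gamma>: "x \<in> V \<Longrightarrow> bilinear (\<Gamma> x)" and \<Gamma>_sym: "x \<in> V \<Longrightarrow> \<Gamma> x u v = \<Gamma> x v u"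
    and smooth_G: "smooth_on V (\<lambda>x. G x u v)" and smooth_J: "smooth_on V (\<lambda>x. J x u)"
    and smooth_\<Gamma>: "smooth_on V (\<lambda>x. \<Gamma> x u v)"
    and metric: "x \<in> V \<Longrightarrow> dd w (\<lambda>y. G y u v) x = G x (\<Gamma> x w u) v + G x u (\<Gamma> x w v)"
    and nearly_kaehler: "x \<in> V \<Longrightarrow> dd v (\<lambda>y. J y v) x + \<Gamma> x v (J x v) - J x (\<Gamma> x v v) = 0"
begin

text \<open>\<open>K\<close>, \<open>S\<close> and \<open>R\<close> are \<open>DJ\<close>, \<open>D(DJ)\<close> and the curvature tensor of the connection with
  Christoffel symbols \<open>\<Gamma>\<close>.\<close>

definition K :: "'n \<Rightarrow> 'n \<Rightarrow> 'n \<Rightarrow> 'n" where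
  "K x w u = dd w (\<lambda>y. J y u) x + \<Gamma> x w (J x u) - J x (\<Gamma> x w u)"

definition S :: "'n \<Rightarrow> 'n \<Rightarrow> 'n \<Rightarrow> 'n \<Rightarrow> 'n" where
  "S x w a b = dd w (\<lambda>y. K y a b) x + \<Gamma> x w (K x a b) - K x (\<Gamma> x w a) b - K x a (\<Gamma> x w b)"

definition R :: "'n \<Rightarrow> 'n \<Rightarrow> 'n \<Rightarrow> 'n \<Rightarrow> 'n" where
  "R x w a b = dd w (\<lambda>y. \<Gamma> y a b) x - dd a (\<lambda>y. \<Gamma> y w b) x + \<Gamma> x w (\<Gamma> x a b) - \<Gamma> x a (\<Gamma> x w b)"

context
  fixes x assumes x: "x \<in> V"
begin

interpretation hermitian_form "G x" "J x" by (rule hermitian[OF x])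

lemmas G_simps' = G_simps
lemmas J_simps' = J_simps
lemmas G_J_left' = G_J_left and J_J' = J_J and G_sym' = sym
lemmas lin_J' = lin_J and bil_G' = bil
lemmas \<Gamma>_simps = bilinear_ladd[OF bil_\<Gamma>[OF x]] bilinear_radd[OF bil_\<Gamma>[OF x]]
  bilinear_lmul[OF bil_\<Gamma>[OF x]] bilinear_rmul[OF bil_\<Gamma>[OF x]]
  bilinear_lneg[OF bil_\<Gamma>[OF x]] bilinear_rneg[OF bil_\<Gamma>[OF x]]
  bilinear_lsub[OF bil_\<Gamma>[OF x]] bilinear_rsub[OF bil_\<Gamma>[OF x]]

end

lemma diff_J: "x \<in> V \<Longrightarrow> (\<lambda>y. J y u) differentiable (at x)"
  by (rule smooth_on_differentiable[OF smooth_J])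

lemma diff_\<Gamma>: "x \<in> V \<Longrightarrow> (\<lambda>y. \<Gamma> y u v) differentiable (at x)"
  by (rule smooth_on_differentiable[OF smooth_\<Gamma>])

lemma deriv_G: "x \<in> V \<Longrightarrow> ((\<lambda>y. G y u v) has_derivative (\<lambda>w. G x (\<Gamma> x w u) v + G x u (\<Gamma> x w v))) (at x)"
  using dd_works[OF smooth_on_differentiable[OF smooth_G]] by (simp add: metric)

lemma deriv_J: "x \<in> V \<Longrightarrow> ((\<lambda>y. J y u) has_derivative (\<lambda>w. K x w u - \<Gamma> x w (J x u) + J x (\<Gamma> x w u))) (at x)"
  using dd_works[OF diff_J, of x u] by (simp add: K_def)

lemma bil_K: assumes x: "x \<in> V" shows "bilinear (K x)"
proof -
  have "linear (\<lambda>w. K x w u)" for u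
    using dd_linear[OF diff_J[OF x, of u]]
    unfolding K_def
    by (intro linearI) (simp_all add: linear_add linear_scale \<Gamma>_simps[OF x] J_simps'[OF x] algebra_simps)
  moreover have "linear (K x w)" for w
  proof (rule linearI)
    fix u v and r :: real
    have "dd w (\<lambda>y. J y (u + v)) x = dd w (\<lambda>y. J y u) x + dd w (\<lambda>y. J y v) x"
    proof -
      have "dd w (\<lambda>y. J y (u + v)) x = dd w (\<lambda>y. J y u + J y v) x"
        by (rule fun_cong[OF dd_cong_open[OF open_V x]]) (simp add: J_simps')
      also have "\<dots> = dd w (\<lambda>y. J y u) x + dd w (\<lambda>y. J y v) x"
        by (rule dd_eqI[OF has_derivative_add[OF dd_works[OF diff_J[OF x]] dd_works[OF diff_J[OF x]]]])
      finally show ?thesis .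
    qed
    then show "K x w (u + v) = K x w u + K x w v"
      by (simp add: K_def J_simps'[OF x] \<Gamma>_simps[OF x])
    have "dd w (\<lambda>y. J y (r *\<^sub>R u)) x = r *\<^sub>R dd w (\<lambda>y. J y u) x"
    proof -
      have "dd w (\<lambda>y. J y (r *\<^sub>R u)) x = dd w (\<lambda>y. r *\<^sub>R J y u) x"
        by (rule fun_cong[OF dd_cong_open[OF open_V x]]) (simp add: J_simps')
      also have "\<dots> = r *\<^sub>R dd w (\<lambda>y. J y u) x"
        by (rule dd_eqI[OF has_derivative_scaleR_right[OF dd_works[OF diff_J[OF x]]]])
      finally show ?thesis .
    qed
    then show "K x w (r *\<^sub>R u) = r *\<^sub>R K x w u"
      by (simp add: K_def J_simps'[OF x] \<Gamma>_simps[OF x] scaleR_diff_right scaleR_right_distrib)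
  qed
  ultimately show ?thesis by (simp add: bilinear_def)
qed

lemmas K_simps = bilinear_ladd[OF bil_K] bilinear_radd[OF bil_K]
  bilinear_lneg[OF bil_K] bilinear_rneg[OF bil_K]

lemma K_skew: "x \<in> V \<Longrightarrow> K x a b = - K x b a"
proof -
  assume x: "x \<in> V"
  have d: "K x v v = 0" for v unfolding K_def by (rule nearly_kaehler[OF x])
  have "K x (a + b) (a + b) = K x a a + K x a b + (K x b a + K x b b)"
    by (simp only: K_simps[OF x] add_ac)
  then show ?thesis by (simp add: d eq_neg_iff_add_eq_0)
qed


text \<open>\<open>cov_along \<psi> \<psi>' X X' y\<close>: the field \<open>X\<close> along the map \<open>\<psi>\<close>, whose derivative at \<open>y\<close> is \<open>\<psi>'\<close>, has
  the covariant derivative \<open>X'\<close> at \<open>y\<close>.\<close>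

definition cov_along :: "('a::euclidean_space \<Rightarrow> 'n) \<Rightarrow> ('a \<Rightarrow> 'n) \<Rightarrow> ('a \<Rightarrow> 'n) \<Rightarrow> ('a \<Rightarrow> 'n) \<Rightarrow> 'a \<Rightarrow> bool" where
  "cov_along \<psi> \<psi>' X X' y \<longleftrightarrow> (X has_derivative (\<lambda>w. X' w - \<Gamma> (\<psi> y) (\<psi>' w) (X y))) (at y)"

text \<open>The source of identities such as \<open>K_J\<close>, \<open>S_J\<close> and
  \<open>ricci_J\<close>: one field is differentiated covariantly in two ways and the results are
  compared.\<close>

lemma cov_along_unique: "cov_along \<psi> \<psi>' X X' y \<Longrightarrow> cov_along \<psi> \<psi>' X X'' y \<Longrightarrow> X' w = X'' w"
  unfolding cov_along_def by (drule (1) has_derivative_unique) (simp add: fun_eq_iff)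

lemma cov_along_uminus:
  assumes "\<psi> y \<in> V" "cov_along \<psi> \<psi>' X X' y"
  shows "cov_along \<psi> \<psi>' (\<lambda>z. - X z) (\<lambda>w. - X' w) y"
  using has_derivative_minus[OF assms(2)[unfolded cov_along_def]]
  unfolding cov_along_def by (simp add: \<Gamma>_simps[OF assms(1)])

lemma cov_along_cong:
  assumes "open W" "y \<in> W" "\<And>z. z \<in> W \<Longrightarrow> X z = Y z" "cov_along \<psi> \<psi>' X X' y"
  shows "cov_along \<psi> \<psi>' Y X' y"
  using has_derivative_transform_within_open[OF assms(4)[unfolded cov_along_def] assms(1,2)] assms(2,3)
  unfolding cov_along_def by simp

section \<open>Product rules along a map\<close>

context
  fixes \<psi> :: "'a::euclidean_space \<Rightarrow> 'n" and \<psi>' y W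
  assumes W: "open W" "y \<in> W" "\<psi> ` W \<subseteq> V" and d\<psi>: "(\<psi> has_derivative \<psi>') (at y)"
begin

lemma \<psi>_in: "z \<in> W \<Longrightarrow> \<psi> z \<in> V" using W(3) by blast

text \<open>Along a map, so that one statement serves twice: the identity map gives the tensor
  calculus on \<open>V\<close>, an immersion gives derivatives along the submanifold. The
  Christoffel terms cancel and leave only \<open>K\<close>.\<close>

lemma cov_along_J:
  assumes X: "cov_along \<psi> \<psi>' X X' y"
  shows "cov_along \<psi> \<psi>' (\<lambda>z. J (\<psi> z) (X z)) (\<lambda>w. K (\<psi> y) (\<psi>' w) (X y) + J (\<psi> y) (X' w)) y"
proof -
  note yV = \<psi>_in[OF W(2)]
  have "((\<lambda>z. J (\<psi> z) v) has_derivative (\<lambda>w. K (\<psi> y) (\<psi>' w) v - \<Gamma> (\<psi> y) (\<psi>' w) (J (\<psi> y) v)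
      + J (\<psi> y) (\<Gamma> (\<psi> y) (\<psi>' w) v))) (at y)" for v
    by (rule has_derivative_compose[OF d\<psi> deriv_J[OF yV]])
  from has_derivative_linear_family[where A = "\<lambda>z. J (\<psi> z)", OF W(1,2) _ this X[unfolded cov_along_def]]
  show ?thesis unfolding cov_along_def
    by (simp add: lin_J'[OF \<psi>_in] J_simps'[OF yV] algebra_simps)
qed

lemma deriv_along_G:
  assumes X: "cov_along \<psi> \<psi>' X X' y" and Y: "cov_along \<psi> \<psi>' Y Y' y"
  shows "((\<lambda>z. G (\<psi> z) (X z) (Y z)) has_derivative
    (\<lambda>w. G (\<psi> y) (X' w) (Y y) + G (\<psi> y) (X y) (Y' w))) (at y)"
proof -
  note yV = \<psi>_in[OF W(2)]
  have "((\<lambda>z. G (\<psi> z) u v) has_derivative (\<lambda>w. G (\<psi> y) (\<Gamma> (\<psi> y) (\<psi>' w) u) v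
      + G (\<psi> y) u (\<Gamma> (\<psi> y) (\<psi>' w) v))) (at y)" for u v
    by (rule has_derivative_compose[OF d\<psi> deriv_G[OF yV]])
  from has_derivative_bilinear_family[where A = "\<lambda>z. G (\<psi> z)",
      OF W(1,2) _ this X[unfolded cov_along_def] Y[unfolded cov_along_def]]
  show ?thesis
    by (simp add: bil_G'[OF \<psi>_in] G_simps'[OF yV] algebra_simps)
qed

end

lemma diff_K: assumes x: "x \<in> V" shows "(\<lambda>y. K y a b) differentiable (at x)"
proof -
  have 1: "(\<lambda>y. dd a (\<lambda>z. J z b) y) differentiable (at x)"
    by (rule smooth_on_differentiable[OF smooth_on_dd[OF smooth_J] x])
  have 2: "(\<lambda>y. \<Gamma> y a (J y b)) differentiable (at x)"
    by (rule differentiableI[OF has_derivative_linear_family[OF open_V x _ dd_works[OF diff_\<Gamma>[OF x]] dd_works[OF diff_J[OF x]]]])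
      (use bil_\<Gamma> in \<open>simp add: bilinear_def\<close>)
  have 3: "(\<lambda>y. J y (\<Gamma> y a b)) differentiable (at x)"
    by (rule differentiableI[OF has_derivative_linear_family[OF open_V x lin_J' dd_works[OF diff_J[OF x]] dd_works[OF diff_\<Gamma>[OF x]]]])
  show ?thesis unfolding K_def
    by (intro differentiable_diff differentiable_add 1 2 3)
qed

lemma deriv_K: "x \<in> V \<Longrightarrow> ((\<lambda>y. K y a b) has_derivative
    (\<lambda>w. S x w a b - \<Gamma> x w (K x a b) + K x (\<Gamma> x w a) b + K x a (\<Gamma> x w b))) (at x)"
  using dd_works[OF diff_K, of x a b] by (simp add: S_def)

lemma cov_along_K:
  fixes \<psi> :: "'a::euclidean_space \<Rightarrow> 'n"
  assumes W: "open W" "y \<in> W" "\<psi> ` W \<subseteq> V" and d\<psi>: "(\<psi> has_derivative \<psi>') (at y)"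
    and X: "cov_along \<psi> \<psi>' X X' y" and Y: "cov_along \<psi> \<psi>' Y Y' y"
  shows "cov_along \<psi> \<psi>' (\<lambda>z. K (\<psi> z) (X z) (Y z))
    (\<lambda>w. S (\<psi> y) (\<psi>' w) (X y) (Y y) + K (\<psi> y) (X' w) (Y y) + K (\<psi> y) (X y) (Y' w)) y"
proof -
  have V: "\<psi> z \<in> V" if "z \<in> W" for z using W(3) that by blast
  note yV = V[OF W(2)]
  have "((\<lambda>z. K (\<psi> z) u v) has_derivative (\<lambda>w. S (\<psi> y) (\<psi>' w) u v - \<Gamma> (\<psi> y) (\<psi>' w) (K (\<psi> y) u v)
      + K (\<psi> y) (\<Gamma> (\<psi> y) (\<psi>' w) u) v + K (\<psi> y) u (\<Gamma> (\<psi> y) (\<psi>' w) v))) (at y)" for u v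
    by (rule has_derivative_compose[OF d\<psi> deriv_K[OF yV]])
  from has_derivative_bilinear_family[where A = "\<lambda>z. K (\<psi> z)",
      OF W(1,2) _ this X[unfolded cov_along_def] Y[unfolded cov_along_def]]
  show ?thesis unfolding cov_along_def
    by (simp add: bil_K[OF V] bilinear_lsub[OF bil_K[OF yV]] bilinear_rsub[OF bil_K[OF yV]] algebra_simps)
qed

section \<open>Pointwise identities for \<open>K\<close>, \<open>S\<close> and the curvature\<close>

context
  fixes x assumes x: "x \<in> V"
begin

abbreviation "cov \<equiv> cov_along (\<lambda>y. y) (\<lambda>w. w)"

lemma V_id: "open V" "x \<in> V" "(\<lambda>y. y) ` V \<subseteq> V" "((\<lambda>y. y) has_derivative (\<lambda>w. w)) (at x)"
  by (auto simp: open_V x)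

lemma cov_const: "cov (\<lambda>y. b) (\<lambda>w. \<Gamma> x w b) x"
  by (simp add: cov_along_def)

lemmas cov_J = cov_along_J[OF V_id] and deriv_G_fields = deriv_along_G[OF V_id]
  and cov_K = cov_along_K[OF V_id]

text \<open>The covariant derivative of \<open>J (J b) = - b\<close>.\<close>

lemma K_J: "K x a (J x b) = - J x (K x a b)"
proof -
  have 1: "cov (\<lambda>y. J y (J y b)) (\<lambda>w. K x w (J x b) + J x (K x w b + J x (\<Gamma> x w b))) x"
    by (rule cov_J[OF cov_J[OF cov_const]])
  have 2: "cov (\<lambda>y. J y (J y b)) (\<lambda>w. - \<Gamma> x w b) x"
    by (rule cov_along_cong[OF V_id(1,2) _ cov_along_uminus[OF x cov_const]]) (simp add: J_J')
  from cov_along_unique[OF 1 2, of a] show ?thesis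
    by (simp add: J_simps'[OF x] J_J'[OF x] eq_neg_iff_add_eq_0)
qed

lemma G_K: "G x (K x w a) b = - G x a (K x w b)"
proof -
  have 1: "((\<lambda>y. G y (J y a) b) has_derivative
      (\<lambda>w. G x (K x w a + J x (\<Gamma> x w a)) b + G x (J x a) (\<Gamma> x w b))) (at x)"
    by (rule deriv_G_fields[OF cov_J[OF cov_const] cov_const])
  have 2: "((\<lambda>y. - G y a (J y b)) has_derivative
      (\<lambda>w. - (G x (\<Gamma> x w a) (J x b) + G x a (K x w b + J x (\<Gamma> x w b))))) (at x)"
    by (rule has_derivative_minus[OF deriv_G_fields[OF cov_const cov_J[OF cov_const]]])
  have 3: "((\<lambda>y. G y (J y a) b) has_derivative
      (\<lambda>w. - (G x (\<Gamma> x w a) (J x b) + G x a (K x w b + J x (\<Gamma> x w b))))) (at x)"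
    by (rule has_derivative_transform_within_open[OF 2 V_id(1,2)]) (simp add: G_J_left')
  from fun_cong[OF has_derivative_unique[OF 1 3], of w] show ?thesis
    by (simp add: G_simps'[OF x] G_J_left'[OF x])
qed

lemma S_skew: "S x w a b = - S x w b a"
proof -
  have 1: "cov (\<lambda>y. K y a b) (\<lambda>w. S x w a b + K x (\<Gamma> x w a) b + K x a (\<Gamma> x w b)) x"
    by (rule cov_K[OF cov_const cov_const])
  have 2: "cov (\<lambda>y. K y a b) (\<lambda>w. - (S x w b a + K x (\<Gamma> x w b) a + K x b (\<Gamma> x w a))) x"
    by (rule cov_along_cong[OF V_id(1,2) _ cov_along_uminus[OF x cov_K[OF cov_const cov_const]]])
      (simp add: K_skew[of _ a b])
  from cov_along_unique[OF 1 2, of w] show ?thesis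
    using K_skew[OF x, of "\<Gamma> x w b" a] K_skew[OF x, of b "\<Gamma> x w a"] by simp
qed

lemma G_S: "G x (S x w a b) c = - G x b (S x w a c)"
proof -
  have 1: "((\<lambda>y. G y (K y a b) c) has_derivative
      (\<lambda>w. G x (S x w a b + K x (\<Gamma> x w a) b + K x a (\<Gamma> x w b)) c + G x (K x a b) (\<Gamma> x w c))) (at x)"
    by (rule deriv_G_fields[OF cov_K[OF cov_const cov_const] cov_const])
  have 2: "((\<lambda>y. - G y b (K y a c)) has_derivative
      (\<lambda>w. - (G x (\<Gamma> x w b) (K x a c) + G x b (S x w a c + K x (\<Gamma> x w a) c + K x a (\<Gamma> x w c))))) (at x)"
    by (rule has_derivative_minus[OF deriv_G_fields[OF cov_const cov_K[OF cov_const cov_const]]])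
  have 3: "((\<lambda>y. G y (K y a b) c) has_derivative
      (\<lambda>w. - (G x (\<Gamma> x w b) (K x a c) + G x b (S x w a c + K x (\<Gamma> x w a) c + K x a (\<Gamma> x w c))))) (at x)"
  proof (rule has_derivative_transform_within_open[OF 2 V_id(1,2)])
    fix y assume y: "y \<in> V"
    show "- G y b (K y a c) = G y (K y a b) c"
      using local_nearly_kaehler.G_K[OF local_nearly_kaehler_axioms y, of a b c] by simp
  qed
  from fun_cong[OF has_derivative_unique[OF 1 3], of w] show ?thesis
    using G_K[of "\<Gamma> x w a" b c] G_K[of a b "\<Gamma> x w c"] G_K[of a "\<Gamma> x w b" c]
    by (simp add: G_simps'[OF x])
qed

text \<open>The covariant derivative of \<open>K_J\<close>. Differentiating the \<open>J\<close> on
  either side gives the two terms quadratic in \<open>K\<close>.\<close>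

lemma S_J: "S x w a (J x b) = - J x (S x w a b) - K x w (K x a b) - K x a (K x w b)"
proof -
  have 1: "cov (\<lambda>y. K y a (J y b)) (\<lambda>w. S x w a (J x b) + K x (\<Gamma> x w a) (J x b)
      + K x a (K x w b + J x (\<Gamma> x w b))) x"
    by (rule cov_K[OF cov_const cov_J[OF cov_const]])
  have 2: "cov (\<lambda>y. K y a (J y b)) (\<lambda>w. - (K x w (K x a b)
      + J x (S x w a b + K x (\<Gamma> x w a) b + K x a (\<Gamma> x w b)))) x"
  proof (rule cov_along_cong[OF V_id(1,2) _ cov_along_uminus[OF x cov_J[OF cov_K[OF cov_const cov_const]]]])
    fix y assume y: "y \<in> V"
    show "- J y (K y a b) = K y a (J y b)"
      using local_nearly_kaehler.K_J[OF local_nearly_kaehler_axioms y, of a b] by simp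
  qed
  from cov_along_unique[OF 1 2, of w] show ?thesis
    by (simp add: J_simps'[OF x] K_simps[OF x] K_J algebra_simps)
qed

text \<open>For constant \<open>a\<close> the field \<open>dd a X y + \<Gamma> y a (X y)\<close> is
  the covariant derivative of \<open>X\<close> along \<open>a\<close>. Constant fields commute, so
  the commutator of second covariant derivatives is the curvature term alone.\<close>

lemma ricci_field:
  assumes X: "smooth_on V X"
  shows "\<exists>D1 D2. cov (\<lambda>y. dd a X y + \<Gamma> y a (X y)) D1 x \<and> cov (\<lambda>y. dd w X y + \<Gamma> y w (X y)) D2 x
    \<and> D1 w - D2 a = R x w a (X x)"
proof -
  define N where "N = (\<lambda>a w. dd w (\<lambda>y. dd a X y) x + (dd w (\<lambda>y. \<Gamma> y a (X x)) x + \<Gamma> x a (dd w X x))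
    + \<Gamma> x w (dd a X x + \<Gamma> x a (X x)))"
  have "cov (\<lambda>y. dd a X y + \<Gamma> y a (X y)) (N a) x" for a
  proof -
    have "((\<lambda>y. \<Gamma> y a (X y)) has_derivative
        (\<lambda>w. dd w (\<lambda>y. \<Gamma> y a (X x)) x + \<Gamma> x a (dd w X x))) (at x)"
      by (rule has_derivative_linear_family[OF open_V x _ dd_works[OF diff_\<Gamma>[OF x]]
            dd_works[OF smooth_on_differentiable[OF X x]]])
        (use bil_\<Gamma> in \<open>simp add: bilinear_def\<close>)
    from has_derivative_add[OF dd_works[OF smooth_on_differentiable[OF smooth_on_dd[OF X] x]] this]
    show ?thesis unfolding cov_along_def N_def by simp
  qed
  moreover have "N a w - N w a = R x w a (X x)"
    using dd_commute[OF X open_V x, of w a]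
    by (simp add: N_def R_def \<Gamma>_simps[OF x])
  ultimately show ?thesis by blast
qed

lemma ricci_J: "S x w a b - S x a w b = R x w a (J x b) - J x (R x w a b)"
proof -
  have const: "\<exists>D1 D2. cov (\<lambda>y. \<Gamma> y a b) D1 x \<and> cov (\<lambda>y. \<Gamma> y w b) D2 x \<and> D1 w - D2 a = R x w a b"
    using ricci_field[OF smooth_on_const[of V b], of a w] by simp
  then obtain D1 D2 where D: "cov (\<lambda>y. \<Gamma> y a b) D1 x" "cov (\<lambda>y. \<Gamma> y w b) D2 x" "D1 w - D2 a = R x w a b"
    by blast
  obtain E1 E2 where E: "cov (\<lambda>y. dd a (\<lambda>y. J y b) y + \<Gamma> y a (J y b)) E1 x"
    "cov (\<lambda>y. dd w (\<lambda>y. J y b) y + \<Gamma> y w (J y b)) E2 x" "E1 w - E2 a = R x w a (J x b)"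
    using ricci_field[OF smooth_J[of b], of a w] by blast
  \<comment> \<open>By the product rule the covariant derivative of \<open>J b\<close> along
    \<open>a\<close> is \<open>K x a b + J x (\<Gamma> x a b)\<close>; a second derivative of this
    form brings in \<open>S\<close>.\<close>
  have *: "cov (\<lambda>y. dd a (\<lambda>y. J y b) y + \<Gamma> y a (J y b))
      (\<lambda>w. S x w a b + K x (\<Gamma> x w a) b + K x a (\<Gamma> x w b) + (K x w (\<Gamma> x a b) + J x (D w))) x"
    if "cov (\<lambda>y. \<Gamma> y a b) D x" for D a
    using has_derivative_add[OF cov_K[OF cov_const cov_const, of a b, unfolded cov_along_def]
        cov_J[OF that, unfolded cov_along_def]]
    unfolding cov_along_def K_def by (simp add: \<Gamma>_simps[OF x] algebra_simps)
  have "E1 w = S x w a b + K x (\<Gamma> x w a) b + K x a (\<Gamma> x w b) + (K x w (\<Gamma> x a b) + J x (D1 w))"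
    by (rule cov_along_unique[OF E(1) *[OF D(1)]])
  moreover have "E2 a = S x a w b + K x (\<Gamma> x a w) b + K x w (\<Gamma> x a b) + (K x a (\<Gamma> x w b) + J x (D2 a))"
    by (rule cov_along_unique[OF E(2) *[OF D(2)]])
  ultimately have "E1 w - E2 a = S x w a b - S x a w b + J x (D1 w - D2 a)"
    by (simp add: \<Gamma>_sym[OF x, of a w] J_simps'[OF x])
  then show ?thesis using D(3) E(3) by simp
qed

lemma R_skew12: "R x w a b = - R x a w b"
  by (simp add: R_def)

lemma R_bianchi: "R x w a b + R x a b w + R x b w a = 0"
proof -
  have "dd u (\<lambda>y. \<Gamma> y v z) x = dd u (\<lambda>y. \<Gamma> y z v) x" for u v z
    by (rule fun_cong[OF dd_cong_open[OF open_V x \<Gamma>_sym]])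
  note 1 = this[of w a b] this[of a b w] this[of b w a]
  show ?thesis
    unfolding R_def using 1 \<Gamma>_sym[OF x, of a b] \<Gamma>_sym[OF x, of b w] \<Gamma>_sym[OF x, of w a]
    by (simp add: algebra_simps)
qed

text \<open>Second derivatives of \<open>G y b c\<close> commute. Expanding both orders by metric
  compatibility, the mixed products agree and the remaining terms give the curvature.\<close>

lemma R_skew34: "G x (R x w a b) c = - G x b (R x w a c)"
proof -
  have smooth: "smooth_on V (\<lambda>y. G y b c)" by (rule smooth_G)
  have *: "dd w (\<lambda>y. dd a (\<lambda>z. G z b c) y) x
    = G x (D w) c + G x (\<Gamma> x a b) (\<Gamma> x w c) + (G x (\<Gamma> x w b) (\<Gamma> x a c) + G x b (E w))"
    if "cov (\<lambda>y. \<Gamma> y a b) D x" "cov (\<lambda>y. \<Gamma> y a c) E x" for D E a w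
  proof -
    have "dd w (\<lambda>y. dd a (\<lambda>z. G z b c) y) x = dd w (\<lambda>y. G y (\<Gamma> y a b) c + G y b (\<Gamma> y a c)) x"
      by (rule fun_cong[OF dd_cong_open[OF open_V x metric]])
    also have "\<dots> = G x (D w) c + G x (\<Gamma> x a b) (\<Gamma> x w c) + (G x (\<Gamma> x w b) (\<Gamma> x a c) + G x b (E w))"
      by (rule dd_eqI[OF has_derivative_add[OF deriv_G_fields[OF that(1) cov_const]
              deriv_G_fields[OF cov_const that(2)]]])
    finally show ?thesis .
  qed
  obtain D1 D2 where D: "cov (\<lambda>y. \<Gamma> y a b) D1 x" "cov (\<lambda>y. \<Gamma> y w b) D2 x" "D1 w - D2 a = R x w a b"
    using ricci_field[OF smooth_on_const[of V b], of a w] by auto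
  obtain E1 E2 where E: "cov (\<lambda>y. \<Gamma> y a c) E1 x" "cov (\<lambda>y. \<Gamma> y w c) E2 x" "E1 w - E2 a = R x w a c"
    using ricci_field[OF smooth_on_const[of V c], of a w] by auto
  have "G x (D1 w) c + G x b (E1 w) = G x (D2 a) c + G x b (E2 a)"
    using dd_commute[OF smooth open_V x, of w a] *[OF D(1) E(1), of w] *[OF D(2) E(2), of a] by simp
  then have "G x (D1 w - D2 a) c + G x b (E1 w - E2 a) = 0"
    by (simp add: G_simps'[OF x])
  then show ?thesis using D(3) E(3) by simp
qed

text \<open>On a form of type (3,0)+(0,3) each double insertion of \<open>J\<close> is a change of
  sign, so the identity would read \<open>s = - 3 * s\<close>; on types (2,1) and (1,2) it holds
  automatically. It thus says that the (3,0)+(0,3) part is zero.\<close>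

lemma S_type:
  "G x (S x w a b) c = G x (S x w (J x a) (J x b)) c + G x (S x w a (J x b)) (J x c)
    + G x (S x w (J x a) b) (J x c)"
proof (rule alternating_curvature_type[where s = "\<lambda>w a b c. G x (S x w a b) c"
      and R = "\<lambda>w a b c. G x (R x w a b) c"])
  have R_lin: "R x w a (- b) = - R x w a b" for w a b
  proof -
    have "dd u (\<lambda>y. \<Gamma> y v (- b)) x = - dd u (\<lambda>y. \<Gamma> y v b) x" for u v
    proof -
      have "dd u (\<lambda>y. \<Gamma> y v (- b)) x = dd u (\<lambda>y. - \<Gamma> y v b) x"
        by (rule fun_cong[OF dd_cong_open[OF open_V x]]) (simp add: \<Gamma>_simps)
      also have "\<dots> = - dd u (\<lambda>y. \<Gamma> y v b) x"
        by (rule dd_eqI[OF has_derivative_minus[OF dd_works[OF diff_\<Gamma>[OF x]]]])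
      finally show ?thesis .
    qed
    then show ?thesis by (simp add: R_def \<Gamma>_simps[OF x])
  qed
  fix w a b c
  show "G x (R x w a b) c = - G x (R x a w b) c"
    using R_skew12[of w a b] by (simp add: G_simps'[OF x])
  show "G x (R x w a b) c = - G x (R x w a c) b"
    using R_skew34[of w a b c] G_sym'[OF x, of b] by simp
  show "G x (R x w a b) c + G x (R x a b w) c + G x (R x b w a) c = 0"
    using arg_cong[OF R_bianchi[of w a b], of "\<lambda>z. G x z c"] by (simp add: G_simps'[OF x])
  show "G x (R x w a (- b)) c = - G x (R x w a b) c"
    by (simp add: R_lin G_simps'[OF x])
  show "G x (S x w a b) c = - G x (S x w b a) c"
    using S_skew[of w a b] by (simp add: G_simps'[OF x])
  show "G x (S x w a b) c = - G x (S x w a c) b"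
    using G_S[of w a b c] G_sym'[OF x, of b] by simp
  show "G x (S x w a b) c - G x (S x a w b) c = G x (R x w a (J x b)) c + G x (R x w a b) (J x c)"
    using arg_cong[OF ricci_J[of w a b], of "\<lambda>z. G x z c"]
    by (simp add: G_simps'[OF x] G_J_left'[OF x])
qed (rule J_J'[OF x])

text \<open>On a Lagrangian subspace the three terms on the right of \<open>S_type\<close> are all equal to the negative of
  the left side, by \<open>S_J\<close>.\<close>

lemma S_tangent:
  assumes f: "lagrangian_frame (G x) (J x) f"
    and T: "\<And>u v w. G x (K x (f u) (f v)) (f w) = 0"
  shows "G x (S x (f z) (f u) (f v)) (f w) = 0"
proof -
  interpret lagrangian_frame "G x" "J x" f by (rule f)
  have KL: "\<exists>r. K x (f u) (f v) = J x (f r)" for u v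
  proof -
    have "K x (f u) (f v) \<in> J x ` range f" unfolding normal using T by blast
    then show ?thesis by blast
  qed
  define s where "s = (\<lambda>a b c. G x (S x (f z) a b) c)"
  have s12: "s a b c = - s b a c" for a b c
    using S_skew[of "f z" a b] by (simp add: s_def G_simps)
  have s23: "s a b c = - s a c b" for a b c
    using G_S[of "f z" a b c] sym[of b] by (simp add: s_def)
  have sJJ: "s (f u) (J x (f v)) (J x (f w)) = - s (f u) (f v) (f w)" for u v w
  proof -
    \<comment> \<open>\<open>K\<close> sends two tangent vectors to \<open>J\<close> of a tangent
      vector; moving this \<open>J\<close> outside and cancelling it against
      \<open>J x (f w)\<close> leaves a value of \<open>T\<close> on tangent vectors.\<close>
    have zero: "G x (K x (f p) (K x (f q) (f r))) (J x (f w)) = 0" for p q r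
    proof -
      obtain m where m: "K x (f q) (f r) = J x (f m)" using KL by blast
      have "K x (f p) (J x (f m)) = - J x (K x (f p) (f m))" by (rule K_J)
      then show ?thesis unfolding m by (simp add: G_simps G_J T)
    qed
    show ?thesis unfolding s_def S_J by (simp add: G_simps G_J zero)
  qed
  have "s (f u) (f v) (f w) = s (J x (f u)) (J x (f v)) (f w) + s (f u) (J x (f v)) (J x (f w))
      + s (J x (f u)) (f v) (J x (f w))"
    unfolding s_def by (rule S_type)
  moreover have "s (J x (f u)) (J x (f v)) (f w) = - s (f u) (f v) (f w)"
    using s23[of "J x (f u)" "J x (f v)" "f w"] s12[of "J x (f u)" "f w" "J x (f v)"] sJJ[of w u v]
      s12[of "f w" "f u" "f v"] s23[of "f u" "f w" "f v"] by linarith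
  moreover have "s (J x (f u)) (f v) (J x (f w)) = - s (f u) (f v) (f w)"
    using s12[of "J x (f u)" "f v" "J x (f w)"] sJJ[of v u w] s12[of "f v" "f u" "f w"] by linarith
  ultimately have "s (f u) (f v) (f w) = 0" using sJJ[of u v w] by linarith
  then show ?thesis by (simp add: s_def)
qed

end

end


section \<open>Lagrangian immersions in coordinates\<close>

locale local_lagrangian = local_nearly_kaehler V G J \<Gamma>
  for V :: "'n::euclidean_space set" and G J \<Gamma> +
  fixes U :: "'m::euclidean_space set" and \<phi> :: "'m \<Rightarrow> 'n"
  assumes open_U: "open U" and smooth_\<phi>: "smooth_on U \<phi>" and \<phi>_U: "\<phi> ` U \<subseteq> V"
    and frame: "y \<in> U \<Longrightarrow> lagrangian_frame (G (\<phi> y)) (J (\<phi> y)) (\<lambda>u. dd u \<phi> y)"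
begin

text \<open>The ambient covariant derivative, in the direction \<open>w\<close>, of the tangent
  field with constant components \<open>u\<close>. Its normal part is the second fundamental
  form.\<close>

definition B :: "'m \<Rightarrow> 'm \<Rightarrow> 'm \<Rightarrow> 'n" where
  "B y w u = dd w (\<lambda>z. dd u \<phi> z) y + \<Gamma> (\<phi> y) (dd w \<phi> y) (dd u \<phi> y)"

context
  fixes y assumes y: "y \<in> U"
begin

interpretation lagrangian_frame "G (\<phi> y)" "J (\<phi> y)" "\<lambda>u. dd u \<phi> y"
  by (rule frame[OF y])

lemma \<phi>_V: "\<phi> y \<in> V" using \<phi>_U y by blast

lemma deriv_\<phi>: "(\<phi> has_derivative (\<lambda>w. dd w \<phi> y)) (at y)"
  by (rule dd_works[OF smooth_on_differentiable[OF smooth_\<phi> y]])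

lemma cov_tangent: "cov_along \<phi> (\<lambda>w. dd w \<phi> y) (\<lambda>z. dd u \<phi> z) (\<lambda>w. B y w u) y"
  using dd_works[OF smooth_on_differentiable[OF smooth_on_dd[OF smooth_\<phi>] y], of u]
  by (simp add: cov_along_def B_def)

lemma B_sym: "B y w u = B y u w"
  using dd_commute[OF smooth_\<phi> open_U y, of w u] \<Gamma>_sym[OF \<phi>_V] by (simp add: B_def)

lemma bilinear_B: "bilinear (B y)"
proof -
  note lin = dd_linear[OF smooth_on_differentiable[OF smooth_\<phi> y]]
  have "linear (\<lambda>w. B y w u)" for u
    using dd_linear[OF smooth_on_differentiable[OF smooth_on_dd[OF smooth_\<phi>] y], of u]
    unfolding B_def
    by (intro linearI) (simp_all add: linear_add linear_scale linear_add[OF lin] linear_scale[OF lin]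
        \<Gamma>_simps[OF \<phi>_V] scaleR_right_distrib)
  moreover from this have "linear (B y w)" for w
    using B_sym by (metis (no_types, lifting) ext)
  ultimately show ?thesis by (simp add: bilinear_def)
qed

text \<open>The derivative of the Lagrangian condition \<open>G (J X) Y = 0\<close> for the tangent
  fields with constant components \<open>u\<close> and \<open>v\<close>. Differentiating
  \<open>J\<close> gives the left side, differentiating the fields gives the right side.\<close>

lemma T_cubic: "G (\<phi> y) (K (\<phi> y) (dd w \<phi> y) (dd u \<phi> y)) (dd v \<phi> y)
  = G (\<phi> y) (B y w u) (J (\<phi> y) (dd v \<phi> y)) - G (\<phi> y) (B y w v) (J (\<phi> y) (dd u \<phi> y))"
proof -
  note along = deriv_along_G[OF open_U y \<phi>_U deriv_\<phi> cov_along_J[OF open_U y \<phi>_U deriv_\<phi> cov_tangent] cov_tangent]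
  have "((\<lambda>z. G (\<phi> z) (J (\<phi> z) (dd u \<phi> z)) (dd v \<phi> z)) has_derivative (\<lambda>w. 0)) (at y)"
    by (rule has_derivative_transform_within_open[OF has_derivative_const[of 0] open_U y])
      (simp add: lagrangian_frame.f_isotropic[OF frame])
  from fun_cong[OF has_derivative_unique[OF along[of u v] this], of w]
  show ?thesis
    using sym[of "J (\<phi> y) (dd u \<phi> y)" "B y w v"] by (simp add: G_simps G_J_left)
qed

abbreviation "T \<equiv> \<lambda>a b c. G (\<phi> y) (K (\<phi> y) a b) c"

lemma T_swap: "T a b c = - T b a c" "T a b c = - T a c b"
  using K_skew[OF \<phi>_V, of a b] G_K[OF \<phi>_V, of a b c] sym[of b "K (\<phi> y) a c"]
  by (simp_all add: G_simps)

text \<open>The right side of \<open>T_cubic\<close> is a difference of values of a form symmetric in its first two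
  arguments, so its cyclic sum is zero, whereas the left side is cyclically invariant.\<close>

lemma T_tangent_0: "T (dd w \<phi> y) (dd u \<phi> y) (dd v \<phi> y) = 0"
  using T_cubic[of w u v] T_cubic[of u v w] T_cubic[of v w u] B_sym[of w u] B_sym[of u v] B_sym[of v w]
    T_swap(1)[of "dd w \<phi> y" "dd u \<phi> y" "dd v \<phi> y"] T_swap(2)[of "dd u \<phi> y" "dd w \<phi> y" "dd v \<phi> y"]
    T_swap(2)[of "dd w \<phi> y" "dd u \<phi> y" "dd v \<phi> y"] T_swap(1)[of "dd w \<phi> y" "dd v \<phi> y" "dd u \<phi> y"]
  by simp

end

lemma lagrangian_jet_at:
  fixes h
  assumes y: "y \<in> U" and dim: "DIM('n) = 6"
    and strict: "\<And>v. v \<noteq> 0 \<Longrightarrow> \<exists>u. K (\<phi> y) v u \<noteq> 0"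
    and h: "\<And>w u v. G (\<phi> y) (h w u) (dd v \<phi> y) = 0"
      "\<And>w u. B y w u - h w u \<in> range (\<lambda>u. dd u \<phi> y)"
  shows "lagrangian_jet (G (\<phi> y)) (J (\<phi> y)) (\<lambda>u. dd u \<phi> y) (\<lambda>a b c. G (\<phi> y) (K (\<phi> y) a b) c) (B y) h"
proof -
  interpret lagrangian_frame "G (\<phi> y)" "J (\<phi> y)" "\<lambda>u. dd u \<phi> y" by (rule frame[OF y])
  note yV = \<phi>_V[OF y]
  show ?thesis
  proof (intro lagrangian_jet.intro complex_volume_frame.intro lagrangian_jet_axioms.intro
      complex_volume_frame_axioms.intro frame[OF y])
    show "linear (\<lambda>x. G (\<phi> y) (K (\<phi> y) x a) b)" for a b
      by (rule linearI) (simp_all add: bilinear_ladd[OF bil_K[OF yV]] bilinear_lmul[OF bil_K[OF yV]] G_simps)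
    show "G (\<phi> y) (K (\<phi> y) a b) c = - G (\<phi> y) (K (\<phi> y) b a) c" for a b c by (rule T_swap(1)[OF y])
    show "G (\<phi> y) (K (\<phi> y) a b) c = - G (\<phi> y) (K (\<phi> y) a c) b" for a b c by (rule T_swap(2)[OF y])
    show "G (\<phi> y) (K (\<phi> y) a (J (\<phi> y) b)) c = G (\<phi> y) (K (\<phi> y) a b) (J (\<phi> y) c)" for a b c
      by (simp add: K_J[OF yV] G_simps G_J_left)
    show "G (\<phi> y) (K (\<phi> y) (dd u \<phi> y) (dd v \<phi> y)) (dd w \<phi> y) = 0" for u v w by (rule T_tangent_0[OF y])
    show "DIM('n) = 6" by (rule dim)
    show "\<exists>a b. G (\<phi> y) (K (\<phi> y) v a) b \<noteq> 0" if "v \<noteq> 0" for v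
      using strict[OF that] G_eq_0 by blast
    show "bilinear (B y)" by (rule bilinear_B[OF y])
    \<comment> \<open>Symmetry of \<open>B\<close> combines with the next fact,
      \<open>T_cubic\<close> with zero left side, to make the cubic form symmetric in all
      arguments.\<close>
    show "B y u v = B y v u" for u v by (rule B_sym[OF y])
    show "G (\<phi> y) (B y w u) (J (\<phi> y) (dd v \<phi> y)) = G (\<phi> y) (B y w v) (J (\<phi> y) (dd u \<phi> y))" for w u v
      using T_cubic[OF y, of w u v] T_tangent_0[OF y, of w u v] by simp
    show "G (\<phi> y) (K (\<phi> y) (B y z w) (dd u \<phi> y)) (dd v \<phi> y) + G (\<phi> y) (K (\<phi> y) (dd w \<phi> y) (B y z u)) (dd v \<phi> y)
      + G (\<phi> y) (K (\<phi> y) (dd w \<phi> y) (dd u \<phi> y)) (B y z v) = 0" for z w u v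
    proof -
      note along = deriv_along_G[OF open_U y \<phi>_U deriv_\<phi>[OF y]
          cov_along_K[OF open_U y \<phi>_U deriv_\<phi>[OF y] cov_tangent[OF y] cov_tangent[OF y]] cov_tangent[OF y]]
      \<comment> \<open>\<open>T\<close> vanishes on tangent vectors at every point of
        \<open>U\<close>, so this function has derivative 0. The product rule gives a term with
        \<open>S\<close>, removed by \<open>S_tangent\<close>, and three terms with
        \<open>B\<close>.\<close>
      have "((\<lambda>z. G (\<phi> z) (K (\<phi> z) (dd w \<phi> z) (dd u \<phi> z)) (dd v \<phi> z)) has_derivative (\<lambda>w. 0)) (at y)"
        by (rule has_derivative_transform_within_open[OF has_derivative_const[of 0] open_U y])
          (simp add: T_tangent_0)
      from fun_cong[OF has_derivative_unique[OF along[of w u v] this], of z]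
      show ?thesis
        using S_tangent[OF yV frame[OF y] T_tangent_0[OF y], of z w u v] by (simp add: G_simps)
    qed
    show "G (\<phi> y) (h w u) (dd v \<phi> y) = 0" for w u v by (rule h(1))
    show "B y w u - h w u \<in> range (\<lambda>u. dd u \<phi> y)" for w u by (rule h(2))
  qed
qed

end


section \<open>Charts and connections\<close>

locale charted_manifold =
  fixes N :: "('a, 'n::euclidean_space) manifold"
  assumes mfd: "smooth_manifold N"
begin

lemma chart: "c \<in> atlas N \<Longrightarrow> is_chart (mtop N) c"
  using mfd by (simp add: smooth_manifold_def)

lemma chart_open: "c \<in> atlas N \<Longrightarrow> openin (mtop N) (fst c)"
  using chart by (simp add: is_chart_def)

lemma chart_points: "c \<in> atlas N \<Longrightarrow> q \<in> fst c \<Longrightarrow> q \<in> points N"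
  using openin_subset[OF chart_open] by blast

lemma chart_inj: assumes "c \<in> atlas N" shows "inj_on (snd c) (fst c)"
proof -
  have "topspace (subtopology (mtop N) (fst c)) = fst c"
    using openin_subset[OF chart_open[OF assms]] by (auto simp: topspace_subtopology)
  then show ?thesis
    using homeomorphic_imp_injective_map chart[OF assms] unfolding is_chart_def by metis
qed

lemma chart_image_open:
  assumes "c \<in> atlas N" "openin (mtop N) W"
  shows "open (snd c ` (W \<inter> fst c))"
proof -
  have hom: "homeomorphic_map (subtopology (mtop N) (fst c)) (top_of_set (snd c ` fst c)) (snd c)"
    and op: "open (snd c ` fst c)"
    using chart[OF assms(1)] by (auto simp: is_chart_def)
  have "openin (subtopology (mtop N) (fst c)) (W \<inter> fst c)"
    using assms(2) by (auto simp: openin_subtopology)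
  then have "openin (top_of_set (snd c ` fst c)) (snd c ` (W \<inter> fst c))"
    using homeomorphic_imp_open_map[OF hom] by (simp add: open_map_def)
  then show ?thesis using op openin_open_eq by blast
qed

lemma chart_inv_chart: "c \<in> atlas N \<Longrightarrow> q \<in> fst c \<Longrightarrow> chart_inv c (snd c q) = q"
  by (rule inv_into_f_f[OF chart_inj])

lemma chart_chart_inv: "x \<in> snd c ` fst c \<Longrightarrow> snd c (chart_inv c x) = x"
  by (rule f_inv_into_f)

lemma chart_inv_in: "c \<in> atlas N \<Longrightarrow> W \<subseteq> fst c \<Longrightarrow> x \<in> snd c ` W \<Longrightarrow> chart_inv c x \<in> W"
  using chart_inv_chart by fastforce

lemma chart_at: "q \<in> points N \<Longrightarrow> chart_at N q \<in> atlas N \<and> q \<in> fst (chart_at N q)"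
  unfolding chart_at_def by (rule someI_ex) (use mfd in \<open>auto simp: smooth_manifold_def\<close>)

lemma transition_smooth:
  "c \<in> atlas N \<Longrightarrow> d \<in> atlas N \<Longrightarrow> smooth_on (snd c ` (fst c \<inter> fst d)) (snd d \<circ> chart_inv c)"
  using mfd by (simp add: smooth_manifold_def)

lemma overlap_open: "c \<in> atlas N \<Longrightarrow> d \<in> atlas N \<Longrightarrow> open (snd c ` (fst c \<inter> fst d))"
  using chart_image_open[of c "fst d"] chart_open[of d] by (simp add: Int_commute)

lemma transition_differentiable:
  assumes "c \<in> atlas N" "d \<in> atlas N" "q \<in> fst c" "q \<in> fst d"
  shows "(snd d \<circ> chart_inv c) differentiable (at (snd c q))"
  by (rule smooth_on_differentiable[OF transition_smooth[OF assms(1,2)]]) (use assms in auto)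

text \<open>Tangent vectors are given in the reference chart of their base point, which may jump.
  This chain rule through the transition map moves every derivative to one chosen chart.\<close>

lemma change_chart:
  assumes c: "c \<in> atlas N" "q \<in> fst c" and d: "d \<in> atlas N" "q \<in> fst d"
    and f: "(f \<circ> chart_inv d) differentiable (at (snd d q))"
  shows "(f \<circ> chart_inv c) differentiable (at (snd c q))"
    and "dd b (f \<circ> chart_inv c) (snd c q)
      = dd (dd b (snd d \<circ> chart_inv c) (snd c q)) (f \<circ> chart_inv d) (snd d q)"
proof -
  let ?W = "snd c ` (fst c \<inter> fst d)"
  have x: "snd c q \<in> ?W" using c d by auto
  have q: "(snd d \<circ> chart_inv c) (snd c q) = snd d q" by (simp add: chart_inv_chart c)
  have eq: "(f \<circ> chart_inv d) ((snd d \<circ> chart_inv c) y) = (f \<circ> chart_inv c) y" if "y \<in> ?W" for y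
    using chart_inv_in[OF c(1) _ that] chart_inv_chart[OF d(1)] by simp
  note t = transition_differentiable[OF c(1) d(1) c(2) d(2)]
  have f': "(f \<circ> chart_inv d) differentiable (at ((snd d \<circ> chart_inv c) (snd c q)))"
    unfolding q by (rule f)
  show "(f \<circ> chart_inv c) differentiable (at (snd c q))"
    by (rule differentiable_cong_open[OF overlap_open[OF c(1) d(1)] x eq differentiable_compose[OF f' t]])
  have "dd b (f \<circ> chart_inv c) (snd c q)
      = dd b (\<lambda>y. (f \<circ> chart_inv d) ((snd d \<circ> chart_inv c) y)) (snd c q)"
    by (rule fun_cong[OF dd_cong_open[OF overlap_open[OF c(1) d(1)] x]]) (rule eq[symmetric])
  also have "\<dots> = dd (dd b (snd d \<circ> chart_inv c) (snd c q)) (f \<circ> chart_inv d) (snd d q)"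
    unfolding dd_chain[OF t f'] q ..
  finally show "dd b (f \<circ> chart_inv c) (snd c q)
      = dd (dd b (snd d \<circ> chart_inv c) (snd c q)) (f \<circ> chart_inv d) (snd d q)" .
qed

lemma dd_chart_id:
  assumes c: "c \<in> atlas N" "q \<in> fst c"
  shows "dd b (snd c \<circ> chart_inv c) (snd c q) = b"
proof -
  have "dd b (snd c \<circ> chart_inv c) (snd c q) = dd b (\<lambda>x. x) (snd c q)"
    by (rule fun_cong[OF dd_cong_open[OF chart_image_open[OF c(1) chart_open[OF c(1)]]]])
      (use c in \<open>auto simp: chart_inv_chart\<close>)
  then show ?thesis by simp
qed

lemma dir_deriv_chart:
  assumes c: "c \<in> atlas N" "q \<in> fst c" and f: "(f \<circ> chart_inv c) differentiable (at (snd c q))"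
  shows "dir_deriv N q v f = dd (coords N c q v) (f \<circ> chart_inv c) (snd c q)"
  using change_chart(2)[OF _ _ c f] chart_at[OF chart_points[OF c]]
  by (simp add: dir_deriv_def coords_def)

lemma dir_deriv_cong:
  assumes "openin (mtop N) W" "q \<in> W" "\<And>r. r \<in> W \<Longrightarrow> f r = f' r"
  shows "dir_deriv N q v f = dir_deriv N q v f'"
proof -
  have "q \<in> points N" using assms openin_subset by blast
  note c = chart_at[OF this]
  show ?thesis unfolding dir_deriv_def
    by (rule fun_cong[OF dd_cong_open[OF chart_image_open[OF conjunct1[OF c] assms(1)]]])
      (use c assms in \<open>auto simp: chart_inv_chart\<close>)
qed

lemma dir_deriv_const: "dir_deriv N q v (\<lambda>r. a) = 0"
  by (simp add: dir_deriv_def o_def)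

section \<open>Components of vectors and coordinate fields\<close>

lemma linear_coords:
  assumes c: "c \<in> atlas N" "q \<in> fst c"
  shows "linear (coords N c q)"
  using dd_linear[OF transition_differentiable[OF _ c(1) _ c(2)]] chart_at[OF chart_points[OF c]]
  unfolding coords_def[abs_def] dir_deriv_def by simp

lemma linear_coord_field:
  assumes c: "c \<in> atlas N" "q \<in> fst c"
  shows "linear (\<lambda>b. coord_field N c b q)"
  using dd_linear[OF transition_differentiable[OF c(1) _ c(2)]] chart_at[OF chart_points[OF c]]
  by (simp add: coord_field_def)

lemma coords_coord_field_gen:
  assumes c: "c \<in> atlas N" "q \<in> fst c" and d: "d \<in> atlas N" "q \<in> fst d"
  shows "coords N d q (coord_field N c b q) = dd b (snd d \<circ> chart_inv c) (snd c q)"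
proof -
  note c0 = chart_at[OF chart_points[OF c]]
  show ?thesis
    using change_chart(2)[OF c conjunct1[OF c0] conjunct2[OF c0]
        transition_differentiable[OF conjunct1[OF c0] d(1) conjunct2[OF c0] d(2)], of b]
    by (simp add: coords_def dir_deriv_def coord_field_def)
qed

lemma coords_coord_field:
  assumes c: "c \<in> atlas N" "q \<in> fst c"
  shows "coords N c q (coord_field N c b q) = b"
  using coords_coord_field_gen[OF c c] dd_chart_id[OF c] by simp

text \<open>The derivatives of the two transition maps between \<open>c\<close> and the reference
  chart are inverse to each other.\<close>

lemma coord_field_coords:
  assumes c: "c \<in> atlas N" "q \<in> fst c"
  shows "coord_field N c (coords N c q v) q = v"
proof -
  note c0 = chart_at[OF chart_points[OF c]]
  show ?thesis
    using change_chart(2)[OF conjunct1[OF c0] conjunct2[OF c0] c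
        transition_differentiable[OF c(1) conjunct1[OF c0] c(2) conjunct2[OF c0]], of v]
      dd_chart_id[OF conjunct1[OF c0] conjunct2[OF c0], of v]
    by (simp add: coords_def dir_deriv_def coord_field_def)
qed

lemma coord_field_chart_at: "q \<in> points N \<Longrightarrow> coord_field N (chart_at N q) b q = b"
  using dd_chart_id chart_at by (simp add: coord_field_def)

lemma coords_chart_at: "q \<in> points N \<Longrightarrow> coords N (chart_at N q) q v = v"
  using coords_coord_field[of "chart_at N q" q v] coord_field_chart_at chart_at by simp

lemma dir_deriv_coord_field:
  assumes c: "c \<in> atlas N" "q \<in> fst c" and f: "(f \<circ> chart_inv c) differentiable (at (snd c q))"
  shows "dir_deriv N q (coord_field N c b q) f = dd b (f \<circ> chart_inv c) (snd c q)"
  by (simp add: dir_deriv_chart[OF c f] coords_coord_field[OF c])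

section \<open>Smooth functions and fields in charts\<close>

lemma smooth_fun_on_chartI:
  assumes c: "c \<in> atlas N" and W: "openin (mtop N) W" "W \<subseteq> fst c"
    and f: "smooth_on (snd c ` W) (f \<circ> chart_inv c)"
  shows "smooth_fun_on N W f"
  unfolding smooth_fun_on_def
proof
  fix d assume d: "d \<in> atlas N"
  have op: "open (snd d ` (W \<inter> fst d))" by (rule chart_image_open[OF d W(1)])
  have t: "smooth_on (snd d ` (W \<inter> fst d)) (snd c \<circ> chart_inv d)"
    by (rule smooth_on_subset[OF transition_smooth[OF d c]]) (use W(2) in auto)
  have im: "(snd c \<circ> chart_inv d) ` (snd d ` (W \<inter> fst d)) \<subseteq> snd c ` W"
    by (auto simp: chart_inv_chart[OF d])
  have "smooth_on (snd d ` (W \<inter> fst d)) (\<lambda>x. (f \<circ> chart_inv c) ((snd c \<circ> chart_inv d) x))"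
    by (rule smooth_on_compose[OF op t f im])
  moreover have "(f \<circ> chart_inv c) ((snd c \<circ> chart_inv d) x) = (f \<circ> chart_inv d) x"
    if "x \<in> snd d ` (W \<inter> fst d)" for x
    using that W(2) by (auto simp: chart_inv_chart[OF d] chart_inv_chart[OF c] subset_iff)
  ultimately show "smooth_on (snd d ` (W \<inter> fst d)) (f \<circ> chart_inv d)"
    by (rule smooth_on_eq[OF op])
qed

lemma smooth_coord_field:
  assumes c: "c \<in> atlas N"
  shows "smooth_field_on N (fst c) (coord_field N c b)"
  unfolding smooth_field_on_def
proof
  fix d assume d: "d \<in> atlas N"
  let ?W = "snd d ` (fst c \<inter> fst d)"
  have op: "open ?W" using overlap_open[OF d c] by (simp add: Int_commute)
  have t: "smooth_on ?W (snd c \<circ> chart_inv d)"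
    using transition_smooth[OF d c] by (simp add: Int_commute)
  have im: "(snd c \<circ> chart_inv d) ` ?W \<subseteq> snd c ` (fst c \<inter> fst d)"
    by (auto simp: chart_inv_chart[OF d])
  have "smooth_on ?W (\<lambda>x. dd b (snd d \<circ> chart_inv c) ((snd c \<circ> chart_inv d) x))"
    by (rule smooth_on_compose[OF op t smooth_on_dd[OF transition_smooth[OF c d]] im])
  moreover have "dd b (snd d \<circ> chart_inv c) ((snd c \<circ> chart_inv d) x)
      = ((\<lambda>q. coords N d q (coord_field N c b q)) \<circ> chart_inv d) x" if "x \<in> ?W" for x
    using that by (auto simp: chart_inv_chart[OF d] coords_coord_field_gen[OF c _ d])
  ultimately show "smooth_on ?W ((\<lambda>q. coords N d q (coord_field N c b q)) \<circ> chart_inv d)"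
    by (rule smooth_on_eq[OF op])
qed

lemma smooth_field_on_subset: "smooth_field_on N W Y \<Longrightarrow> W' \<subseteq> W \<Longrightarrow> smooth_field_on N W' Y"
  unfolding smooth_field_on_def by (blast intro: smooth_on_subset[OF _ image_mono])

lemma smooth_field_on_scaleR:
  assumes W: "openin (mtop N) W" and f: "smooth_fun_on N W f" and Y: "smooth_field_on N W Y"
  shows "smooth_field_on N W (\<lambda>q. f q *\<^sub>R Y q)"
  unfolding smooth_field_on_def
proof
  fix d assume d: "d \<in> atlas N"
  have op: "open (snd d ` (W \<inter> fst d))" by (rule chart_image_open[OF d W])
  have "smooth_on (snd d ` (W \<inter> fst d))
      (\<lambda>x. (f \<circ> chart_inv d) x *\<^sub>R ((\<lambda>q. coords N d q (Y q)) \<circ> chart_inv d) x)"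
    by (rule smooth_on_scaleR[OF op bspec[OF f[unfolded smooth_fun_on_def] d]
          bspec[OF Y[unfolded smooth_field_on_def] d]])
  moreover have "(f \<circ> chart_inv d) x *\<^sub>R ((\<lambda>q. coords N d q (Y q)) \<circ> chart_inv d) x
      = ((\<lambda>q. coords N d q (f q *\<^sub>R Y q)) \<circ> chart_inv d) x" if "x \<in> snd d ` (W \<inter> fst d)" for x
    using that by (auto simp: chart_inv_chart[OF d] linear_scale[OF linear_coords[OF d]])
  ultimately show "smooth_on (snd d ` (W \<inter> fst d)) ((\<lambda>q. coords N d q (f q *\<^sub>R Y q)) \<circ> chart_inv d)"
    by (rule smooth_on_eq[OF op])
qed

lemma smooth_field_on_sum:
  assumes W: "openin (mtop N) W" and Y: "\<And>i. i \<in> I \<Longrightarrow> smooth_field_on N W (Y i)"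
  shows "smooth_field_on N W (\<lambda>q. \<Sum>i\<in>I. Y i q)"
  unfolding smooth_field_on_def
proof
  fix d assume d: "d \<in> atlas N"
  have op: "open (snd d ` (W \<inter> fst d))" by (rule chart_image_open[OF d W])
  have "smooth_on (snd d ` (W \<inter> fst d)) (\<lambda>x. \<Sum>i\<in>I. ((\<lambda>q. coords N d q (Y i q)) \<circ> chart_inv d) x)"
    by (rule smooth_on_sum[OF op bspec[OF Y[unfolded smooth_field_on_def] d]])
  moreover have "(\<Sum>i\<in>I. ((\<lambda>q. coords N d q (Y i q)) \<circ> chart_inv d) x)
      = ((\<lambda>q. coords N d q (\<Sum>i\<in>I. Y i q)) \<circ> chart_inv d) x" if "x \<in> snd d ` (W \<inter> fst d)" for x
    using that by (auto simp: chart_inv_chart[OF d] linear_sum[OF linear_coords[OF d]])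
  ultimately show "smooth_on (snd d ` (W \<inter> fst d)) ((\<lambda>q. coords N d q (\<Sum>i\<in>I. Y i q)) \<circ> chart_inv d)"
    by (rule smooth_on_eq[OF op])
qed

lemma smooth_fun_near_const: "q \<in> points N \<Longrightarrow> smooth_fun_near N q (\<lambda>r. a)"
  unfolding smooth_fun_near_def smooth_fun_on_def
  by (intro exI[of _ "points N"]) (simp add: smooth_on_const o_def)

lemma coord_field_near:
  "c \<in> atlas N \<Longrightarrow> q \<in> fst c \<Longrightarrow> smooth_field_near N q (coord_field N c b)"
  unfolding smooth_field_near_def using smooth_coord_field chart_open by blast

definition hat :: "('a, 'n) chart \<Rightarrow> ('a \<Rightarrow> 'n) \<Rightarrow> 'n \<Rightarrow> 'n" where
  "hat c Y = (\<lambda>q. coords N c q (Y q)) \<circ> chart_inv c"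

lemma hat_smooth:
  assumes "c \<in> atlas N" "smooth_field_on N W Y"
  shows "smooth_on (snd c ` (W \<inter> fst c)) (hat c Y)"
  using assms by (simp add: smooth_field_on_def hat_def)

lemma hat_differentiable:
  assumes "c \<in> atlas N" "q \<in> fst c" "smooth_field_near N q Y"
  shows "hat c Y differentiable (at (snd c q))"
proof -
  obtain W where "q \<in> W" "smooth_field_on N W Y" using assms(3) by (auto simp: smooth_field_near_def)
  then show ?thesis
    using smooth_on_differentiable[OF hat_smooth[OF assms(1)]] assms(2) by blast
qed

lemma hat_chart: "c \<in> atlas N \<Longrightarrow> q \<in> fst c \<Longrightarrow> hat c Y (snd c q) = coords N c q (Y q)"
  by (simp add: hat_def chart_inv_chart)

lemma component_smooth:
  assumes c: "c \<in> atlas N" and W: "openin (mtop N) W" and Y: "smooth_field_on N W Y"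
  shows "smooth_fun_on N (W \<inter> fst c) (\<lambda>q. coords N c q (Y q) \<bullet> b)"
proof (rule smooth_fun_on_chartI[OF c])
  show op: "openin (mtop N) (W \<inter> fst c)" using W chart_open[OF c] by (rule openin_Int)
  have "smooth_on (snd c ` (W \<inter> fst c)) (\<lambda>x. hat c Y x \<bullet> b)"
    by (rule smooth_on_bounded_linear[OF chart_image_open[OF c W] bounded_linear_inner_left hat_smooth[OF c Y]])
  then show "smooth_on (snd c ` (W \<inter> fst c)) ((\<lambda>q. coords N c q (Y q) \<bullet> b) \<circ> chart_inv c)"
    by (simp add: hat_def o_def)
qed simp

lemma field_expansion:
  assumes c: "c \<in> atlas N" "q \<in> fst c"
  shows "v = (\<Sum>b\<in>Basis. (coords N c q v \<bullet> b) *\<^sub>R coord_field N c b q)"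
  using linear_expand_Basis[OF linear_coord_field[OF c], of "coords N c q v"] coord_field_coords[OF c, of v]
  by simp

end

locale affine_manifold = charted_manifold N for N :: "('a, 'n::euclidean_space) manifold" +
  fixes D :: "('a, 'n) connection"
  assumes conn: "affine_connection N D"
begin

lemma D_linear: "p \<in> points N \<Longrightarrow> smooth_field_near N p Y \<Longrightarrow> linear (\<lambda>v. D p v Y)"
  using conn by (simp add: affine_connection_def)

lemma D_add: "p \<in> points N \<Longrightarrow> smooth_field_near N p Y \<Longrightarrow> smooth_field_near N p Z \<Longrightarrow>
    D p v (\<lambda>q. Y q + Z q) = D p v Y + D p v Z"
  using conn by (simp add: affine_connection_def)

lemma D_scaleR: "p \<in> points N \<Longrightarrow> smooth_field_near N p Y \<Longrightarrow> smooth_fun_near N p f \<Longrightarrow>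
    D p v (\<lambda>q. f q *\<^sub>R Y q) = dir_deriv N p v f *\<^sub>R Y p + f p *\<^sub>R D p v Y"
  using conn by (simp add: affine_connection_def)

lemma D_smooth: "openin (mtop N) W \<Longrightarrow> smooth_field_on N W X \<Longrightarrow> smooth_field_on N W Y \<Longrightarrow>
    smooth_field_on N W (\<lambda>q. D q (X q) Y)"
  using conn by (simp add: affine_connection_def)

text \<open>Multiplication by the indicator function of \<open>W\<close> makes the two fields equal
  everywhere. The indicator is smooth near \<open>p\<close> with derivative 0 there, so the Leibniz
  rule leaves both covariant derivatives unchanged.\<close>

lemma D_cong:
  assumes W: "openin (mtop N) W" "p \<in> W" and YZ: "\<And>q. q \<in> W \<Longrightarrow> Y q = Z q"
    and Y: "smooth_field_near N p Y" and Z: "smooth_field_near N p Z"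
  shows "D p v Y = D p v Z"
proof -
  have p: "p \<in> points N" using W openin_subset by blast
  define f where "f = (\<lambda>q. if q \<in> W then 1 else (0::real))"
  have f1: "smooth_fun_near N p f"
    unfolding smooth_fun_near_def smooth_fun_on_def
  proof (intro exI[of _ W] conjI W ballI)
    fix c assume c: "c \<in> atlas N"
    show "smooth_on (snd c ` (W \<inter> fst c)) (f \<circ> chart_inv c)"
      by (rule smooth_on_eq[OF chart_image_open[OF c W(1)] smooth_on_const[of _ 1]])
        (auto simp: f_def chart_inv_chart[OF c])
  qed
  have f2: "dir_deriv N p v f = 0"
    using dir_deriv_cong[OF W, of f "\<lambda>r. 1"] dir_deriv_const by (simp add: f_def)
  have "D p v (\<lambda>q. f q *\<^sub>R X q) = D p v X" if "smooth_field_near N p X" for X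
    using D_scaleR[OF p that f1] W by (simp add: f2) (simp add: f_def)
  moreover have "(\<lambda>q. f q *\<^sub>R Y q) = (\<lambda>q. f q *\<^sub>R Z q)" using YZ by (auto simp: f_def)
  ultimately show ?thesis using Y Z by metis
qed

lemma D_sum:
  assumes p: "p \<in> W" and W: "openin (mtop N) W" and fin: "finite I"
    and Y: "\<And>i. i \<in> I \<Longrightarrow> smooth_field_on N W (Y i)"
  shows "D p v (\<lambda>q. \<Sum>i\<in>I. Y i q) = (\<Sum>i\<in>I. D p v (Y i))"
  using fin Y
proof (induction I rule: finite_induct)
  case empty
  have pp: "p \<in> points N" using W p openin_subset by blast
  have near: "smooth_field_near N p (\<lambda>q. 0)"
    using smooth_field_on_sum[OF W, of "{}"] W p by (auto simp: smooth_field_near_def)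
  \<comment> \<open>The zero field is 0 times itself, so the Leibniz rule gives it covariant
    derivative 0.\<close>
  show ?case
    using D_scaleR[OF pp near smooth_fun_near_const[OF pp, of 0], of v] by (simp add: dir_deriv_const)
next
  case (insert i I)
  have pp: "p \<in> points N" using W p openin_subset by blast
  have "smooth_field_near N p (Y i)" "smooth_field_near N p (\<lambda>q. \<Sum>i\<in>I. Y i q)"
    using insert.prems smooth_field_on_sum[OF W, of I Y] W p by (auto simp: smooth_field_near_def)
  from D_add[OF pp this, of v] show ?case using insert by simp
qed

definition christoffel :: "('a, 'n) chart \<Rightarrow> 'n \<Rightarrow> 'n \<Rightarrow> 'n \<Rightarrow> 'n" where
  "christoffel c x w u =
    coords N c (chart_inv c x) (D (chart_inv c x) (coord_field N c w (chart_inv c x)) (coord_field N c u))"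

text \<open>The field is a combination of coordinate fields only on the chart domain, so
  \<open>D_cong\<close> has to come before additivity and the Leibniz rule.\<close>

lemma D_expand:
  assumes c: "c \<in> atlas N" "p \<in> fst c" and Y: "smooth_field_near N p Y"
  shows "coords N c p (D p v Y) = dd (coords N c p v) (hat c Y) (snd c p)
    + (\<Sum>b\<in>Basis. (coords N c p (Y p) \<bullet> b) *\<^sub>R christoffel c (snd c p) (coords N c p v) b)"
proof -
  obtain W0 where W0: "openin (mtop N) W0" "p \<in> W0" "smooth_field_on N W0 Y"
    using Y by (auto simp: smooth_field_near_def)
  define W where "W = W0 \<inter> fst c"
  have W: "openin (mtop N) W" "p \<in> W" using W0 c chart_open[OF c(1)] by (auto simp: W_def)
  have p: "p \<in> points N" by (rule chart_points[OF c])
  define f where "f = (\<lambda>b q. coords N c q (Y q) \<bullet> b)"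
  define E where "E = coord_field N c"
  have f: "smooth_fun_on N W (f b)" for b
    unfolding W_def f_def by (rule component_smooth[OF c(1) W0(1,3)])
  have Esm: "smooth_field_on N W (E b)" for b
    unfolding E_def by (rule smooth_field_on_subset[OF smooth_coord_field[OF c(1)]]) (simp add: W_def)
  have fE: "smooth_field_on N W (\<lambda>q. f b q *\<^sub>R E b q)" for b
    by (rule smooth_field_on_scaleR[OF W(1) f Esm])
  have "D p v Y = D p v (\<lambda>q. \<Sum>b\<in>Basis. f b q *\<^sub>R E b q)"
  proof (rule D_cong[OF W])
    show "Y q = (\<Sum>b\<in>Basis. f b q *\<^sub>R E b q)" if "q \<in> W" for q
      using field_expansion[OF c(1), of q "Y q"] that by (simp add: W_def f_def E_def)
    show "smooth_field_near N p (\<lambda>q. \<Sum>b\<in>Basis. f b q *\<^sub>R E b q)"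
      using smooth_field_on_sum[OF W(1), of Basis "\<lambda>b q. f b q *\<^sub>R E b q"] fE W
      unfolding smooth_field_near_def by blast
  qed (rule Y)
  also have "\<dots> = (\<Sum>b\<in>Basis. D p v (\<lambda>q. f b q *\<^sub>R E b q))"
    by (rule D_sum[OF W(2,1) finite_Basis fE])
  also have "\<dots> = (\<Sum>b\<in>Basis. dir_deriv N p v (f b) *\<^sub>R E b p + f b p *\<^sub>R D p v (E b))"
    by (intro sum.cong refl D_scaleR p) (use f Esm W in \<open>auto simp: smooth_fun_near_def smooth_field_near_def\<close>)
  finally have DY: "D p v Y = (\<Sum>b\<in>Basis. dir_deriv N p v (f b) *\<^sub>R E b p + f b p *\<^sub>R D p v (E b))" .
  have hd: "hat c Y differentiable (at (snd c p))" by (rule hat_differentiable[OF c Y])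
  have fb: "(f b \<circ> chart_inv c) = (\<lambda>x. hat c Y x \<bullet> b)" for b by (simp add: f_def hat_def o_def)
  have df: "dir_deriv N p v (f b) = dd (coords N c p v) (hat c Y) (snd c p) \<bullet> b" for b
  proof -
    have "(\<lambda>x. hat c Y x \<bullet> b) differentiable (at (snd c p))"
      using has_derivative_inner_left[OF dd_works[OF hd], of b] by (rule differentiableI)
    then show ?thesis
      using dir_deriv_chart[OF c, of "f b" v] dd_bounded_linear[OF bounded_linear_inner_left hd]
      unfolding fb by simp
  qed
  have ch: "christoffel c (snd c p) (coords N c p v) b = coords N c p (D p v (E b))" for b
    by (simp add: christoffel_def chart_inv_chart[OF c] coord_field_coords[OF c] E_def)
  have "coords N c p (E b p) = b" "f b p = coords N c p (Y p) \<bullet> b" for b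
    by (simp_all add: E_def f_def coords_coord_field[OF c])
  then show ?thesis
    unfolding DY ch df
    by (simp add: linear_sum[OF linear_coords[OF c]] linear_add[OF linear_coords[OF c]]
        linear_scale[OF linear_coords[OF c]] sum.distrib euclidean_representation)
qed

end


section \<open>Nearly Kaehler manifolds in a chart\<close>

locale nk_manifold = affine_manifold N D for N :: "('a, 'n::euclidean_space) manifold" and D +
  fixes g :: "'a \<Rightarrow> 'n \<Rightarrow> 'n \<Rightarrow> real" and J :: "'a \<Rightarrow> 'n \<Rightarrow> 'n"
  assumes nk: "nearly_kaehler N g J D"
begin

lemma ah: "riemannian_metric N g" "almost_complex_structure N J"
    "p \<in> points N \<Longrightarrow> g p (J p u) (J p v) = g p u v"
    "torsion_free N D" "metric_connection N g D"
  using nk by (auto simp: nearly_kaehler_def almost_hermitian_def levi_civita_def)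

lemma hermitian_at:
  assumes p: "p \<in> points N" shows "hermitian_form (g p) (J p)"
proof (intro hermitian_form.intro inner_form.intro hermitian_form_axioms.intro)
  show "bilinear (g p)" "g p u v = g p v u" "v \<noteq> 0 \<Longrightarrow> 0 < g p v v" for u v
    using ah(1) p by (auto simp: riemannian_metric_def)
  show "linear (J p)" "J p (J p v) = - v" for v
    using ah(2) p by (auto simp: almost_complex_structure_def)
  show "g p (J p u) (J p v) = g p u v" for u v by (rule ah(3)[OF p])
qed

lemma J_smooth: "openin (mtop N) W \<Longrightarrow> smooth_field_on N W Y \<Longrightarrow> smooth_field_on N W (\<lambda>q. J q (Y q))"
  using ah(2) by (simp add: almost_complex_structure_def)

lemma J_near: "smooth_field_near N p Y \<Longrightarrow> smooth_field_near N p (\<lambda>q. J q (Y q))"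
  using J_smooth unfolding smooth_field_near_def by blast

definition lg :: "('a, 'n) chart \<Rightarrow> 'n \<Rightarrow> 'n \<Rightarrow> 'n \<Rightarrow> real" where
  "lg c x u v = g (chart_inv c x) (coord_field N c u (chart_inv c x)) (coord_field N c v (chart_inv c x))"

definition lJ :: "('a, 'n) chart \<Rightarrow> 'n \<Rightarrow> 'n \<Rightarrow> 'n" where
  "lJ c x u = coords N c (chart_inv c x) (J (chart_inv c x) (coord_field N c u (chart_inv c x)))"

context
  fixes c assumes c: "c \<in> atlas N"
begin

abbreviation "V \<equiv> snd c ` fst c"
abbreviation "\<Gamma> \<equiv> christoffel c"

lemma lg_chart: "q \<in> fst c \<Longrightarrow> lg c (snd c q) u v = g q (coord_field N c u q) (coord_field N c v q)"
  by (simp add: lg_def chart_inv_chart[OF c])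

lemma lJ_chart: "q \<in> fst c \<Longrightarrow> lJ c (snd c q) u = coords N c q (J q (coord_field N c u q))"
  by (simp add: lJ_def chart_inv_chart[OF c])

lemma coord_field_lJ: "q \<in> fst c \<Longrightarrow> coord_field N c (lJ c (snd c q) u) q = J q (coord_field N c u q)"
  by (simp add: lJ_chart coord_field_coords[OF c])

lemma \<Gamma>_chart: "q \<in> fst c \<Longrightarrow> \<Gamma> (snd c q) w u = coords N c q (D q (coord_field N c w q) (coord_field N c u))"
  by (simp add: christoffel_def chart_inv_chart[OF c])

lemma coord_field_\<Gamma>:
  "q \<in> fst c \<Longrightarrow> coord_field N c (\<Gamma> (snd c q) w u) q = D q (coord_field N c w q) (coord_field N c u)"
  by (simp add: \<Gamma>_chart coord_field_coords[OF c])

lemma V_open: "open V"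
  using chart_image_open[OF c chart_open[OF c]] by simp

lemma lhermitian: assumes q: "q \<in> fst c" shows "hermitian_form (lg c (snd c q)) (lJ c (snd c q))"
proof -
  interpret hermitian_form "g q" "J q" by (rule hermitian_at[OF chart_points[OF c q]])
  note lin = linear_coord_field[OF c q] and linc = linear_coords[OF c q]
  note E = linear_add[OF lin] linear_scale[OF lin] linear_add[OF linc] linear_scale[OF linc]
    linear_neg[OF lin] linear_neg[OF linc]
  show ?thesis
  proof (intro hermitian_form.intro inner_form.intro hermitian_form_axioms.intro)
    show "bilinear (lg c (snd c q))"
      unfolding bilinear_def
      by (auto intro!: linearI simp: lg_chart[OF q] E G_simps)
    show "lg c (snd c q) u v = lg c (snd c q) v u" for u v
      using sym by (simp add: lg_chart[OF q])
    show "0 < lg c (snd c q) v v" if "v \<noteq> 0" for v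
    proof -
      have "coord_field N c v q \<noteq> 0"
        using coords_coord_field[OF c q, of v] linear_0[OF linc] that by auto
      then show ?thesis unfolding lg_chart[OF q] by (rule pos)
    qed
    show "linear (lJ c (snd c q))"
      by (intro linearI) (simp_all add: lJ_chart[OF q] E J_simps)
    show "lJ c (snd c q) (lJ c (snd c q) v) = - v" for v
      by (simp add: lJ_chart[OF q] coord_field_coords[OF c q] J_J E coords_coord_field[OF c q])
    show "lg c (snd c q) (lJ c (snd c q) u) (lJ c (snd c q) v) = lg c (snd c q) u v" for u v
      by (simp add: lg_chart[OF q] coord_field_lJ[OF q] G_J)
  qed
qed

lemma hat_coord_field: "x \<in> V \<Longrightarrow> hat c (coord_field N c u) x = u"
  by (auto simp: hat_chart[OF c] coords_coord_field[OF c])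

lemma hat_J: "x \<in> V \<Longrightarrow> hat c (\<lambda>q. J q (Y q)) x = lJ c x (hat c Y x)"
  by (auto simp: hat_chart[OF c] lJ_chart coord_field_coords[OF c])

text \<open>Linearity of the Christoffel symbols in the differentiated field is not part of their
  definition. It follows from \<open>D_expand\<close> because a coordinate field has constant
  components.\<close>

lemma D_expand_coord:
  assumes q: "q \<in> fst c"
  shows "\<Gamma> (snd c q) w u = (\<Sum>b\<in>Basis. (u \<bullet> b) *\<^sub>R \<Gamma> (snd c q) w b)"
proof -
  have "dd w (hat c (coord_field N c u)) (snd c q) = dd w (\<lambda>x. u) (snd c q)"
    by (rule fun_cong[OF dd_cong_open[OF V_open]]) (use q in \<open>auto simp: hat_coord_field\<close>)
  then show ?thesis
    using D_expand[OF c q coord_field_near[OF c q, of u], of "coord_field N c w q"]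
    by (simp add: coords_coord_field[OF c q] \<Gamma>_chart[OF q])
qed

lemma bilinear_\<Gamma>: assumes q: "q \<in> fst c" shows "bilinear (\<Gamma> (snd c q))"
proof -
  note lin = linear_coord_field[OF c q] and linc = linear_coords[OF c q]
    and linD = D_linear[OF chart_points[OF c q] coord_field_near[OF c q]]
  have "linear (\<lambda>w. \<Gamma> (snd c q) w u)" for u
    by (rule linearI) (simp_all add: \<Gamma>_chart[OF q] linear_add[OF lin] linear_scale[OF lin]
        linear_add[OF linD] linear_scale[OF linD] linear_add[OF linc] linear_scale[OF linc])
  moreover have "linear (\<Gamma> (snd c q) w)" for w
  proof -
    have "\<Gamma> (snd c q) w = (\<lambda>u. \<Sum>b\<in>Basis. (u \<bullet> b) *\<^sub>R \<Gamma> (snd c q) w b)"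
      by (rule ext) (rule D_expand_coord[OF q])
    moreover have "linear (\<lambda>u. \<Sum>b\<in>Basis. (u \<bullet> b) *\<^sub>R \<Gamma> (snd c q) w b)"
      by (intro linear_compose_sum ballI linearI) (simp_all add: inner_add_left scaleR_left_distrib)
    ultimately show ?thesis by simp
  qed
  ultimately show ?thesis by (simp add: bilinear_def)
qed

lemma D_coords:
  assumes q: "q \<in> fst c" and Y: "smooth_field_near N q Y"
  shows "coords N c q (D q v Y) = dd (coords N c q v) (hat c Y) (snd c q)
    + \<Gamma> (snd c q) (coords N c q v) (hat c Y (snd c q))"
proof -
  have "linear (\<Gamma> (snd c q) (coords N c q v))"
    using bilinear_\<Gamma>[OF q] by (simp add: bilinear_def)
  from linear_expand_Basis[OF this, of "hat c Y (snd c q)"] show ?thesis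
    using D_expand[OF c q Y, of v] by (simp add: hat_chart[OF c q])
qed

text \<open>Torsion-freeness is tested on the coordinate functions of \<open>c\<close>. Coordinate
  fields map them to constants, so the bracket of two coordinate fields annihilates them.\<close>

lemma \<Gamma>_symmetric: assumes q: "q \<in> fst c" shows "\<Gamma> (snd c q) w u = \<Gamma> (snd c q) u w"
proof -
  have p: "q \<in> points N" by (rule chart_points[OF c q])
  define Z where "Z = D q (coord_field N c w q) (coord_field N c u) - D q (coord_field N c u q) (coord_field N c w)"
  have "coords N c q Z \<bullet> b = 0" for b
  proof -
    define f where "f = (\<lambda>r. snd c r \<bullet> b)"
    have fc: "(f \<circ> chart_inv c) x = x \<bullet> b" if "x \<in> V" for x
      using chart_chart_inv[OF that] by (simp add: f_def)
    have fd: "dd v (f \<circ> chart_inv c) (snd c r) = v \<bullet> b" "(f \<circ> chart_inv c) differentiable (at (snd c r))"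
      if "r \<in> fst c" for r v
    proof -
      have x: "snd c r \<in> V" using that by blast
      have "((\<lambda>x. x \<bullet> b) has_derivative (\<lambda>v. v \<bullet> b)) (at (snd c r))"
        by (intro derivative_eq_intros) auto
      then have "((f \<circ> chart_inv c) has_derivative (\<lambda>v. v \<bullet> b)) (at (snd c r))"
        by (rule has_derivative_transform_within_open[OF _ V_open x]) (simp add: fc del: o_apply)
      then show "dd v (f \<circ> chart_inv c) (snd c r) = v \<bullet> b" "(f \<circ> chart_inv c) differentiable (at (snd c r))"
        by (auto intro: dd_eqI differentiableI)
    qed
    have near: "smooth_fun_near N q f"
      unfolding smooth_fun_near_def
    proof (intro exI[of _ "fst c"] conjI chart_open[OF c] q smooth_fun_on_chartI[OF c])
      have "smooth_on V (\<lambda>x. x)" by (rule smooth_on_ident)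
      from smooth_on_bounded_linear[OF V_open bounded_linear_inner_left this]
      show "smooth_on V (f \<circ> chart_inv c)"
        by (rule smooth_on_eq[OF V_open]) (simp add: fc del: o_apply)
    qed simp
    have *: "dir_deriv N q z (\<lambda>r. dir_deriv N r (coord_field N c v r) f) = 0" for z v
    proof -
      have "dir_deriv N q z (\<lambda>r. dir_deriv N r (coord_field N c v r) f) = dir_deriv N q z (\<lambda>r. v \<bullet> b)"
        by (rule dir_deriv_cong[OF chart_open[OF c] q])
          (simp add: dir_deriv_coord_field[OF c _ fd(2)] fd(1))
      then show ?thesis by (simp add: dir_deriv_const)
    qed
    have "dir_deriv N q Z f = 0"
      using ah(4) p coord_field_near[OF c q] near
      unfolding torsion_free_def Z_def by (simp add: *)
    then show ?thesis by (simp add: dir_deriv_chart[OF c q fd(2)[OF q]] fd(1)[OF q])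
  qed
  then have "coords N c q Z = 0" by (metis euclidean_eqI inner_zero_left)
  then show ?thesis
    by (simp add: Z_def linear_diff[OF linear_coords[OF c q]] \<Gamma>_chart[OF q])
qed

lemma metric_chart:
  assumes q: "q \<in> fst c"
  shows "dd w (\<lambda>x. lg c x u v) (snd c q)
    = lg c (snd c q) (\<Gamma> (snd c q) w u) v + lg c (snd c q) u (\<Gamma> (snd c q) w v)"
proof -
  have p: "q \<in> points N" by (rule chart_points[OF c q])
  have "smooth_fun_on N (fst c) (\<lambda>r. g r (coord_field N c u r) (coord_field N c v r))"
    using ah(1) chart_open[OF c] smooth_coord_field[OF c] by (simp add: riemannian_metric_def)
  then have sm: "smooth_on V ((\<lambda>r. g r (coord_field N c u r) (coord_field N c v r)) \<circ> chart_inv c)"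
    using c unfolding smooth_fun_on_def by (metis Int_absorb)
  have eq: "(\<lambda>r. g r (coord_field N c u r) (coord_field N c v r)) \<circ> chart_inv c = (\<lambda>x. lg c x u v)"
    by (simp add: lg_def o_def)
  have "dir_deriv N q (coord_field N c w q) (\<lambda>r. g r (coord_field N c u r) (coord_field N c v r))
      = dd w (\<lambda>x. lg c x u v) (snd c q)"
    using dir_deriv_coord_field[OF c q smooth_on_differentiable[OF sm], of w] q unfolding eq by simp
  moreover have "dir_deriv N q (coord_field N c w q) (\<lambda>r. g r (coord_field N c u r) (coord_field N c v r))
      = g q (D q (coord_field N c w q) (coord_field N c u)) (coord_field N c v q)
        + g q (coord_field N c u q) (D q (coord_field N c w q) (coord_field N c v))"
    using ah(5) p coord_field_near[OF c q] by (simp add: metric_connection_def)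
  ultimately show ?thesis by (simp add: lg_chart[OF q] coord_field_\<Gamma>[OF q])
qed

lemma smooth_lg: "smooth_on V (\<lambda>x. lg c x u v)"
proof -
  have "smooth_fun_on N (fst c) (\<lambda>r. g r (coord_field N c u r) (coord_field N c v r))"
    using ah(1) chart_open[OF c] smooth_coord_field[OF c] by (simp add: riemannian_metric_def)
  from bspec[OF this[unfolded smooth_fun_on_def] c] show ?thesis
    by (simp add: lg_def o_def)
qed

lemma smooth_lJ: "smooth_on V (\<lambda>x. lJ c x u)"
  using bspec[OF J_smooth[OF chart_open[OF c] smooth_coord_field[OF c], unfolded smooth_field_on_def] c, of u]
  by (simp add: lJ_def o_def)

lemma smooth_\<Gamma>: "smooth_on V (\<lambda>x. \<Gamma> x w u)"
  using bspec[OF D_smooth[OF chart_open[OF c] smooth_coord_field[OF c] smooth_coord_field[OF c],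
      unfolded smooth_field_on_def] c, of w u]
  by (simp add: christoffel_def o_def)

text \<open>The derivative of the components of \<open>Y\<close> enters both \<open>D (J Y)\<close>
  and \<open>J (D Y)\<close> through \<open>J\<close> and cancels. What remains depends on
  \<open>Y q\<close> only and is the coordinate expression of \<open>DJ\<close>.\<close>

lemma cov_deriv_J_chart:
  assumes q: "q \<in> fst c" and Y: "smooth_field_near N q Y"
  shows "coords N c q (cov_deriv_J D J q v Y)
    = dd (coords N c q v) (\<lambda>x. lJ c x (coords N c q (Y q))) (snd c q)
      + \<Gamma> (snd c q) (coords N c q v) (lJ c (snd c q) (coords N c q (Y q)))
      - lJ c (snd c q) (\<Gamma> (snd c q) (coords N c q v) (coords N c q (Y q)))"
proof -
  let ?x = "snd c q" and ?w = "coords N c q v" and ?y = "coords N c q (Y q)"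
  interpret hermitian_form "lg c ?x" "lJ c ?x" by (rule lhermitian[OF q])
  have x: "?x \<in> V" using q by blast
  have lin: "linear (lJ c z)" if "z \<in> V" for z
    using that hermitian_form.lin_J[OF lhermitian] by blast
  have hY: "hat c Y ?x = ?y" by (rule hat_chart[OF c q])
  have "((\<lambda>z. lJ c z (hat c Y z)) has_derivative (\<lambda>w. dd w (\<lambda>z. lJ c z ?y) ?x + lJ c ?x (dd w (hat c Y) ?x))) (at ?x)"
    using has_derivative_linear_family[OF V_open x lin dd_works[OF smooth_on_differentiable[OF smooth_lJ x]]
        dd_works[OF hat_differentiable[OF c q Y]]]
    by (simp add: hY)
  then have "(hat c (\<lambda>q. J q (Y q)) has_derivative
      (\<lambda>w. dd w (\<lambda>z. lJ c z ?y) ?x + lJ c ?x (dd w (hat c Y) ?x))) (at ?x)"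
    by (rule has_derivative_transform_within_open[OF _ V_open x]) (simp add: hat_J)
  then have 1: "dd ?w (hat c (\<lambda>q. J q (Y q))) ?x = dd ?w (\<lambda>z. lJ c z ?y) ?x + lJ c ?x (dd ?w (hat c Y) ?x)"
    by (rule dd_eqI)
  have "coords N c q (J q (D q v Y)) = lJ c ?x (coords N c q (D q v Y))"
    by (simp add: lJ_chart[OF q] coord_field_coords[OF c q])
  also have "\<dots> = lJ c ?x (dd ?w (hat c Y) ?x) + lJ c ?x (\<Gamma> ?x ?w ?y)"
    unfolding D_coords[OF q Y, of v] hY by (rule J_simps(1))
  finally have 2: "coords N c q (J q (D q v Y)) = lJ c ?x (dd ?w (hat c Y) ?x) + lJ c ?x (\<Gamma> ?x ?w ?y)" .
  show ?thesis
    unfolding cov_deriv_J_def linear_diff[OF linear_coords[OF c q]]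
      D_coords[OF q J_near[OF Y]] 1 2 hat_J[OF x] hY by simp
qed

lemma local_nk: "local_nearly_kaehler V (lg c) (lJ c) \<Gamma>"
proof (rule local_nearly_kaehler.intro)
  show "open V" by (rule V_open)
  show "hermitian_form (lg c x) (lJ c x)" if "x \<in> V" for x using lhermitian that by blast
  show "bilinear (\<Gamma> x)" if "x \<in> V" for x using bilinear_\<Gamma> that by blast
  show "\<Gamma> x u v = \<Gamma> x v u" if "x \<in> V" for x u v using \<Gamma>_symmetric that by blast
  show "smooth_on V (\<lambda>x. lg c x u v)" for u v by (rule smooth_lg)
  show "smooth_on V (\<lambda>x. lJ c x u)" for u by (rule smooth_lJ)
  show "smooth_on V (\<lambda>x. \<Gamma> x u v)" for u v by (rule smooth_\<Gamma>)
  show "dd w (\<lambda>y. lg c y u v) x = lg c x (\<Gamma> x w u) v + lg c x u (\<Gamma> x w v)" if "x \<in> V" for x u v w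
    using metric_chart that by blast
  show "dd v (\<lambda>y. lJ c y v) x + \<Gamma> x v (lJ c x v) - lJ c x (\<Gamma> x v v) = 0" if "x \<in> V" for x v
  proof -
    obtain q where q: "q \<in> fst c" "x = snd c q" using \<open>x \<in> V\<close> by blast
    have "cov_deriv_J D J q (coord_field N c v q) (coord_field N c v) = 0"
      using nk chart_points[OF c q(1)] coord_field_near[OF c q(1)] by (simp add: nearly_kaehler_def)
    then show ?thesis
      using cov_deriv_J_chart[OF q(1) coord_field_near[OF c q(1), of v], of "coord_field N c v q"]
      by (simp add: q coords_coord_field[OF c q(1)] linear_0[OF linear_coords[OF c q(1)]])
  qed
qed

end

end


section \<open>Lagrangian submanifolds\<close>

locale lagrangian_submanifold = nk_manifold N D g J + sub: charted_manifold M
  for N :: "('b, 'n::euclidean_space) manifold" and D g J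
    and M :: "('a, 'm::euclidean_space) manifold" +
  fixes F :: "'a \<Rightarrow> 'b"
  assumes lagr: "lagrangian M N g J F"
begin

lemma F_smooth: "smooth_map M N F" and F_inj: "p \<in> points M \<Longrightarrow> inj (tangent_map M N F p)"
  and F_normal: "p \<in> points M \<Longrightarrow> J (F p) ` tangent_space M N F p = normal_space M N g F p"
  using lagr by (auto simp: lagrangian_def immersion_def)

lemma F_cont: "continuous_map (mtop M) (mtop N) F"
  using F_smooth by (simp add: smooth_map_def)

lemma F_points: "p \<in> points M \<Longrightarrow> F p \<in> points N"
  using F_cont by (auto simp: continuous_map_def)

context
  fixes c d assumes c: "c \<in> atlas N" and d: "d \<in> atlas M"
begin

abbreviation "W \<equiv> fst d \<inter> F -` fst c"
abbreviation "U \<equiv> snd d ` W"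
abbreviation "\<phi> \<equiv> snd c \<circ> F \<circ> chart_inv d"

lemma W_open: "openin (mtop M) W"
proof -
  have "openin (mtop M) {x \<in> topspace (mtop M). F x \<in> fst c}"
    by (rule openin_continuous_map_preimage[OF F_cont chart_open[OF c]])
  from openin_Int[OF sub.chart_open[OF d] this]
  have "openin (mtop M) (fst d \<inter> {x \<in> topspace (mtop M). F x \<in> fst c})" .
  moreover have "fst d \<inter> {x \<in> topspace (mtop M). F x \<in> fst c} = W"
    using sub.chart_points[OF d] by auto
  ultimately show ?thesis by simp
qed

lemma U_open: "open U"
proof -
  have "W \<inter> fst d = W" by blast
  then show ?thesis using sub.chart_image_open[OF d W_open] by simp
qed

lemma \<phi>_smooth: "smooth_on U \<phi>"
  using F_smooth c d by (simp add: smooth_map_def)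

lemma \<phi>_chart: "q \<in> W \<Longrightarrow> \<phi> (snd d q) = snd c (F q)"
  by (simp add: sub.chart_inv_chart[OF d])

lemma \<phi>_differentiable: "q \<in> W \<Longrightarrow> \<phi> differentiable (at (snd d q))"
  by (rule smooth_on_differentiable[OF \<phi>_smooth imageI])

text \<open>The chain rule through the transition from \<open>c\<close> to the reference chart at
  \<open>F q\<close>: in charts, the tangent map is the derivative of \<open>\<phi>\<close>.\<close>

lemma tangent_map_chart:
  assumes q: "q \<in> W"
  shows "tangent_map M N F q (coord_field M d u q) = coord_field N c (dd u \<phi> (snd d q)) (F q)"
proof -
  have qd: "q \<in> fst d" and qc: "F q \<in> fst c" using q by auto
  note c' = chart_at[OF chart_points[OF c qc]]
  define f where "f = snd (chart_at N (F q)) \<circ> F"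
  define t where "t = snd (chart_at N (F q)) \<circ> chart_inv c"
  have y: "snd d q \<in> U" using q by blast
  have t: "t differentiable (at (\<phi> (snd d q)))"
    unfolding \<phi>_chart[OF q] t_def by (rule transition_differentiable[OF c conjunct1[OF c'] qc conjunct2[OF c']])
  have eq: "t (\<phi> y) = (f \<circ> chart_inv d) y" if "y \<in> U" for y
    using that by (auto simp: t_def f_def sub.chart_inv_chart[OF d] chart_inv_chart[OF c])
  have df: "(f \<circ> chart_inv d) differentiable (at (snd d q))"
    by (rule differentiable_cong_open[OF U_open y eq differentiable_compose[OF t \<phi>_differentiable[OF q]]])
  have "tangent_map M N F q (coord_field M d u q) = dd u (f \<circ> chart_inv d) (snd d q)"
    unfolding tangent_map_def f_def[symmetric] by (rule sub.dir_deriv_coord_field[OF d qd df])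
  also have "\<dots> = dd u (\<lambda>y. t (\<phi> y)) (snd d q)"
    by (rule fun_cong[OF dd_cong_open[OF U_open y]]) (rule eq[symmetric])
  also have "\<dots> = dd (dd u \<phi> (snd d q)) t (\<phi> (snd d q))"
    by (rule dd_chain[OF \<phi>_differentiable[OF q] t])
  also have "\<dots> = coord_field N c (dd u \<phi> (snd d q)) (F q)"
    unfolding \<phi>_chart[OF q] coord_field_def t_def ..
  finally show ?thesis .
qed

lemma coords_tangent_map:
  "q \<in> W \<Longrightarrow> coords N c (F q) (tangent_map M N F q (coord_field M d u q)) = dd u \<phi> (snd d q)"
  by (simp add: tangent_map_chart coords_coord_field[OF c])

lemma tangent_space_chart:
  assumes q: "q \<in> W"
  shows "tangent_space M N F q = range (\<lambda>u. coord_field N c (dd u \<phi> (snd d q)) (F q))"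
proof -
  have qd: "q \<in> fst d" using q by auto
  have "range (tangent_map M N F q) = tangent_map M N F q ` range (\<lambda>u. coord_field M d u q)"
    using surjI[of "\<lambda>u. coord_field M d u q" "coords M d q", OF sub.coord_field_coords[OF d qd]] by simp
  then show ?thesis
    unfolding tangent_space_def image_image tangent_map_chart[OF q] .
qed

lemma frame_chart:
  assumes q: "q \<in> W"
  shows "lagrangian_frame (lg c (\<phi> (snd d q))) (lJ c (\<phi> (snd d q))) (\<lambda>u. dd u \<phi> (snd d q))"
proof -
  have qd: "q \<in> fst d" and qc: "F q \<in> fst c" using q by auto
  have qM: "q \<in> points M" by (rule sub.chart_points[OF d qd])
  define f where "f = (\<lambda>u. dd u \<phi> (snd d q))"
  define E where "E = (\<lambda>u. coord_field N c u (F q))"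
  have E_inv: "coords N c (F q) (E u) = u" "E (coords N c (F q) v) = v" for u v
    by (simp_all add: E_def coords_coord_field[OF c qc] coord_field_coords[OF c qc])
  have TS: "tangent_space M N F q = range (\<lambda>u. E (f u))"
    unfolding E_def f_def by (rule tangent_space_chart[OF q])
  have G: "lg c (snd c (F q)) u v = g (F q) (E u) (E v)" for u v
    by (simp add: lg_chart[OF c qc] E_def)
  have J: "lJ c (snd c (F q)) u = coords N c (F q) (J (F q) (E u))" for u
    by (simp add: lJ_chart[OF c qc] E_def)
  have normal: "u \<in> lJ c (snd c (F q)) ` range f \<longleftrightarrow> (\<forall>w. lg c (snd c (F q)) u (f w) = 0)" for u
  proof -
    have "u \<in> lJ c (snd c (F q)) ` range f \<longleftrightarrow> E u \<in> J (F q) ` tangent_space M N F q"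
    proof
      assume "u \<in> lJ c (snd c (F q)) ` range f"
      then obtain a where "u = coords N c (F q) (J (F q) (E (f a)))" by (auto simp: J)
      then have "E u = J (F q) (E (f a))" by (simp add: E_inv)
      then show "E u \<in> J (F q) ` tangent_space M N F q" unfolding TS by blast
    next
      assume "E u \<in> J (F q) ` tangent_space M N F q"
      then obtain a where a: "E u = J (F q) (E (f a))" unfolding TS by blast
      have "u = lJ c (snd c (F q)) (f a)" unfolding J a[symmetric] by (simp add: E_inv)
      then show "u \<in> lJ c (snd c (F q)) ` range f" by blast
    qed
    also have "\<dots> \<longleftrightarrow> (\<forall>w. g (F q) (E u) (E (f w)) = 0)"
      by (subst F_normal[OF qM]) (auto simp: normal_space_def TS)
    finally show ?thesis by (simp add: G)
  qed
  have "inj f"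
  proof (rule injI)
    fix u v assume "f u = f v"
    then have "tangent_map M N F q (coord_field M d u q) = tangent_map M N F q (coord_field M d v q)"
      unfolding tangent_map_chart[OF q] f_def by simp
    then have "coord_field M d u q = coord_field M d v q" by (rule injD[OF F_inj[OF qM]])
    then have "coords M d q (coord_field M d u q) = coords M d q (coord_field M d v q)" by (rule arg_cong)
    then show "u = v" unfolding sub.coords_coord_field[OF d qd] .
  qed
  moreover have "linear f" unfolding f_def by (rule dd_linear[OF \<phi>_differentiable[OF q]])
  ultimately show ?thesis
    unfolding \<phi>_chart[OF q] f_def[symmetric]
    using normal
    by (intro lagrangian_frame.intro lagrangian_frame_axioms.intro lhermitian[OF c qc]) auto
qed

lemma local_lagrangian_chart: "local_lagrangian (snd c ` fst c) (lg c) (lJ c) (christoffel c) U \<phi>"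
proof (intro local_lagrangian.intro local_nk[OF c] local_lagrangian_axioms.intro U_open \<phi>_smooth)
  show "\<phi> ` U \<subseteq> snd c ` fst c" by (auto simp: sub.chart_inv_chart[OF d])
  show "lagrangian_frame (lg c (\<phi> y)) (lJ c (\<phi> y)) (\<lambda>u. dd u \<phi> y)" if "y \<in> U" for y
    using frame_chart that by blast
qed

end

text \<open>The constant \<open>k\<close> is the square of the isotropy function at
  \<open>p\<close>. The point is fixed, but the jet fed into the algebra comes from differentiating
  conditions on a whole chart domain around it.\<close>

lemma isotropic_at_imp_zero:
  assumes dim: "DIM('n) = 6"
    and strict: "\<And>v. v \<noteq> 0 \<Longrightarrow> \<exists>Y. smooth_field_near N (F p) Y \<and> cov_deriv_J D J (F p) v Y \<noteq> 0"
    and h: "second_fundamental_form M N g D F h"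
    and p: "p \<in> points M"
    and iso: "\<And>v. g (F p) (h p v v) (h p v v)
      = k * (g (F p) (tangent_map M N F p v) (tangent_map M N F p v))\<^sup>2"
  shows "h p v w = 0"
proof -
  define c where "c = chart_at N (F p)"
  define d where "d = chart_at M p"
  have Fp: "F p \<in> points N" by (rule F_points[OF p])
  have c: "c \<in> atlas N" "F p \<in> fst c" using chart_at[OF Fp] by (auto simp: c_def)
  have d: "d \<in> atlas M" "p \<in> fst d" using sub.chart_at[OF p] by (auto simp: d_def)
  \<comment> \<open>Both charts are the reference charts of their points, where a vector coincides
    with its components. Hence \<open>g (F p)\<close>, \<open>h p\<close> and the tangent map enter
    the coordinate setting unchanged.\<close>
  have E: "coord_field N c u (F p) = u" and C: "coords N c (F p) u = u" for u
    using coord_field_chart_at[OF Fp] coords_chart_at[OF Fp] by (auto simp: c_def)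
  have Es: "coord_field M d u p = u" and Cs: "coords M d p u = u" for u
    using sub.coord_field_chart_at[OF p] sub.coords_chart_at[OF p] by (auto simp: d_def)
  define y where "y = snd d p"
  let ?\<phi> = "snd c \<circ> F \<circ> chart_inv d"
  interpret L: local_lagrangian "snd c ` fst c" "lg c" "lJ c" "christoffel c"
      "snd d ` (fst d \<inter> F -` fst c)" ?\<phi>
    by (rule local_lagrangian_chart[OF c(1) d(1)])
  have pW: "p \<in> fst d \<inter> F -` fst c" using c d by auto
  have y: "y \<in> snd d ` (fst d \<inter> F -` fst c)" using pW by (auto simp: y_def)
  have \<phi>y: "?\<phi> y = snd c (F p)" unfolding y_def by (rule \<phi>_chart[OF c(1) d(1) pW])
  have tm: "tangent_map M N F p u = dd u ?\<phi> y" for u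
    using tangent_map_chart[OF c(1) d(1) pW, of u] by (simp only: Es E y_def)
  have G: "lg c (?\<phi> y) u v = g (F p) u v" for u v
    unfolding \<phi>y by (simp add: lg_chart[OF c] E)
  have \<Gamma>: "christoffel c (?\<phi> y) u v = D (F p) u (coord_field N c v)" for u v
    unfolding \<phi>y by (simp add: \<Gamma>_chart[OF c] E C)
  \<comment> \<open>The coordinate field with components \<open>u\<close> serves as the extension of
    \<open>u\<close>. The two sums in \<open>cov_deriv_along\<close> become the second derivative of
    the immersion and the Christoffel term of \<open>L.B\<close>.\<close>
  have B: "cov_deriv_along M N D F p w (\<lambda>q. tangent_map M N F q (coord_field M d u q)) = L.B y w u" for w u
  proof -
    define s where "s = (\<lambda>q. coords N c (F q) (tangent_map M N F q (coord_field M d u q)))"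
    have s: "s q = dd u ?\<phi> (snd d q)" if "q \<in> fst d \<inter> F -` fst c" for q
      unfolding s_def by (rule coords_tangent_map[OF c(1) d(1) that])
    have diff: "(\<lambda>z. dd u ?\<phi> z) differentiable (at y)"
      by (rule smooth_on_differentiable[OF smooth_on_dd[OF L.smooth_\<phi>] y])
    have ds: "dir_deriv M p w (\<lambda>q. s q \<bullet> b) = dd w (\<lambda>z. dd u ?\<phi> z) y \<bullet> b" for b
    proof -
      have eq: "dd u ?\<phi> z \<bullet> b = ((\<lambda>q. s q \<bullet> b) \<circ> chart_inv d) z"
        if "z \<in> snd d ` (fst d \<inter> F -` fst c)" for z
      proof -
        obtain q where q: "q \<in> fst d \<inter> F -` fst c" "z = snd d q" using \<open>z \<in> _\<close> by blast
        have "chart_inv d z = q" using q sub.chart_inv_chart[OF d(1), of q] by simp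
        then show ?thesis using s[OF q(1)] q(2) by (simp del: o_apply add: o_apply[of "\<lambda>q. s q \<bullet> b"])
      qed
      have "((\<lambda>z. dd u ?\<phi> z \<bullet> b) has_derivative (\<lambda>w. dd w (\<lambda>z. dd u ?\<phi> z) y \<bullet> b)) (at y)"
        by (rule has_derivative_inner_left[OF dd_works[OF diff]])
      then have der: "(((\<lambda>q. s q \<bullet> b) \<circ> chart_inv d) has_derivative (\<lambda>w. dd w (\<lambda>z. dd u ?\<phi> z) y \<bullet> b)) (at y)"
        by (rule has_derivative_transform_within_open[OF _ L.open_U y]) (rule eq)
      show ?thesis
        using sub.dir_deriv_chart[OF d, of "\<lambda>q. s q \<bullet> b" w] differentiableI[OF der] dd_eqI[OF der]
        by (simp only: y_def[symmetric] Cs)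
    qed
    have "cov_deriv_along M N D F p w (\<lambda>q. tangent_map M N F q (coord_field M d u q))
      = (\<Sum>b\<in>Basis. dir_deriv M p w (\<lambda>q. s q \<bullet> b) *\<^sub>R coord_field N c b (F p)
          + (s p \<bullet> b) *\<^sub>R D (F p) (tangent_map M N F p w) (coord_field N c b))"
      by (simp only: cov_deriv_along_def c_def[symmetric] Let_def s_def)
    also have "\<dots> = (\<Sum>b\<in>Basis. (dd w (\<lambda>z. dd u ?\<phi> z) y \<bullet> b) *\<^sub>R b
          + (dd u ?\<phi> y \<bullet> b) *\<^sub>R christoffel c (?\<phi> y) (dd w ?\<phi> y) b)"
      by (simp only: ds E \<Gamma> tm s[OF pW] y_def[symmetric])
    also have "\<dots> = L.B y w u"
    proof -
      have "linear (christoffel c (?\<phi> y) (dd w ?\<phi> y))"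
        unfolding \<phi>y using bilinear_\<Gamma>[OF c] by (simp add: bilinear_def)
      from linear_expand_Basis[OF this, of "dd u ?\<phi> y"] show ?thesis
        by (simp only: L.B_def sum.distrib euclidean_representation)
    qed
    finally show ?thesis .
  qed
  \<comment> \<open>The Gauss formula for the same coordinate field, whose value at \<open>p\<close>
    is \<open>u\<close> itself.\<close>
  have sff: "h p w u \<in> normal_space M N g F p \<and>
      cov_deriv_along M N D F p w (\<lambda>q. tangent_map M N F q (coord_field M d u q)) - h p w u
        \<in> tangent_space M N F p" for w u
    using h p sub.coord_field_near[OF d, of u] Es[of u] unfolding second_fundamental_form_def by metis
  have jet: "lagrangian_jet (lg c (?\<phi> y)) (lJ c (?\<phi> y)) (\<lambda>u. dd u ?\<phi> y)
      (\<lambda>a b e. lg c (?\<phi> y) (L.K (?\<phi> y) a b) e) (L.B y) (h p)"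
  proof (rule L.lagrangian_jet_at[OF y dim])
    show "\<exists>u. L.K (?\<phi> y) v u \<noteq> 0" if "v \<noteq> 0" for v
    proof -
      obtain Y where Y: "smooth_field_near N (F p) Y" "cov_deriv_J D J (F p) v Y \<noteq> 0"
        using strict[OF \<open>v \<noteq> 0\<close>] by blast
      have "L.K (?\<phi> y) v (Y (F p)) = cov_deriv_J D J (F p) v Y"
        using cov_deriv_J_chart[OF c Y(1), of v] unfolding L.K_def \<phi>y C by simp
      then show ?thesis using Y(2) by metis
    qed
    show "lg c (?\<phi> y) (h p w u) (dd v ?\<phi> y) = 0" for w u v
      using conjunct1[OF sff[of w u]] unfolding G normal_space_def tangent_space_def tm[symmetric] by blast
    show "L.B y w u - h p w u \<in> range (\<lambda>u. dd u ?\<phi> y)" for w u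
      using conjunct2[OF sff[of w u]] unfolding B tangent_space_def tm[abs_def] by simp
  qed
  show ?thesis
    by (rule lagrangian_jet.isotropic_imp_zero[OF jet, of k]) (use iso in \<open>simp only: G tm\<close>)
qed

end

theorem theorem1p2:
  fixes N :: "('b, 'n::euclidean_space) manifold"
    and M :: "('a, 'm::euclidean_space) manifold"
    and g :: "'b \<Rightarrow> 'n \<Rightarrow> 'n \<Rightarrow> real"
    and J :: "'b \<Rightarrow> 'n \<Rightarrow> 'n"
    and D :: "('b, 'n) connection"
    and F :: "'a \<Rightarrow> 'b"
    and h :: "'a \<Rightarrow> 'm \<Rightarrow> 'm \<Rightarrow> 'n"
  assumes "DIM('n) = 6"
    and "strict_nearly_kaehler N g J D"
    and "lagrangian M N g J F"
    and "second_fundamental_form M N g D F h"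
  shows "isotropic M N g F h \<longleftrightarrow> totally_geodesic M h"
proof -
  have nk: "nearly_kaehler N g J D" using assms(2) by (simp add: strict_nearly_kaehler_def)
  interpret lagrangian_submanifold N D g J M F
  proof (intro lagrangian_submanifold.intro nk_manifold.intro affine_manifold.intro charted_manifold.intro
      affine_manifold_axioms.intro nk_manifold_axioms.intro lagrangian_submanifold_axioms.intro nk assms(3))
    show "smooth_manifold N" "affine_connection N D"
      using nk by (auto simp: nearly_kaehler_def almost_hermitian_def levi_civita_def)
    show "smooth_manifold M" using assms(3) by (simp add: lagrangian_def)
  qed
  show ?thesis
  proof
    assume "isotropic M N g F h"
    then obtain \<mu> :: "'a \<Rightarrow> real" where \<mu>: "\<And>p v. p \<in> points M \<Longrightarrow> g (F p) (h p v v) (h p v v)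
        = (\<mu> p)\<^sup>2 * (g (F p) (tangent_map M N F p v) (tangent_map M N F p v))\<^sup>2"
      unfolding isotropic_def by blast
    show "totally_geodesic M h"
      unfolding totally_geodesic_def
    proof (intro ballI allI)
      fix p v w assume p: "p \<in> points M"
      show "h p v w = 0"
      proof (rule isotropic_at_imp_zero[OF assms(1) _ assms(4) p])
        show "\<exists>Y. smooth_field_near N (F p) Y \<and> cov_deriv_J D J (F p) v Y \<noteq> 0" if "v \<noteq> 0" for v
          using assms(2) F_points[OF p] that by (simp add: strict_nearly_kaehler_def)
        show "g (F p) (h p v v) (h p v v) = (\<mu> p)\<^sup>2 * (g (F p) (tangent_map M N F p v) (tangent_map M N F p v))\<^sup>2"
          for v by (rule \<mu>[OF p])
      qed
    qed
  next
    assume tg: "totally_geodesic M h"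
    have "g (F p) 0 0 = 0" if "p \<in> points M" for p
      using ah(1) F_points[OF that] bilinear_lzero by (auto simp: riemannian_metric_def)
    then show "isotropic M N g F h"
      using tg unfolding isotropic_def totally_geodesic_def by (intro exI[of _ "\<lambda>p. 0"]) simp
  qed
qed

end
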